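(* For a prime $p$ and an integer $n\ge 2$, let $$B_{n,p}=\mathbb{F}_p[x_1,\ldots,x_n,y_1,\ldots,y_n]/(x_1\cdots x_n-y_1\cdots y_n).$$ Then for every prime $p$ and every integer $n\ge 2$, $$s(B_{n,p})=\frac{(n!)^2}{(2n-1)!},$$ where $s(\cdot)$ denotes the $F$-signature at the homogeneous maximal ideal.
   Context: Let $(R,\mathfrak m,k)$ be a $d$-dimensional $F$-finite Noetherian local domain of characteristic $p>0$ with perfect residue field $k$. For $e\ge 1$ let $F^e_*R$ denote $R$ viewed as an $R$-module via the $e$-th iterate of Frobenius ($r\cdot F^e_*x=F^e_*(r^{p^e}x)$); $F$-finite means $F_*R$ is a finitely generated $R$-module. Write $F^e_*R\cong R^{\oplus a_e(R)}\oplus M_e$ with $M_e$ having no nonzero free direct summand. The $F$-signature of $R$ is $s(R)=\lim_{e\to\infty} a_e(R)/p^{ed}$ (the limit exists by a theorem of Tucker). For a standard graded ring $R$ with $R_0=k$, $s(R)$ denotes the $F$-signature of the localization of $R$ at its homogeneous maximal ideal (generated by the images of the variables). *)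

theory Defs
  imports "HOL-Algebra.Indexed_Polynomials" "HOL-Number_Theory.Residues"
    "HOL-Library.Extended_Nat"
begin

section \<open>Modules\<close>

definition module_iso ::
  "('a, 'r) ring_scheme \<Rightarrow> ('a, 'b, 'm) module_scheme \<Rightarrow> ('a, 'c, 'n) module_scheme \<Rightarrow> ('b \<Rightarrow> 'c) set"
  where "module_iso R M N =
    {h. bij_betw h (carrier M) (carrier N) \<and>
        (\<forall>x\<in>carrier M. \<forall>y\<in>carrier M. h (x \<oplus>\<^bsub>M\<^esub> y) = h x \<oplus>\<^bsub>N\<^esub> h y) \<and>
        (\<forall>r\<in>carrier R. \<forall>x\<in>carrier M. h (r \<odot>\<^bsub>M\<^esub> x) = r \<odot>\<^bsub>N\<^esub> h x)}"

text \<open>The free module of rank \<open>a\<close>. The multiplicative fields of a module record carry no meaning.\<close>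

definition free_module :: "('a, 'r) ring_scheme \<Rightarrow> nat \<Rightarrow> ('a, nat \<Rightarrow> 'a) module"
  where "free_module R a =
    \<lparr>carrier = {..<a} \<rightarrow>\<^sub>E carrier R, monoid.mult = undefined, one = undefined,
     zero = (\<lambda>i\<in>{..<a}. \<zero>\<^bsub>R\<^esub>), add = (\<lambda>v w. \<lambda>i\<in>{..<a}. v i \<oplus>\<^bsub>R\<^esub> w i),
     smult = (\<lambda>r v. \<lambda>i\<in>{..<a}. r \<otimes>\<^bsub>R\<^esub> v i)\<rparr>"

definition free_of_rank :: "('a, 'r) ring_scheme \<Rightarrow> ('a, 'b, 'm) module_scheme \<Rightarrow> nat \<Rightarrow> bool"
  where "free_of_rank R M a \<longleftrightarrow> module_iso R (free_module R a) M \<noteq> {}"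

definition direct_decomp ::
  "('a, 'r) ring_scheme \<Rightarrow> ('a, 'b, 'm) module_scheme \<Rightarrow> 'b set \<Rightarrow> 'b set \<Rightarrow> bool"
  where "direct_decomp R M N N' \<longleftrightarrow>
    submodule N R M \<and> submodule N' R M \<and> N <+>\<^bsub>M\<^esub> N' = carrier M \<and> N \<inter> N' = {\<zero>\<^bsub>M\<^esub>}"

definition has_free_summand :: "('a, 'r) ring_scheme \<Rightarrow> ('a, 'b, 'm) module_scheme \<Rightarrow> bool"
  where "has_free_summand R M \<longleftrightarrow>
    (\<exists>N N' b. direct_decomp R M N N' \<and> b > 0 \<and> free_of_rank R (M\<lparr>carrier := N\<rparr>) b)"

text \<open>The rank \<open>a\<close> of the free part in a decomposition of \<open>M\<close> as a free module of rank \<open>a\<close> plus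
  a module without nonzero free direct summand. Over a local ring, \<open>a\<close> does not depend on the
  decomposition, and a finitely generated module over a Noetherian local ring has one.\<close>

definition free_rank :: "('a, 'r) ring_scheme \<Rightarrow> ('a, 'b, 'm) module_scheme \<Rightarrow> nat"
  where "free_rank R M = (THE a. \<exists>N N'. direct_decomp R M N N' \<and>
    free_of_rank R (M\<lparr>carrier := N\<rparr>) a \<and> \<not> has_free_summand R (M\<lparr>carrier := N'\<rparr>))"


section \<open>F-signature\<close>

definition krull_dim :: "('a, 'r) ring_scheme \<Rightarrow> enat"
  where "krull_dim R = (SUP l\<in>{l. \<exists>P :: nat \<Rightarrow> 'a set.
    (\<forall>i\<le>l. primeideal (P i) R) \<and> (\<forall>i<l. P i \<subset> P (Suc i))}. enat l)"

definition frob_pushforward :: "nat \<Rightarrow> nat \<Rightarrow> ('a, 'r) ring_scheme \<Rightarrow> ('a, 'a) module"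
  where "frob_pushforward p e R =
    \<lparr>carrier = carrier R, monoid.mult = monoid.mult R, one = \<one>\<^bsub>R\<^esub>, zero = \<zero>\<^bsub>R\<^esub>, add = add R,
     smult = (\<lambda>r x. (r [^]\<^bsub>R\<^esub> (p ^ e)) \<otimes>\<^bsub>R\<^esub> x)\<rparr>"

text \<open>Meant for an F-finite Noetherian local domain \<open>R\<close> of characteristic \<open>p\<close> with perfect
  residue field. Then the Krull dimension is finite and the limit exists.\<close>

definition F_signature :: "nat \<Rightarrow> ('a, 'r) ring_scheme \<Rightarrow> real"
  where "F_signature p R =
    lim (\<lambda>e. real (free_rank R (frob_pushforward p e R)) / real p ^ (e * the_enat (krull_dim R)))"


section \<open>Localization\<close>

text \<open>The fraction \<open>a / s\<close>, as an equivalence class of numerator-denominator pairs. The set \<open>S\<close>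
  of denominators is multiplicatively closed but may contain zero divisors, hence the factor \<open>u\<close>.\<close>

definition fraction :: "('a, 'r) ring_scheme \<Rightarrow> 'a set \<Rightarrow> 'a \<Rightarrow> 'a \<Rightarrow> ('a \<times> 'a) set"
  where "fraction R S a s =
    {(b, t). b \<in> carrier R \<and> t \<in> S \<and> (\<exists>u\<in>S. u \<otimes>\<^bsub>R\<^esub> (t \<otimes>\<^bsub>R\<^esub> a) = u \<otimes>\<^bsub>R\<^esub> (s \<otimes>\<^bsub>R\<^esub> b))}"

text \<open>As for \<^const>\<open>FactRing\<close>, operations on classes are unions over all representatives; all
  members of such a union are equal.\<close>

definition localization :: "('a, 'r) ring_scheme \<Rightarrow> 'a set \<Rightarrow> ('a \<times> 'a) set ring"
  where "localization R S =
    \<lparr>carrier = {fraction R S a s | a s. a \<in> carrier R \<and> s \<in> S},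
     monoid.mult = (\<lambda>A B. \<Union>(a, s)\<in>A. \<Union>(b, t)\<in>B. fraction R S (a \<otimes>\<^bsub>R\<^esub> b) (s \<otimes>\<^bsub>R\<^esub> t)),
     one = fraction R S \<one>\<^bsub>R\<^esub> \<one>\<^bsub>R\<^esub>,
     zero = fraction R S \<zero>\<^bsub>R\<^esub> \<one>\<^bsub>R\<^esub>,
     add = (\<lambda>A B. \<Union>(a, s)\<in>A. \<Union>(b, t)\<in>B.
       fraction R S ((t \<otimes>\<^bsub>R\<^esub> a) \<oplus>\<^bsub>R\<^esub> (s \<otimes>\<^bsub>R\<^esub> b)) (s \<otimes>\<^bsub>R\<^esub> t))\<rparr>"

definition localization_at :: "('a, 'r) ring_scheme \<Rightarrow> 'a set \<Rightarrow> ('a \<times> 'a) set ring"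
  where "localization_at R P = localization R (carrier R - P)"


section \<open>The hypersurfaces\<close>

text \<open>The polynomial ring over \<open>K\<close> in variables indexed by \<open>I\<close>: monomials are multisets of
  variables, and multiplication is convolution.\<close>

definition indexed_poly_ring :: "('a, 'r) ring_scheme \<Rightarrow> 'c set \<Rightarrow> ('c multiset \<Rightarrow> 'a) ring"
  where "indexed_poly_ring K I =
    \<lparr>carrier = ring.indexed_pset K I (carrier K),
     monoid.mult = (\<lambda>P Q m. \<Oplus>\<^bsub>K\<^esub>a\<in>{a. a \<subseteq># m}. P a \<otimes>\<^bsub>K\<^esub> Q (m - a)),
     one = ring.indexed_const K \<one>\<^bsub>K\<^esub>,
     zero = ring.indexed_const K \<zero>\<^bsub>K\<^esub>,
     add = ring.indexed_padd K\<rparr>"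

text \<open>The variables \<open>x\<^sub>1, \<dots>, x\<^sub>n\<close> are indexed by \<open>Inl 1, \<dots>, Inl n\<close> and
  \<open>y\<^sub>1, \<dots>, y\<^sub>n\<close> by \<open>Inr 1, \<dots>, Inr n\<close>.\<close>

definition B_vars :: "nat \<Rightarrow> (nat + nat) set"
  where "B_vars n = {1..n} <+> {1..n}"

definition B_var :: "nat \<Rightarrow> nat + nat \<Rightarrow> (nat + nat) multiset \<Rightarrow> int"
  where "B_var p v = ring.indexed_var (residue_ring (int p)) v"

definition B_poly :: "nat \<Rightarrow> nat \<Rightarrow> ((nat + nat) multiset \<Rightarrow> int) ring"
  where "B_poly n p = indexed_poly_ring (residue_ring (int p)) (B_vars n)"

definition B_ideal :: "nat \<Rightarrow> nat \<Rightarrow> ((nat + nat) multiset \<Rightarrow> int) set"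
  where "B_ideal n p = Idl\<^bsub>B_poly n p\<^esub>
    {(\<Otimes>\<^bsub>B_poly n p\<^esub>i\<in>{1..n}. B_var p (Inl i)) \<ominus>\<^bsub>B_poly n p\<^esub>
     (\<Otimes>\<^bsub>B_poly n p\<^esub>i\<in>{1..n}. B_var p (Inr i))}"

definition B_ring :: "nat \<Rightarrow> nat \<Rightarrow> ((nat + nat) multiset \<Rightarrow> int) set ring"
  where "B_ring n p = B_poly n p Quot B_ideal n p"

definition B_max :: "nat \<Rightarrow> nat \<Rightarrow> ((nat + nat) multiset \<Rightarrow> int) set set"
  where "B_max n p = Idl\<^bsub>B_ring n p\<^esub>
    ((\<lambda>v. B_ideal n p +>\<^bsub>B_poly n p\<^esub> B_var p v) ` B_vars n)"

end

theory Submission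
  imports Defs "HOL-Library.Poly_Mapping" "HOL-Library.Product_Lexorder"
begin

text \<open>
  The hypersurface is toric, and for a toric ring the F-signature is the volume of a polytope.
  Arrange variables \<open>t\<^sub>i\<^sub>j\<close> in an \<open>n\<close> by \<open>n\<close> matrix and send \<open>x\<^sub>i\<close> to the product of row \<open>i\<close> and
  \<open>y\<^sub>j\<close> to the product of column \<open>j\<close>. Both products of all the \<open>x\<^sub>i\<close> and of all the \<open>y\<^sub>j\<close> become
  the product of the whole matrix, and nothing else is identified (\<open>proj_eq_iff\<close>). So \<open>B\<close> is the
  span of the monomials \<open>t\<^sup>v\<close> whose exponent matrices have the form \<open>v\<^sub>i\<^sub>j = a\<^sub>i + b\<^sub>j\<close>. These matrices
  form a semigroup that is cut out of a lattice of rank \<open>2n - 1\<close> by the inequalities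
  \<open>v\<^sub>i\<^sub>j \<ge> 0\<close>; in particular it is saturated.

  Put \<open>q = p\<^sup>e\<close>. Since \<open>q\<close>-th powers of monomials only shift exponents by multiples of \<open>q\<close>, the
  pushforward of \<open>R\<close> along the \<open>e\<close>-th Frobenius is the direct sum of pieces of rank one, one for each class of
  exponents modulo \<open>q\<close>. If a class contains a matrix with all entries below \<open>q\<close>, every other
  member of the class exceeds it by \<open>q\<close> times a member of the semigroup, so the piece is free. In the
  other classes every member has an entry \<open>v\<^sub>i\<^sub>j \<ge> q\<close>, and it stays in the semigroup when multiplied
  by the \<open>q\<close>-th power of the Laurent monomial whose exponents are \<open>-1\<close> at \<open>(i, j)\<close> and \<open>0\<close> or \<open>1\<close>
  elsewhere (\<open>nonfree_exps_move\<close>); so none of the monomials generates its piece, and no linear form on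
  these pieces takes a unit as value (\<open>nonfree_form_nonunit\<close>). Hence the free rank is the number
  of exponent matrices with entries below \<open>q\<close> (\<open>free_rank_push\<close>). That this number does not
  depend on the decomposition follows by counting modulo the maximal ideal, since the residue
  field is finite (\<open>free_rank_eqI\<close>).

  With \<open>min a = 0\<close> the pair \<open>(a, b)\<close> is unique and the condition is \<open>max a + max b < q\<close>. Sorting by
  \<open>max b\<close> makes the number a convolution of the sequence \<open>(k + 1)\<^sup>n - k\<^sup>n\<close> with itself. As this sequence
  is close to \<open>n! \<cdot> (k choose (n - 1))\<close>, Vandermonde's identity gives \<open>(n!)\<^sup>2 (q choose (2n - 1))\<close> to
  leading order, which is \<open>(n!)\<^sup>2 / (2n - 1)!\<close> times \<open>q\<close> to the power \<open>2n - 1\<close>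
  (\<open>card_small_exps_limit\<close>).

  It remains to see that \<open>2n - 1\<close> is the dimension. Setting the entries of the first row and column to zero one
  after the other gives a chain of faces of the semigroup, hence of monomial primes
  (\<open>long_chain\<close>). Conversely, from a chain of \<open>l\<close> strict inclusions one obtains, for every \<open>N\<close>, a set of
  \<open>p\<close> to the power \<open>(N + 1)\<^sup>l\<close> elements whose numerators and denominators have degree \<open>O(N)\<close>, while there are only
  \<open>O(N)\<close> to the power \<open>2n - 1\<close> exponents of that size (\<open>chain_length_le\<close>).

  The prime \<open>p\<close> is a variable, so all computations take place in polynomial rings over the integers,
  where the type class \<open>comm_ring_1\<close> is available, and equality is replaced by congruence of
  coefficients modulo \<open>p\<close>. The locale \<open>toric_local_ring\<close> collects the properties of the local
  ring on which the argument rests; the last two parts show that the localization of \<open>B\<close> has them.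
\<close>

section \<open>Integer polynomials modulo p\<close>

abbreviation coef :: "('a \<Rightarrow>\<^sub>0 'b::zero) \<Rightarrow> 'a \<Rightarrow> 'b"
  where "coef \<equiv> Poly_Mapping.lookup"

abbreviation supp :: "('a \<Rightarrow>\<^sub>0 'b::zero) \<Rightarrow> 'a set"
  where "supp \<equiv> Poly_Mapping.keys"

definition vanishes_mod :: "nat \<Rightarrow> ('a \<Rightarrow>\<^sub>0 int) \<Rightarrow> bool"
  where "vanishes_mod p g \<longleftrightarrow> (\<forall>u. int p dvd coef g u)"

lemma lookup_of_nat_mult:
  fixes h :: "'a::comm_monoid_add \<Rightarrow>\<^sub>0 int"
  shows "coef (of_nat p * h) u = int p * coef h u"
  by (induction p) (simp_all add: algebra_simps lookup_add)

lemma vanishes_mod_iff_dvd: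
  fixes g :: "'a::comm_monoid_add \<Rightarrow>\<^sub>0 int"
  shows "vanishes_mod p g \<longleftrightarrow> of_nat p dvd g"
proof
  assume g: "vanishes_mod p g"
  have fin: "finite {u. coef g u div int p \<noteq> 0}"
    by (rule finite_subset[of _ "{u. coef g u \<noteq> 0}"]) auto
  have "g = of_nat p * Abs_poly_mapping (\<lambda>u. coef g u div int p)"
    by (rule poly_mapping_eqI) (use g fin in \<open>simp add: lookup_of_nat_mult vanishes_mod_def\<close>)
  then show "of_nat p dvd g" by (rule dvdI)
next
  assume "of_nat p dvd g"
  then obtain h where "g = of_nat p * h" by (auto elim: dvdE)
  then show "vanishes_mod p g" by (simp add: vanishes_mod_def lookup_of_nat_mult)
qed

lemma vanishes_mod_zero [simp]: "vanishes_mod p 0"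
  by (simp add: vanishes_mod_def)

lemma vanishes_mod_add: "vanishes_mod p f \<Longrightarrow> vanishes_mod p g \<Longrightarrow> vanishes_mod p (f + g)"
  by (simp add: vanishes_mod_def lookup_add)

lemma vanishes_mod_diff: "vanishes_mod p f \<Longrightarrow> vanishes_mod p g \<Longrightarrow> vanishes_mod p (f - g)"
  by (simp add: vanishes_mod_def lookup_minus)

lemma vanishes_mod_mult:
  fixes f g :: "'a::comm_monoid_add \<Rightarrow>\<^sub>0 int"
  assumes "vanishes_mod p g"
  shows "vanishes_mod p (f * g)" "vanishes_mod p (g * f)"
  using assms by (simp_all add: vanishes_mod_iff_dvd)

lemma lookup_times_unfold:
  fixes f g :: "'a::comm_monoid_add \<Rightarrow>\<^sub>0 int"
  shows "coef (f * g) k = (\<Sum>(a, b) | a \<in> supp f \<and> b \<in> supp g \<and> k = a + b. coef f a * coef g b)"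
proof -
  have "coef (f * g) k = (\<Sum>(a, b). coef f a * coef g b when k = a + b)"
    unfolding times_poly_mapping.rep_eq by (rule prod_fun_unfold_prod) auto
  also have "\<dots> = (\<Sum>x\<in>supp f \<times> supp g. case x of (a, b) \<Rightarrow> coef f a * coef g b when k = a + b)"
    by (rule Sum_any.expand_superset) (auto simp: in_keys_iff)
  also have "\<dots> = (\<Sum>x\<in>{(a, b). a \<in> supp f \<and> b \<in> supp g \<and> k = a + b}.
      case x of (a, b) \<Rightarrow> coef f a * coef g b)"
    by (rule sum.mono_neutral_cong_right)
      (auto simp: when_def split: if_splits intro: finite_subset[of _ "supp f \<times> supp g"])
  finally show ?thesis .
qed

lemma finite_keys_pairs: "finite {(a, b). a \<in> supp f \<and> b \<in> supp g \<and> P a b}"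
  by (rule finite_subset[of _ "supp f \<times> supp g"]) auto

text \<open>Modulo \<open>p\<close>, a coefficient of a product is a single product of coefficients as soon as all
  other ways to split its exponent contribute multiples of \<open>p\<close>. Taking \<open>0\<close> for \<open>p\<close> turns the
  congruence into an equation.\<close>

lemma lookup_times_split:
  fixes f g :: "'a::comm_monoid_add \<Rightarrow>\<^sub>0 int"
  assumes "\<And>a b. a \<in> supp f \<Longrightarrow> b \<in> supp g \<Longrightarrow> k = a + b \<Longrightarrow> (a, b) \<noteq> (a0, b0) \<Longrightarrow>
     int p dvd coef f a * coef g b"
    and k: "k = a0 + b0"
  shows "int p dvd coef (f * g) k - coef f a0 * coef g b0"
proof -
  let ?A = "{(a, b). a \<in> supp f \<and> b \<in> supp g \<and> k = a + b}"
  have fin: "finite ?A" by (rule finite_keys_pairs)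
  have *: "coef (f * g) k = (\<Sum>x\<in>insert (a0,b0) ?A. case x of (a, b) \<Rightarrow> coef f a * coef g b)"
    unfolding lookup_times_unfold using k
    by (intro sum.mono_neutral_left) (use fin in \<open>auto simp: in_keys_iff\<close>)
  have "coef (f * g) k = coef f a0 * coef g b0 +
     (\<Sum>x\<in>?A - {(a0,b0)}. case x of (a, b) \<Rightarrow> coef f a * coef g b)"
    unfolding * using sum.remove[of "insert (a0,b0) ?A" "(a0,b0)" "\<lambda>x. case x of (a, b) \<Rightarrow> coef f a * coef g b"] fin
    by simp
  moreover have "int p dvd (\<Sum>x\<in>?A - {(a0,b0)}. case x of (a, b) \<Rightarrow> coef f a * coef g b)"
    by (rule dvd_sum) (use assms(1) in auto)
  ultimately show ?thesis by simp
qed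

lemma lookup_frag_of_times:
  fixes g :: "'a::cancel_comm_monoid_add \<Rightarrow>\<^sub>0 int"
  shows "coef (frag_of a * g) (a + b) = coef g b"
proof -
  have "int 0 dvd coef (frag_of a * g) (a + b) - coef (frag_of a) a * coef g b"
    by (rule lookup_times_split) auto
  then show ?thesis by simp
qed

lemma keys_frag_of_times:
  fixes g :: "'a::cancel_comm_monoid_add \<Rightarrow>\<^sub>0 int"
  shows "supp (frag_of a * g) = (+) a ` supp g"
proof
  show "supp (frag_of a * g) \<subseteq> (+) a ` supp g"
    using keys_mult[of "frag_of a" g] by auto
  show "(+) a ` supp g \<subseteq> supp (frag_of a * g)"
    by (auto simp: in_keys_iff lookup_frag_of_times)
qed

text \<open>Gauss: a prime stays prime in the polynomial ring. The smallest exponents at which \<open>f\<close> and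
  \<open>g\<close> are nonzero modulo \<open>p\<close> add up to an exponent of \<open>f * g\<close> that arises in only one way. This is
  why the exponents carry a linear order.\<close>

lemma vanishes_mod_prime:
  fixes f g :: "'a::{ordered_cancel_comm_monoid_add, linorder} \<Rightarrow>\<^sub>0 int"
  assumes p: "prime p" and fg: "vanishes_mod p (f * g)"
  shows "vanishes_mod p f \<or> vanishes_mod p g"
proof (rule ccontr)
  assume neg: "\<not> ?thesis"
  define A where "A = {a. \<not> int p dvd coef f a}"
  define B where "B = {a. \<not> int p dvd coef g a}"
  have A: "A \<subseteq> supp f" "finite A" "A \<noteq> {}"
  proof -
    show "A \<subseteq> supp f" by (auto simp: A_def in_keys_iff)
    then show "finite A" by (rule finite_subset) simp
    show "A \<noteq> {}" using neg by (auto simp: A_def vanishes_mod_def)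
  qed
  have B: "B \<subseteq> supp g" "finite B" "B \<noteq> {}"
  proof -
    show "B \<subseteq> supp g" by (auto simp: B_def in_keys_iff)
    then show "finite B" by (rule finite_subset) simp
    show "B \<noteq> {}" using neg by (auto simp: B_def vanishes_mod_def)
  qed
  define a0 where "a0 = Min A"
  define b0 where "b0 = Min B"
  have "int p dvd coef (f * g) (a0 + b0) - coef f a0 * coef g b0"
  proof (rule lookup_times_split)
    fix a b assume ab: "a0 + b0 = a + b" "(a, b) \<noteq> (a0, b0)"
    show "int p dvd coef f a * coef g b"
    proof (rule ccontr)
      assume "\<not> int p dvd coef f a * coef g b"
      then have "a \<in> A" "b \<in> B" by (auto simp: A_def B_def)
      then have "a0 \<le> a" "b0 \<le> b" using A B by (auto simp: a0_def b0_def)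
      with ab show False
        by (metis add_less_le_mono add_le_less_mono order_less_irrefl order_le_less)
    qed
  qed simp
  moreover have "int p dvd coef (f * g) (a0 + b0)"
    using fg by (simp add: vanishes_mod_def)
  ultimately have "int p dvd coef f a0 * coef g b0"
    using dvd_diff_right_iff by (metis dvd_diff diff_diff_eq2 add_diff_cancel_left')
  moreover have "a0 \<in> A" "b0 \<in> B" using A B by (auto simp: a0_def b0_def)
  ultimately show False
    using p prime_dvd_multD[of "int p" "coef f a0" "coef g b0"] by (auto simp: A_def B_def)
qed

lemma lookup_times_zero:
  fixes f g :: "('k \<Rightarrow>\<^sub>0 nat) \<Rightarrow>\<^sub>0 int"
  shows "coef (f * g) 0 = coef f 0 * coef g 0"
proof -
  have z: "a = 0 \<and> b = 0" if "0 = a + b" for a b :: "'k \<Rightarrow>\<^sub>0 nat"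
  proof -
    have "coef a k = 0 \<and> coef b k = 0" for k
      using arg_cong[OF that, of "\<lambda>m. coef m k"] by (simp add: lookup_add)
    then show ?thesis by (auto intro: poly_mapping_eqI)
  qed
  have "int 0 dvd coef (f * g) 0 - coef f 0 * coef g 0"
    by (rule lookup_times_split) (blast dest: z, simp)
  then show ?thesis by simp
qed

section \<open>Linear extension of maps of monomials\<close>

lemma frag_cmul_conv_mult:
  fixes h :: "'a::comm_monoid_add \<Rightarrow>\<^sub>0 int"
  shows "frag_cmul c h = of_int c * h"
proof (cases c rule: int_cases2)
  case (nonneg n) then show ?thesis by (simp add: poly_mapping_eqI lookup_of_nat_mult)
next
  case (nonpos n) then show ?thesis by (simp add: poly_mapping_eqI lookup_of_nat_mult)
qed

lemma frag_of_mult: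
  fixes a b :: "'a::comm_monoid_add"
  shows "frag_of a * frag_of b = frag_of (a + b)"
  by (simp add: mult_single)

lemma frag_extend_mult:
  fixes f :: "'a::comm_monoid_add \<Rightarrow> ('b::comm_monoid_add) \<Rightarrow>\<^sub>0 int"
  assumes "\<And>a b. f (a + b) = f a * f b"
  shows "frag_extend f (g * h) = frag_extend f g * frag_extend f h"
proof -
  have 1: "frag_extend f (frag_of a * h) = f a * frag_extend f h" for a
    using subset_UNIV
  proof (induction h rule: frag_induction)
    case (one b) then show ?case by (simp add: frag_of_mult assms del: single_one)
  qed (simp_all add: frag_extend_diff right_diff_distrib)
  show ?thesis
    using subset_UNIV
    by (induction g rule: frag_induction)
      (simp_all add: 1 frag_extend_diff left_diff_distrib)
qed

lemma lookup_frag_extend: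
  "coef (frag_extend f x) u = (\<Sum>i\<in>supp x. coef x i * coef (f i) u)"
  by (simp add: frag_extend_def lookup_sum)

lemma lookup_frag_extend_inj:
  assumes "inj f"
  shows "coef (frag_extend (\<lambda>u. frag_of (f u)) g) (f u) = coef g u"
proof -
  have "coef (frag_extend (\<lambda>u. frag_of (f u)) g) (f u) = (\<Sum>i\<in>supp g. if i = u then coef g i else 0)"
    unfolding lookup_frag_extend
    by (rule sum.cong) (use assms in \<open>auto simp: lookup_single when_def dest: injD\<close>)
  then show ?thesis by (simp add: in_keys_iff)
qed

lemma keys_frag_extend_of: "supp (frag_extend (\<lambda>u. frag_of (f u)) g) \<subseteq> f ` supp g"
  using keys_frag_extend[of "\<lambda>u. frag_of (f u)" g] by auto

section \<open>The Frobenius power of a polynomial\<close>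

text \<open>The binomial coefficients strictly between the ends of row \<open>p\<close> are multiples of \<open>p\<close>; the
  statement for \<open>p ^ e\<close> follows because congruent elements have congruent \<open>p\<close>-th powers.\<close>

lemma freshman_dream:
  fixes x y :: "'a::comm_ring_1"
  assumes p: "prime p"
  shows "of_nat p dvd (x + y) ^ p ^ e - x ^ p ^ e - y ^ p ^ e"
proof (induction e)
  case 0 show ?case by simp
next
  have base: "of_nat p dvd (x + y) ^ p - x ^ p - y ^ p" for x y :: 'a
  proof -
    have p1: "p \<ge> 2" using p by (rule prime_ge_2_nat)
    have "(x + y) ^ p = (\<Sum>k\<le>p. of_nat (p choose k) * x ^ k * y ^ (p - k))"
      by (rule binomial_ring)
    also have "{..p} = insert 0 (insert p {0<..<p})" using p1 by auto
    finally have "(x + y) ^ p - x ^ p - y ^ p = (\<Sum>k\<in>{0<..<p}. of_nat (p choose k) * x ^ k * y ^ (p - k))"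
      using p1 by simp
    also have "of_nat p dvd \<dots>"
    proof (rule dvd_sum)
      fix k assume "k \<in> {0<..<p}"
      then have "p dvd (p choose k)" using p by (intro dvd_choose_prime) auto
      then obtain c where "p choose k = p * c" by (auto elim: dvdE)
      then show "of_nat p dvd (of_nat (p choose k) * x ^ k * y ^ (p - k) :: 'a)"
        by (simp add: mult.assoc)
    qed
    finally show ?thesis .
  qed
  case (Suc e)
  let ?q = "p ^ e"
  have cong: "of_nat p dvd a ^ p - b ^ p" if "of_nat p dvd a - b" for a b :: 'a
    using that by (simp add: power_diff_sumr2)
  have "of_nat p dvd (x + y) ^ ?q - (x ^ ?q + y ^ ?q)"
    using Suc by (simp add: algebra_simps)
  from cong[OF this] base[of "x ^ ?q" "y ^ ?q"]
  have "of_nat p dvd (((x + y) ^ ?q) ^ p - (x ^ ?q + y ^ ?q) ^ p) + ((x ^ ?q + y ^ ?q) ^ p - (x ^ ?q) ^ p - (y ^ ?q) ^ p)"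
    by (rule dvd_add)
  then show ?case by (simp add: power_mult[symmetric] mult.commute algebra_simps)
qed

definition scale_exp :: "nat \<Rightarrow> ('k \<Rightarrow>\<^sub>0 nat) \<Rightarrow> ('k \<Rightarrow>\<^sub>0 nat)"
  where "scale_exp q u = Poly_Mapping.map ((*) q) u"

lemma lookup_scale_exp [simp]: "coef (scale_exp q u) k = q * coef u k"
  by (simp add: scale_exp_def Poly_Mapping.map.rep_eq when_def)

lemma scale_exp_add: "scale_exp q (u + v) = scale_exp q u + scale_exp q v"
  by (rule poly_mapping_eqI) (simp add: lookup_add algebra_simps)

lemma scale_exp_zero [simp]: "scale_exp q 0 = 0"
  by (rule poly_mapping_eqI) simp

lemma inj_scale_exp: "q > 0 \<Longrightarrow> inj (scale_exp q)"
  by (rule injI, rule poly_mapping_eqI) (metis lookup_scale_exp mult_left_cancel less_irrefl)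

lemma frag_of_power: "frag_of u ^ q = frag_of (scale_exp q u)"
proof (induction q)
  case 0
  have "scale_exp 0 u = 0" by (rule poly_mapping_eqI) simp
  then show ?case by simp
next
  case (Suc q)
  have "scale_exp (Suc q) u = u + scale_exp q u" by (rule poly_mapping_eqI) (simp add: lookup_add)
  then show ?case by (simp add: Suc frag_of_mult)
qed

text \<open>Congruent modulo \<open>p\<close> to the \<open>q\<close>-th power when \<open>q\<close> is a power of \<open>p\<close>; unlike the power it is
  additive on the nose and its support consists of multiples of \<open>q\<close>.\<close>

definition frob :: "nat \<Rightarrow> (('k \<Rightarrow>\<^sub>0 nat) \<Rightarrow>\<^sub>0 int) \<Rightarrow> ('k \<Rightarrow>\<^sub>0 nat) \<Rightarrow>\<^sub>0 int"
  where "frob q = frag_extend (\<lambda>u. frag_of (scale_exp q u))"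

lemma lookup_frob: "q > 0 \<Longrightarrow> coef (frob q g) (scale_exp q u) = coef g u"
  unfolding frob_def by (intro lookup_frag_extend_inj inj_scale_exp)

lemma keys_frob: "supp (frob q g) \<subseteq> scale_exp q ` supp g"
  unfolding frob_def by (rule keys_frag_extend_of)

lemma frob_cong:
  fixes g :: "('k \<Rightarrow>\<^sub>0 nat) \<Rightarrow>\<^sub>0 int"
  assumes p: "prime p"
  shows "vanishes_mod p (g ^ p ^ e - frob (p ^ e) g)"
  unfolding vanishes_mod_iff_dvd
  using subset_UNIV
proof (induction g rule: frag_induction)
  case zero
  then show ?case using prime_gt_0_nat[OF p] by (simp add: frob_def power_0_left)
next
  case (one u)
  then show ?case by (simp add: frob_def frag_of_power)
next
  case (diff f g)
  let ?q = "p ^ e"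
  have "of_nat p dvd ((f - g) + g) ^ ?q - (f - g) ^ ?q - g ^ ?q"
    by (rule freshman_dream[OF p])
  then have 1: "of_nat p dvd f ^ ?q - (f - g) ^ ?q - g ^ ?q" by simp
  have "(f - g) ^ ?q - frob ?q (f - g) =
     (f ^ ?q - frob ?q f) - (g ^ ?q - frob ?q g) - (f ^ ?q - (f - g) ^ ?q - g ^ ?q)"
    by (simp add: frob_def frag_extend_diff)
  then show ?case using diff 1 by (metis dvd_diff)
qed

section \<open>The exponent semigroup\<close>

type_synonym expo = "(nat \<times> nat) \<Rightarrow>\<^sub>0 nat"

text \<open>The exponent matrix of the image of the monomial with \<open>x\<close>-exponents \<open>a\<close> and \<open>y\<close>-exponents
  \<open>b\<close>.\<close>

definition outer_sum :: "nat \<Rightarrow> (nat \<Rightarrow> nat) \<Rightarrow> (nat \<Rightarrow> nat) \<Rightarrow> expo"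
  where "outer_sum n a b =
    Abs_poly_mapping (\<lambda>(i, j). if i \<in> {1..n} \<and> j \<in> {1..n} then a i + b j else 0)"

lemma lookup_outer_sum:
  "coef (outer_sum n a b) (i, j) = (if i \<in> {1..n} \<and> j \<in> {1..n} then a i + b j else 0)"
proof -
  have "{x. (case x of (i, j) \<Rightarrow> if i \<in> {1..n} \<and> j \<in> {1..n} then a i + b j else 0) \<noteq> 0}
    \<subseteq> {1..n} \<times> {1..n}" by (auto split: if_splits)
  then have "finite {x. (case x of (i, j) \<Rightarrow> if i \<in> {1..n} \<and> j \<in> {1..n} then a i + b j else 0) \<noteq> 0}"
    by (rule finite_subset) simp
  then show ?thesis by (simp add: outer_sum_def)
qed

lemma expo_eqI: "(\<And>i j. coef u (i, j) = coef v (i, j)) \<Longrightarrow> u = (v :: expo)"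
  by (rule poly_mapping_eqI) auto

definition toric_exps :: "nat \<Rightarrow> expo set"
  where "toric_exps n = {outer_sum n a b | a b. True}"

lemma outer_sum_in_toric_exps [simp]: "outer_sum n a b \<in> toric_exps n"
  by (auto simp: toric_exps_def)

lemma toric_exps_outside:
  "v \<in> toric_exps n \<Longrightarrow> \<not> (i \<in> {1..n} \<and> j \<in> {1..n}) \<Longrightarrow> coef v (i, j) = 0"
  by (auto simp: toric_exps_def lookup_outer_sum)

lemma toric_exps_exchange:
  assumes "v \<in> toric_exps n" "i \<in> {1..n}" "j \<in> {1..n}" "k \<in> {1..n}" "l \<in> {1..n}"
  shows "coef v (i, j) + coef v (k, l) = coef v (i, l) + coef v (k, j)"
  using assms by (auto simp: toric_exps_def lookup_outer_sum)

text \<open>The lattice spanned by the semigroup is given by the exchange equations between the entries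
  of two rows and two columns; every nonnegative point of it lies in the semigroup.\<close>

lemma toric_expsI:
  assumes out: "\<And>i j. \<not> (i \<in> {1..n} \<and> j \<in> {1..n}) \<Longrightarrow> coef v (i, j) = 0"
    and ex: "\<And>i j k l. i \<in> {1..n} \<Longrightarrow> j \<in> {1..n} \<Longrightarrow> k \<in> {1..n} \<Longrightarrow> l \<in> {1..n} \<Longrightarrow>
      coef v (i, j) + coef v (k, l) = coef v (i, l) + coef v (k, j)"
  shows "v \<in> toric_exps n"
proof (cases "n = 0")
  case True
  then have "v = outer_sum n (\<lambda>_. 0) (\<lambda>_. 0)"
    by (intro expo_eqI) (simp add: out lookup_outer_sum)
  then show ?thesis by simp
next
  case False
  \<comment> \<open>The smallest entry of the first column, in row \<open>i0\<close>. With row \<open>i0\<close> as \<open>b\<close>, the differences \<open>a\<close> are nonnegative.\<close>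
  define M where "M = Min ((\<lambda>i. coef v (i, 1)) ` {1..n})"
  have "M \<in> (\<lambda>i. coef v (i, 1)) ` {1..n}"
    unfolding M_def using False by (intro Min_in) auto
  then obtain i0 where i0: "i0 \<in> {1..n}" "M = coef v (i0, 1)" by auto
  have le: "M \<le> coef v (i, 1)" if "i \<in> {1..n}" for i
    unfolding M_def using that by (intro Min_le) auto
  have "v = outer_sum n (\<lambda>i. coef v (i, 1) - M) (\<lambda>j. coef v (i0, j))"
  proof (rule expo_eqI)
    fix i j
    show "coef v (i, j) = coef (outer_sum n (\<lambda>i. coef v (i, 1) - M) (\<lambda>j. coef v (i0, j))) (i, j)"
    proof (cases "i \<in> {1..n} \<and> j \<in> {1..n}")
      case True
      then have "coef v (i, j) + coef v (i0, 1) = coef v (i, 1) + coef v (i0, j)"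
        using i0 False by (intro ex) auto
      then show ?thesis using True le[of i] i0(2) by (simp add: lookup_outer_sum)
    next
      case False
      then show ?thesis by (simp only: lookup_outer_sum out[OF False] if_False)
    qed
  qed
  then show ?thesis by (metis outer_sum_in_toric_exps)
qed

lemma zero_in_toric_exps [simp]: "0 \<in> toric_exps n"
  by (rule toric_expsI) auto

lemma add_in_toric_exps [intro]:
  assumes "u \<in> toric_exps n" "v \<in> toric_exps n"
  shows "u + v \<in> toric_exps n"
proof (rule toric_expsI)
  fix i j k l assume "i \<in> {1..n}" "j \<in> {1..n}" "k \<in> {1..n}" "l \<in> {1..n}"
  then show "coef (u + v) (i, j) + coef (u + v) (k, l) = coef (u + v) (i, l) + coef (u + v) (k, j)"
    using toric_exps_exchange[OF assms(1), of i j k l] toric_exps_exchange[OF assms(2), of i j k l]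
    by (simp add: lookup_add)
qed (use assms in \<open>simp add: lookup_add toric_exps_outside\<close>)

lemma scale_exp_in_toric_exps [intro]:
  assumes "u \<in> toric_exps n"
  shows "scale_exp q u \<in> toric_exps n"
proof (rule toric_expsI)
  fix i j k l assume "i \<in> {1..n}" "j \<in> {1..n}" "k \<in> {1..n}" "l \<in> {1..n}"
  then have "q * (coef u (i, j) + coef u (k, l)) = q * (coef u (i, l) + coef u (k, j))"
    using toric_exps_exchange[OF assms, of i j k l] by simp
  then show "coef (scale_exp q u) (i, j) + coef (scale_exp q u) (k, l) =
      coef (scale_exp q u) (i, l) + coef (scale_exp q u) (k, j)"
    by (simp add: algebra_simps)
qed (use assms in \<open>simp add: toric_exps_outside\<close>)

text \<open>The exchange equations are homogeneous, so they can be divided by \<open>q\<close>. This normality of the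
  semigroup is what makes the pieces described by \<open>free_exps\<close> free.\<close>

lemma toric_exps_saturated:
  assumes s: "s \<in> toric_exps n" "s + scale_exp q w \<in> toric_exps n" and q: "q > 0"
  shows "w \<in> toric_exps n"
proof (rule toric_expsI)
  fix i j assume ij: "\<not> (i \<in> {1..n} \<and> j \<in> {1..n})"
  have "coef s (i, j) + q * coef w (i, j) = 0"
    using toric_exps_outside[OF s(2) ij] by (simp add: lookup_add)
  then show "coef w (i, j) = 0" using q by simp
next
  fix i j k l assume b: "i \<in> {1..n}" "j \<in> {1..n}" "k \<in> {1..n}" "l \<in> {1..n}"
  have "q * (coef w (i, j) + coef w (k, l)) = q * (coef w (i, l) + coef w (k, j))"
    using toric_exps_exchange[OF s(1) b] toric_exps_exchange[OF s(2) b]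
    by (simp add: lookup_add algebra_simps)
  then show "coef w (i, j) + coef w (k, l) = coef w (i, l) + coef w (k, j)"
    using q by simp
qed

lemma toric_exps_cancel:
  assumes "s \<in> toric_exps n" "s + w \<in> toric_exps n"
  shows "w \<in> toric_exps n"
proof -
  have "scale_exp 1 w = w" by (rule poly_mapping_eqI) simp
  then show ?thesis using toric_exps_saturated[of s n 1 w] assms by simp
qed

section \<open>Exponents modulo a Frobenius power\<close>

definition small_exps :: "nat \<Rightarrow> nat \<Rightarrow> expo set"
  where "small_exps n q = {v \<in> toric_exps n. \<forall>i j. coef v (i, j) < q}"

text \<open>By \<open>free_exps_sub\<close>, these are all members of the semigroup that are congruent modulo \<open>q\<close> to
  a member with entries below \<open>q\<close>.\<close>

definition free_exps :: "nat \<Rightarrow> nat \<Rightarrow> expo set"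
  where "free_exps n q = {t + scale_exp q u | t u. t \<in> small_exps n q \<and> u \<in> toric_exps n}"

lemma free_exps_subset: "free_exps n q \<subseteq> toric_exps n"
  by (auto simp: free_exps_def small_exps_def)

lemma small_exps_decomp_unique:
  assumes t: "t \<in> small_exps n q" "t' \<in> small_exps n q"
    and eq: "t + scale_exp q u = t' + scale_exp q u'"
  shows "t = t' \<and> u = u'"
proof -
  have "coef t (i, j) = coef t' (i, j) \<and> coef u (i, j) = coef u' (i, j)" for i j
  proof -
    have lt: "coef t (i, j) < q" "coef t' (i, j) < q" using t by (auto simp: small_exps_def)
    have e: "coef t (i, j) + q * coef u (i, j) = coef t' (i, j) + q * coef u' (i, j)"
      using arg_cong[OF eq, of "\<lambda>m. coef m (i, j)"] by (simp add: lookup_add)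
    then have "(coef t (i, j) + q * coef u (i, j)) mod q = (coef t' (i, j) + q * coef u' (i, j)) mod q"
      by simp
    then have "coef t (i, j) = coef t' (i, j)" using lt by simp
    with e lt show ?thesis by simp
  qed
  then show ?thesis by (auto intro!: expo_eqI)
qed

lemma free_exps_add:
  assumes "v \<in> free_exps n q" "u \<in> toric_exps n"
  shows "v + scale_exp q u \<in> free_exps n q"
proof -
  obtain t w where "t \<in> small_exps n q" "w \<in> toric_exps n" "v = t + scale_exp q w"
    using assms by (auto simp: free_exps_def)
  then have "v + scale_exp q u = t + scale_exp q (w + u)" "w + u \<in> toric_exps n"
    using assms by (auto simp: scale_exp_add add.assoc)
  then show ?thesis using \<open>t \<in> small_exps n q\<close> by (auto simp: free_exps_def)
qed

text \<open>Subtracting multiples of \<open>q\<close> from an exponent cannot cross below the remainders modulo \<open>q\<close>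
  as long as the entries stay nonnegative. So \<open>free_exps\<close> and its complement are both unions of
  congruence classes.\<close>

lemma free_exps_sub:
  assumes v: "v \<in> toric_exps n" and vu: "v + scale_exp q u \<in> free_exps n q" and q: "q > 0"
  shows "v \<in> free_exps n q"
proof -
  obtain t w where t: "t \<in> small_exps n q" and w: "w \<in> toric_exps n"
    and eq: "v + scale_exp q u = t + scale_exp q w"
    using vu by (auto simp: free_exps_def)
  have e: "coef v (i, j) + q * coef u (i, j) = coef t (i, j) + q * coef w (i, j)" for i j
    using arg_cong[OF eq, of "\<lambda>m. coef m (i, j)"] by (simp add: lookup_add)
  have le: "coef u (i, j) \<le> coef w (i, j)" for i j
  proof (rule ccontr)
    assume "\<not> ?thesis"
    then have "q * (coef w (i, j) + 1) \<le> q * coef u (i, j)"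
      by (intro mult_left_mono) auto
    moreover have "coef t (i, j) < q" using t by (auto simp: small_exps_def)
    ultimately show False using e[of i j] by simp
  qed
  have vt: "v = t + scale_exp q (w - u)"
  proof (rule expo_eqI)
    fix i j
    have "q * coef u (i, j) \<le> q * coef w (i, j)" using le by (intro mult_left_mono) auto
    then show "coef v (i, j) = coef (t + scale_exp q (w - u)) (i, j)"
      using e[of i j] by (simp add: lookup_add lookup_minus diff_mult_distrib2)
  qed
  have "t \<in> toric_exps n" using t by (auto simp: small_exps_def)
  then have "w - u \<in> toric_exps n" using v q unfolding vt by (rule toric_exps_saturated)
  then show ?thesis using t vt by (auto simp: free_exps_def)
qed

text \<open>The combinatorial core: an exponent outside \<open>free_exps\<close> has an entry of at least \<open>q\<close>, and
  that entry can be lowered by \<open>q\<close> by passing to \<open>v + q (m1 - m2)\<close>, although \<open>m1 - m2\<close> is not in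
  the semigroup. Therefore the monomial of \<open>v\<close> does not generate its piece of the pushforward.\<close>

lemma nonfree_exps_move:
  assumes v: "v \<in> toric_exps n - free_exps n q" and q: "q > 0"
  obtains v' m1 m2 where "v' \<in> toric_exps n - free_exps n q"
    "m1 \<in> toric_exps n" "m2 \<in> toric_exps n"
    "v' + scale_exp q m2 = v + scale_exp q m1" "\<And>w. m1 \<noteq> m2 + w"
proof -
  have "v \<notin> small_exps n q"
  proof
    assume "v \<in> small_exps n q"
    then have "v + scale_exp q 0 \<in> free_exps n q" unfolding free_exps_def using zero_in_toric_exps by blast
    then show False using v by simp
  qed
  then obtain i j where ij: "coef v (i, j) \<ge> q" using v by (auto simp: small_exps_def not_less)
  have b: "i \<in> {1..n}" "j \<in> {1..n}"
    using toric_exps_outside[of v n i j] ij q v by fastforce+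
  \<comment> \<open>The exponent of \<open>x\<^sub>i\<close>, and below that of the product of all \<open>y\<^sub>l\<close> with \<open>l \<noteq> j\<close>: the entries of \<open>m1 - m2\<close> are \<open>0\<close> or \<open>1\<close> except for \<open>-1\<close> at \<open>(i, j)\<close>.\<close>
  define m2 where "m2 = outer_sum n (\<lambda>k. if k = i then 1 else 0) (\<lambda>_. 0)"
  define m1 where "m1 = outer_sum n (\<lambda>_. 0) (\<lambda>l. if l = j then 0 else 1)"
  define v' where "v' = v + scale_exp q m1 - scale_exp q m2"
  have le: "q * coef m2 (k, l) \<le> coef v (k, l) + q * coef m1 (k, l)" for k l
    using ij by (auto simp: m1_def m2_def lookup_outer_sum)
  have eq: "v' + scale_exp q m2 = v + scale_exp q m1"
    using le by (intro expo_eqI) (simp add: v'_def lookup_add lookup_minus)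
  have vT: "v \<in> toric_exps n" using v by simp
  have m: "m1 \<in> toric_exps n" "m2 \<in> toric_exps n" by (simp_all add: m1_def m2_def)
  have "scale_exp q m2 + v' = v + scale_exp q m1" using eq by (simp add: add.commute)
  then have "scale_exp q m2 + v' \<in> toric_exps n" using vT m by auto
  then have v'T: "v' \<in> toric_exps n" using toric_exps_cancel m(2) by blast
  have "v' \<notin> free_exps n q"
  proof
    assume "v' \<in> free_exps n q"
    then have "v + scale_exp q m1 \<in> free_exps n q" using free_exps_add[OF _ m(2)] eq by metis
    then show False using free_exps_sub[OF vT _ q] v by blast
  qed
  moreover have "m1 \<noteq> m2 + w" for w
  proof
    assume "m1 = m2 + w"
    then have "coef m1 (i, j) = coef m2 (i, j) + coef w (i, j)" by (simp add: lookup_add)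
    then show False using b by (simp add: m1_def m2_def lookup_outer_sum)
  qed
  ultimately show ?thesis using that v'T m eq by blast
qed

section \<open>Counting exponents\<close>

definition bounded_exps :: "nat \<Rightarrow> nat \<Rightarrow> expo set"
  where "bounded_exps n D = {v \<in> toric_exps n. \<forall>i j. coef v (i, j) \<le> D}"

text \<open>By the exchange equations, a member of the semigroup is determined by its first row and its
  first column, which have \<open>2 * n - 1\<close> entries.\<close>

lemma bounded_exps_finite_card:
  assumes "n \<ge> 1"
  shows "finite (bounded_exps n D)" "card (bounded_exps n D) \<le> (D + 1) ^ (2 * n - 1)"
proof -
  let ?I = "{1..n} \<times> {1} \<union> {1} \<times> {1..n}"
  let ?A = "?I \<rightarrow>\<^sub>E {..D}"
  let ?f = "\<lambda>v. restrict (coef v) ?I"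
  have inj: "inj_on ?f (bounded_exps n D)"
  proof (rule inj_onI)
    fix v w assume v: "v \<in> bounded_exps n D" and w: "w \<in> bounded_exps n D" and eq: "?f v = ?f w"
    have e: "coef v x = coef w x" if "x \<in> ?I" for x using fun_cong[OF eq, of x] that by auto
    show "v = w"
    proof (rule expo_eqI)
      fix i j
      show "coef v (i, j) = coef w (i, j)"
      proof (cases "i \<in> {1..n} \<and> j \<in> {1..n}")
        case True
        then have "coef v (i, j) + coef v (1, 1) = coef v (i, 1) + coef v (1, j)"
          "coef w (i, j) + coef w (1, 1) = coef w (i, 1) + coef w (1, j)"
          using v w assms by (auto simp: bounded_exps_def intro!: toric_exps_exchange)
        moreover have "coef v (1, 1) = coef w (1, 1)" "coef v (i, 1) = coef w (i, 1)"
          "coef v (1, j) = coef w (1, j)" using True assms by (auto intro!: e)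
        ultimately show ?thesis by simp
      next
        case False
        have "v \<in> toric_exps n" "w \<in> toric_exps n" using v w by (auto simp: bounded_exps_def)
        then show ?thesis using toric_exps_outside[OF _ False] by metis
      qed
    qed
  qed
  have img: "?f ` bounded_exps n D \<subseteq> ?A"
    by (rule image_subsetI) (auto simp: restrict_PiE_iff bounded_exps_def)
  have fin: "finite ?A" by (intro finite_PiE) auto
  show "finite (bounded_exps n D)" by (rule inj_on_finite[OF inj img fin])
  have "card (bounded_exps n D) \<le> card ?A" by (rule card_inj_on_le[OF inj img fin])
  also have "card ?A = (D + 1) ^ card ?I" by (subst card_PiE) auto
  also have "card ?I = 2 * n - 1"
  proof -
    have "({1..n} \<times> {1::nat}) \<inter> ({1} \<times> {1..n}) = {(1, 1)}" using assms by auto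
    then have "card ?I + card {(1::nat, 1::nat)} = n + n"
      using card_Un_Int[of "{1..n} \<times> {1::nat}" "{1} \<times> {1..n}"] by (simp add: card_cartesian_product)
    then show ?thesis by simp
  qed
  finally show "card (bounded_exps n D) \<le> (D + 1) ^ (2 * n - 1)" .
qed

lemma finite_small_exps:
  assumes "n \<ge> 1" shows "finite (small_exps n q)"
  using bounded_exps_finite_card(1)[OF assms, of q]
  by (rule finite_subset[rotated]) (auto simp: small_exps_def bounded_exps_def less_imp_le)

text \<open>Subtracting the minimum of \<open>a\<close> and adding it to \<open>b\<close> makes \<open>a\<close> and \<open>b\<close> unique. The entries of
  the exponent are then bounded by \<open>max a + max b\<close>, and the sum runs over \<open>B = max b\<close>.\<close>

lemma card_small_exps:
  assumes n: "n \<ge> 1"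
  shows "card (small_exps n q) =
    (\<Sum>B<q. ((q - B) ^ n - (q - 1 - B) ^ n) * ((B + 1) ^ n - B ^ n))"
proof -
  \<comment> \<open>The families \<open>b\<close> with maximum \<open>B\<close>, and below the families \<open>a\<close> with minimum \<open>0\<close> and maximum at most \<open>A\<close>.\<close>
  define P where "P B = ({1..n} \<rightarrow>\<^sub>E {..B}) - ({1..n} \<rightarrow>\<^sub>E {..<B})" for B :: nat
  define Q where "Q A = ({1..n} \<rightarrow>\<^sub>E {..A}) - ({1..n} \<rightarrow>\<^sub>E {1..A})" for A :: nat
  define W where "W = (\<Union>B\<in>{..<q}. Q (q - 1 - B) \<times> P B)"
  have fin: "finite (P B)" "finite (Q B)" for B
    unfolding P_def Q_def by (auto intro!: finite_Diff finite_PiE)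
  have cP: "card (P B) = (B + 1) ^ n - B ^ n" for B
  proof -
    have "({1..n} \<rightarrow>\<^sub>E {..<B}) \<subseteq> ({1..n} \<rightarrow>\<^sub>E {..B})" by (rule PiE_mono) auto
    then show ?thesis unfolding P_def
      by (subst card_Diff_subset) (auto intro!: finite_PiE simp: card_PiE)
  qed
  have cQ: "card (Q A) = (A + 1) ^ n - A ^ n" for A
  proof -
    have "({1..n} \<rightarrow>\<^sub>E {1..A}) \<subseteq> ({1..n} \<rightarrow>\<^sub>E {..A})" by (rule PiE_mono) auto
    then show ?thesis unfolding Q_def
      by (subst card_Diff_subset) (auto intro!: finite_PiE simp: card_PiE)
  qed
  have Pmax: "(\<exists>j\<in>{1..n}. b j = B) \<and> (\<forall>j\<in>{1..n}. b j \<le> B)" if "b \<in> P B" for b B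
  proof -
    have le: "\<forall>j\<in>{1..n}. b j \<le> B" using that by (auto simp: P_def PiE_def)
    moreover have "\<not> (\<forall>j\<in>{1..n}. b j < B)" using that by (auto simp: P_def PiE_def)
    ultimately show ?thesis by (metis le_neq_implies_less)
  qed
  have Qmin: "(\<exists>i\<in>{1..n}. a i = 0) \<and> (\<forall>i\<in>{1..n}. a i \<le> A)" if "a \<in> Q A" for a A
  proof -
    have "\<forall>i\<in>{1..n}. a i \<le> A" using that by (auto simp: Q_def PiE_def)
    moreover have "\<exists>i\<in>{1..n}. a i = 0"
    proof (rule ccontr)
      assume "\<not> ?thesis"
      then have "\<forall>i\<in>{1..n}. 1 \<le> a i" by auto
      then show False using that by (auto simp: Q_def PiE_def)
    qed
    ultimately show ?thesis by blast
  qed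
  have inj: "inj_on (\<lambda>(a, b). outer_sum n a b) W"
  proof (rule inj_onI, clarify)
    fix a b a' b' assume "(a, b) \<in> W" "(a', b') \<in> W" and eq: "outer_sum n a b = outer_sum n a' b'"
    then obtain B B' where ab: "a \<in> Q (q - 1 - B)" "b \<in> P B" "a' \<in> Q (q - 1 - B')" "b' \<in> P B'"
      by (auto simp: W_def)
    have e: "a i + b j = a' i + b' j" if "i \<in> {1..n}" "j \<in> {1..n}" for i j
      using arg_cong[OF eq, of "\<lambda>m. coef m (i, j)"] that by (simp add: lookup_outer_sum)
    obtain i0 i1 where i: "i0 \<in> {1..n}" "a i0 = 0" "i1 \<in> {1..n}" "a' i1 = 0"
      using Qmin[OF ab(1)] Qmin[OF ab(3)] by blast
    have bb: "b j = b' j" if "j \<in> {1..n}" for j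
      using e[OF i(1) that] e[OF i(3) that] i by linarith
    have n1: "1 \<in> {1..n}" using n by auto
    have aa: "a j = a' j" if "j \<in> {1..n}" for j
      using e[OF that n1] bb[OF n1] by linarith
    have "a \<in> extensional {1..n}" "a' \<in> extensional {1..n}"
      "b \<in> extensional {1..n}" "b' \<in> extensional {1..n}"
      using ab by (auto simp: P_def Q_def PiE_def)
    then show "a = a' \<and> b = b'" using aa bb by (blast intro: extensionalityI)
  qed
  have img: "(\<lambda>(a, b). outer_sum n a b) ` W = small_exps n q"
  proof (intro equalityI subsetI)
    fix v assume "v \<in> (\<lambda>(a, b). outer_sum n a b) ` W"
    then obtain a b B where ab: "a \<in> Q (q - 1 - B)" "b \<in> P B" "B < q" "v = outer_sum n a b"
      by (auto simp: W_def)
    have "coef v (i, j) < q" for i j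
    proof (cases "i \<in> {1..n} \<and> j \<in> {1..n}")
      case True
      then have "a i \<le> q - 1 - B" "b j \<le> B" using Qmin[OF ab(1)] Pmax[OF ab(2)] by blast+
      then have "a i + b j < q" using ab(3) by linarith
      then show ?thesis using ab True by (simp add: lookup_outer_sum)
    next
      case False
      then show ?thesis using ab(3,4) by (simp only: lookup_outer_sum if_False)
    qed
    then show "v \<in> small_exps n q" using ab by (auto simp: small_exps_def)
  next
    fix v assume v: "v \<in> small_exps n q"
    then obtain a0 b0 where v0: "v = outer_sum n a0 b0" by (auto simp: small_exps_def toric_exps_def)
    define m where "m = Min (a0 ` {1..n})"
    have "m \<in> a0 ` {1..n}" unfolding m_def using n by (intro Min_in) auto
    then obtain i0 where i0: "i0 \<in> {1..n}" "a0 i0 = m" by auto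
    have mle: "m \<le> a0 i" if "i \<in> {1..n}" for i unfolding m_def using that by (intro Min_le) auto
    define a where "a = (\<lambda>i\<in>{1..n}. a0 i - m)"
    define b where "b = (\<lambda>j\<in>{1..n}. b0 j + m)"
    have vab: "v = outer_sum n a b"
      unfolding v0 by (rule expo_eqI) (auto simp: lookup_outer_sum a_def b_def mle)
    define B where "B = Max (b ` {1..n})"
    have "B \<in> b ` {1..n}" unfolding B_def using n by (intro Max_in) auto
    then obtain j0 where j0: "j0 \<in> {1..n}" "b j0 = B" by auto
    have leB: "b j \<le> B" if "j \<in> {1..n}" for j unfolding B_def using that by (intro Max_ge) auto
    have ltq: "a i + b j < q" if "i \<in> {1..n}" "j \<in> {1..n}" for i j
    proof -
      have "coef v (i, j) < q" using v by (auto simp: small_exps_def)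
      then show ?thesis using that by (simp add: vab lookup_outer_sum)
    qed
    have Bq: "B < q" using ltq[OF i0(1) j0(1)] j0 by simp
    have aQ: "a \<in> Q (q - 1 - B)"
    proof -
      have "a i \<le> q - 1 - B" if "i \<in> {1..n}" for i using ltq[OF that j0(1)] j0(2) by linarith
      then have "a \<in> {1..n} \<rightarrow>\<^sub>E {..q - 1 - B}" by (auto simp: a_def)
      moreover have "a i0 = 0" using i0 by (simp add: a_def)
      then have "a \<notin> {1..n} \<rightarrow>\<^sub>E {1..q - 1 - B}" using i0 by (auto dest!: PiE_mem[of a _ _ i0])
      ultimately show ?thesis by (simp add: Q_def)
    qed
    have bP: "b \<in> P B"
    proof -
      have "b \<in> {1..n} \<rightarrow>\<^sub>E {..B}" using leB by (auto simp: b_def)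
      moreover have "b \<notin> {1..n} \<rightarrow>\<^sub>E {..<B}" using j0 by (auto dest!: PiE_mem[of b _ _ j0])
      ultimately show ?thesis by (simp add: P_def)
    qed
    have "(a, b) \<in> W" using aQ bP Bq by (auto simp: W_def)
    then show "v \<in> (\<lambda>(a, b). outer_sum n a b) ` W" using vab by force
  qed
  have disj: "B = B'" if "b \<in> P B" "b \<in> P B'" for b B B'
    using Pmax[OF that(1)] Pmax[OF that(2)] by (metis le_antisym)
  have "card (small_exps n q) = card W" using card_image[OF inj] img by simp
  also have "card W = (\<Sum>B<q. card (Q (q - 1 - B) \<times> P B))"
    unfolding W_def by (rule card_UN_disjoint) (use fin in \<open>auto dest: disj\<close>)
  also have "\<dots> = (\<Sum>B<q. ((q - B) ^ n - (q - 1 - B) ^ n) * ((B + 1) ^ n - B ^ n))"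
  proof (rule sum.cong)
    fix B assume "B \<in> {..<q}"
    then have "q - 1 - B + 1 = q - B" by auto
    then show "card (Q (q - 1 - B) \<times> P B) = ((q - B) ^ n - (q - 1 - B) ^ n) * ((B + 1) ^ n - B ^ n)"
      unfolding card_cartesian_product cP cQ by presburger
  qed simp
  finally show ?thesis .
qed

text \<open>A subset of \<open>{0..m}\<close> with \<open>r + s + 1\<close> elements, sorted by its element \<open>k\<close> that has \<open>r\<close>
  smaller ones; the proof is by Pascal's rule.\<close>

lemma sum_choose_convolution:
  "(\<Sum>k\<le>m. (k choose r) * (m - k choose s)) = (m + 1 choose (r + s + 1))"
proof (induction s arbitrary: m)
  case 0
  then show ?case by (simp add: sum_choose_upper)
next
  case (Suc s)
  note IHs = Suc
  show ?case
  proof (induction m)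
    case 0 show ?case by simp
  next
    case (Suc m)
    have "(\<Sum>k\<le>Suc m. (k choose r) * (Suc m - k choose Suc s)) =
       (\<Sum>k\<le>m. (k choose r) * (Suc m - k choose Suc s))" by simp
    also have "\<dots> = (\<Sum>k\<le>m. (k choose r) * (m - k choose s) + (k choose r) * (m - k choose Suc s))"
      by (rule sum.cong) (auto simp: Suc_diff_le algebra_simps)
    also have "\<dots> = (m + 1 choose (r + s + 1)) + (m + 1 choose (r + Suc s + 1))"
      by (simp add: sum.distrib IHs Suc del: sum.atMost_Suc)
    finally show ?case by simp
  qed
qed

lemma sum_choose_convolution_rising:
  "(\<Sum>k\<le>m. (k + r choose r) * (m - k + s choose s)) = (m + r + s + 1 choose (r + s + 1))"
proof -
  have "(\<Sum>k\<le>m. (k + r choose r) * (m - k + s choose s)) =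
     (\<Sum>k\<in>{r..m+r}. (k choose r) * (m + r + s - k choose s))"
    by (rule sum.reindex_bij_witness[of _ "\<lambda>k. k - r" "\<lambda>k. k + r"]) auto
  also have "\<dots> = (\<Sum>k\<le>m + r + s. (k choose r) * (m + r + s - k choose s))"
    by (rule sum.mono_neutral_left) (auto simp: not_le binomial_eq_0)
  finally show ?thesis by (simp add: sum_choose_convolution)
qed

text \<open>The difference is a sum of \<open>n\<close> products between \<open>k ^ (n - 1)\<close> and \<open>(k + 1) ^ (n - 1)\<close>, and
  these powers lie between the falling and the rising factorial. The two bounds are binomial
  coefficients, to which the convolution identities apply.\<close>

lemma power_step_bounds:
  assumes n: "n \<ge> 1"
  shows "(k + 1) ^ n - k ^ n \<le> fact n * (k + (n - 1) choose (n - 1))" (is ?U)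
    and "fact n * (k choose (n - 1)) \<le> (k + 1) ^ n - k ^ n" (is ?L)
proof -
  obtain r where r: "n = Suc r" using n by (cases n) auto
  \<comment> \<open>The geometric sum identity needs genuine subtraction, hence the detour through the integers.\<close>
  have id: "(k + 1) ^ n - k ^ n = (\<Sum>i<n. (k + 1) ^ (n - 1 - i) * k ^ i)"
  proof -
    have "int ((k + 1) ^ n) - int (k ^ n) = (\<Sum>i<n. int ((k + 1) ^ (n - 1 - i) * k ^ i))"
      using power_diff_sumr2[of "int k" n "int (k + 1)"] by simp
    moreover have "k ^ n \<le> (k + 1) ^ n" by (intro power_mono) auto
    ultimately have "int ((k + 1) ^ n - k ^ n) = int (\<Sum>i<n. (k + 1) ^ (n - 1 - i) * k ^ i)"
      by (simp only: of_nat_diff of_nat_sum)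
    then show ?thesis by (simp only: of_nat_eq_iff)
  qed
  have prod1: "fact r * (k + r choose r) = (\<Prod>i<r. k + 1 + i)"
  proof (induction r)
    case (Suc r)
    have "fact (Suc r) * (k + Suc r choose Suc r) = fact r * (Suc r * (Suc (k + r) choose Suc r))"
      by (simp add: algebra_simps)
    also have "Suc r * (Suc (k + r) choose Suc r) = (Suc (k + r)) * (k + r choose r)"
      by (metis Suc_times_binomial_eq mult.commute)
    finally show ?case using Suc by (simp add: algebra_simps)
  qed simp
  have "(\<Sum>i<n. (k + 1) ^ (n - 1 - i) * k ^ i) \<le> (\<Sum>i<n. (k + 1) ^ r)"
  proof (rule sum_mono)
    fix i assume "i \<in> {..<n}"
    then have "(k + 1) ^ (n - 1 - i) * k ^ i \<le> (k + 1) ^ (n - 1 - i) * (k + 1) ^ i"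
      by (intro mult_left_mono power_mono) auto
    also have "\<dots> = (k + 1) ^ r" using r \<open>i \<in> {..<n}\<close> by (simp add: power_add[symmetric] del: power_Suc)
    finally show "(k + 1) ^ (n - 1 - i) * k ^ i \<le> (k + 1) ^ r" .
  qed
  also have "\<dots> = n * (k + 1) ^ r" by simp
  also have "(k + 1) ^ r \<le> (\<Prod>i<r. k + 1 + i)"
    using prod_mono[of "{..<r}" "\<lambda>_. k + 1" "\<lambda>i. k + 1 + i"] by simp
  finally have "(k + 1) ^ n - k ^ n \<le> n * (fact r * (k + r choose r))"
    by (simp only: id prod1 mult_left_mono)
  then show ?U using r by (simp add: algebra_simps)
  have "fact r * (k choose r) \<le> k ^ r"
    by (metis binomial_fact_pow mult.commute)
  then have "fact n * (k choose r) \<le> n * k ^ r"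
    unfolding r by (simp only: fact_Suc mult.assoc of_nat_id mult_le_mono)
  also have "n * k ^ r = (\<Sum>i<n. k ^ r)" by simp
  also have "\<dots> \<le> (\<Sum>i<n. (k + 1) ^ (n - 1 - i) * k ^ i)"
  proof (rule sum_mono)
    fix i assume "i \<in> {..<n}"
    then have "k ^ r = k ^ (n - 1 - i) * k ^ i" using r by (simp add: power_add[symmetric])
    also have "\<dots> \<le> (k + 1) ^ (n - 1 - i) * k ^ i" by (intro mult_right_mono power_mono) auto
    finally show "k ^ r \<le> (k + 1) ^ (n - 1 - i) * k ^ i" .
  qed
  finally show ?L using id r by simp
qed

lemma card_small_exps_bounds:
  assumes n: "n \<ge> 1" and q: "q \<ge> 1"
  shows "(fact n)\<^sup>2 * (q choose (2 * n - 1)) \<le> card (small_exps n q)"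
    and "card (small_exps n q) \<le> (fact n)\<^sup>2 * (q + (2 * n - 2) choose (2 * n - 1))"
proof -
  obtain m where m: "q = Suc m" using q by (cases q) auto
  obtain r where r: "n = Suc r" using n by (cases n) auto
  define f where "f k = (k + 1) ^ n - k ^ n" for k :: nat
  have c: "card (small_exps n q) = (\<Sum>B\<le>m. f B * f (m - B))"
    unfolding card_small_exps[OF n] m lessThan_Suc_atMost
    by (rule sum.cong) (auto simp: f_def Suc_diff_le algebra_simps)
  have U: "f k \<le> fact n * (k + r choose r)" and L: "fact n * (k choose r) \<le> f k" for k
    unfolding f_def using power_step_bounds[OF n, of k] r by auto
  have "(fact n)\<^sup>2 * (q choose (2 * n - 1)) = (\<Sum>B\<le>m. (fact n * (B choose r)) * (fact n * (m - B choose r)))"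
  proof -
    have e: "q = m + 1" "2 * n - 1 = r + r + 1" using m r by simp_all
    show ?thesis
      unfolding e sum_choose_convolution[symmetric] sum_distrib_left
      by (rule sum.cong) (auto simp: power2_eq_square)
  qed
  also have "\<dots> \<le> (\<Sum>B\<le>m. f B * f (m - B))" by (intro sum_mono mult_mono L) auto
  finally show "(fact n)\<^sup>2 * (q choose (2 * n - 1)) \<le> card (small_exps n q)" by (simp add: c)
  have "(\<Sum>B\<le>m. f B * f (m - B)) \<le> (\<Sum>B\<le>m. (fact n * (B + r choose r)) * (fact n * (m - B + r choose r)))"
    by (intro sum_mono mult_mono U) auto
  also have "\<dots> = (fact n)\<^sup>2 * (\<Sum>B\<le>m. (B + r choose r) * (m - B + r choose r))"
    unfolding sum_distrib_left by (rule sum.cong) (auto simp: power2_eq_square)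
  also have "\<dots> = (fact n)\<^sup>2 * (q + (2 * n - 2) choose (2 * n - 1))"
    unfolding sum_choose_convolution_rising by (simp add: m r mult_2 add.assoc)
  finally show "card (small_exps n q) \<le> (fact n)\<^sup>2 * (q + (2 * n - 2) choose (2 * n - 1))"
    by (simp add: c)
qed

lemma choose_div_power_tendsto:
  "(\<lambda>q. real (q + c choose d) / real q ^ d) \<longlonglongrightarrow> 1 / fact d"
proof -
  have "((\<lambda>q. (\<Prod>i<d. (real q + real c - real i) / real q) / fact d) \<longlonglongrightarrow> (\<Prod>i<d. 1) / fact d)"
  proof (intro tendsto_divide tendsto_prod)
    fix i
    have "(\<lambda>q. 1 + (real c - real i) / real q) \<longlonglongrightarrow> 1 + 0"
      by (intro tendsto_add tendsto_const lim_const_over_n)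
    moreover have "\<forall>\<^sub>F q in sequentially. 1 + (real c - real i) / real q = (real q + real c - real i) / real q"
      using eventually_gt_at_top[of 0] by eventually_elim (simp add: field_simps)
    ultimately show "(\<lambda>q. (real q + real c - real i) / real q) \<longlonglongrightarrow> 1"
      by (simp add: tendsto_cong)
  qed auto
  moreover have "(\<Prod>i<d. (real q + real c - real i) / real q) / fact d = real (q + c choose d) / real q ^ d" for q
    by (simp add: binomial_gbinomial gbinomial_prod_rev prod_dividef atLeast0LessThan)
  ultimately show ?thesis by simp
qed

theorem card_small_exps_limit:
  assumes n: "n \<ge> 1" and p: "p \<ge> 2"
  shows "(\<lambda>e. real (card (small_exps n (p ^ e))) / real p ^ (e * (2 * n - 1)))
    \<longlonglongrightarrow> (fact n)\<^sup>2 / fact (2 * n - 1)"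
proof -
  let ?d = "2 * n - 1"
  have pe: "filterlim (\<lambda>e. p ^ e) sequentially sequentially"
    by (rule filterlim_subseq) (use p in \<open>auto intro!: strict_monoI power_strict_increasing\<close>)
  have lim: "(\<lambda>e. (fact n)\<^sup>2 * (real (p ^ e + c choose ?d) / real (p ^ e) ^ ?d)) \<longlonglongrightarrow>
      (fact n)\<^sup>2 * (1 / fact ?d)" for c
    by (intro tendsto_mult tendsto_const filterlim_compose[OF choose_div_power_tendsto pe])
  have pw: "real p ^ (e * ?d) = real (p ^ e) ^ ?d" for e by (simp add: power_mult)
  have q1: "p ^ e \<ge> 1" for e using p by simp
  show ?thesis unfolding pw
  proof (rule tendsto_sandwich[where f = "\<lambda>e. (fact n)\<^sup>2 * (real (p ^ e + 0 choose ?d) / real (p ^ e) ^ ?d)"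
        and h = "\<lambda>e. (fact n)\<^sup>2 * (real (p ^ e + (2 * n - 2) choose ?d) / real (p ^ e) ^ ?d)"])
    show "\<forall>\<^sub>F e in sequentially. (fact n)\<^sup>2 * (real (p ^ e + 0 choose ?d) / real (p ^ e) ^ ?d) \<le>
        real (card (small_exps n (p ^ e))) / real (p ^ e) ^ ?d"
    proof (intro always_eventually allI)
      fix e
      have "real ((fact n)\<^sup>2 * (p ^ e choose ?d)) \<le> real (card (small_exps n (p ^ e)))"
        using card_small_exps_bounds(1)[OF n q1[of e]] by (simp only: of_nat_le_iff)
      then have "(fact n)\<^sup>2 * real (p ^ e choose ?d) \<le> real (card (small_exps n (p ^ e)))" by simp
      then show "(fact n)\<^sup>2 * (real (p ^ e + 0 choose ?d) / real (p ^ e) ^ ?d) \<le>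
        real (card (small_exps n (p ^ e))) / real (p ^ e) ^ ?d"
        by (simp add: divide_right_mono)
    qed
    show "\<forall>\<^sub>F e in sequentially. real (card (small_exps n (p ^ e))) / real (p ^ e) ^ ?d \<le>
       (fact n)\<^sup>2 * (real (p ^ e + (2 * n - 2) choose ?d) / real (p ^ e) ^ ?d)"
    proof (intro always_eventually allI)
      fix e
      have "real (card (small_exps n (p ^ e))) \<le> real ((fact n)\<^sup>2 * (p ^ e + (2 * n - 2) choose ?d))"
        using card_small_exps_bounds(2)[OF n q1[of e]] by (simp only: of_nat_le_iff)
      then have "real (card (small_exps n (p ^ e))) \<le> (fact n)\<^sup>2 * real (p ^ e + (2 * n - 2) choose ?d)" by simp
      then show "real (card (small_exps n (p ^ e))) / real (p ^ e) ^ ?d \<le>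
       (fact n)\<^sup>2 * (real (p ^ e + (2 * n - 2) choose ?d) / real (p ^ e) ^ ?d)"
        by (simp add: divide_right_mono)
    qed
  qed (use lim[of 0] lim[of "2 * n - 2"] in simp_all)
qed

section \<open>The rank of the free part\<close>

definition linear_form :: "('a, 'r) ring_scheme \<Rightarrow> ('a, 'b, 'm) module_scheme \<Rightarrow> ('b \<Rightarrow> 'a) \<Rightarrow> bool"
  where "linear_form R M \<phi> \<longleftrightarrow> \<phi> \<in> carrier M \<rightarrow> carrier R \<and>
    (\<forall>x\<in>carrier M. \<forall>y\<in>carrier M. \<phi> (x \<oplus>\<^bsub>M\<^esub> y) = \<phi> x \<oplus>\<^bsub>R\<^esub> \<phi> y) \<and>
    (\<forall>r\<in>carrier R. \<forall>x\<in>carrier M. \<phi> (r \<odot>\<^bsub>M\<^esub> x) = r \<otimes>\<^bsub>R\<^esub> \<phi> x)"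

lemma linear_formD:
  assumes "linear_form R M \<phi>"
  shows "x \<in> carrier M \<Longrightarrow> \<phi> x \<in> carrier R"
    "x \<in> carrier M \<Longrightarrow> y \<in> carrier M \<Longrightarrow> \<phi> (x \<oplus>\<^bsub>M\<^esub> y) = \<phi> x \<oplus>\<^bsub>R\<^esub> \<phi> y"
    "r \<in> carrier R \<Longrightarrow> x \<in> carrier M \<Longrightarrow> \<phi> (r \<odot>\<^bsub>M\<^esub> x) = r \<otimes>\<^bsub>R\<^esub> \<phi> x"
  using assms by (auto simp: linear_form_def)

lemma module_isoD:
  assumes "h \<in> module_iso R M N"
  shows "bij_betw h (carrier M) (carrier N)"
    "x \<in> carrier M \<Longrightarrow> y \<in> carrier M \<Longrightarrow> h (x \<oplus>\<^bsub>M\<^esub> y) = h x \<oplus>\<^bsub>N\<^esub> h y"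
    "r \<in> carrier R \<Longrightarrow> x \<in> carrier M \<Longrightarrow> h (r \<odot>\<^bsub>M\<^esub> x) = r \<odot>\<^bsub>N\<^esub> h x"
    "x \<in> carrier M \<Longrightarrow> h x \<in> carrier N"
  using assms by (auto simp: module_iso_def dest: bij_betwE)

text \<open>A splitting of \<open>M\<close> into a free module of rank \<open>a\<close>, embedded by \<open>h\<close> and with coordinate
  functions \<open>c\<close> that are defined on all of \<open>M\<close>, and the complement \<open>N'\<close>.\<close>

definition splitting :: "('a, 'r) ring_scheme \<Rightarrow> ('a, 'b, 'm) module_scheme \<Rightarrow> 'b set \<Rightarrow> nat \<Rightarrow>
    ((nat \<Rightarrow> 'a) \<Rightarrow> 'b) \<Rightarrow> (nat \<Rightarrow> 'b \<Rightarrow> 'a) \<Rightarrow> bool"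
  where "splitting R M N' a h c \<longleftrightarrow>
    h \<in> carrier (free_module R a) \<rightarrow> carrier M \<and>
    (\<forall>v\<in>carrier (free_module R a). \<forall>w\<in>carrier (free_module R a).
       h (v \<oplus>\<^bsub>free_module R a\<^esub> w) = h v \<oplus>\<^bsub>M\<^esub> h w) \<and>
    (\<forall>r\<in>carrier R. \<forall>v\<in>carrier (free_module R a).
       h (r \<odot>\<^bsub>free_module R a\<^esub> v) = r \<odot>\<^bsub>M\<^esub> h v) \<and>
    (\<forall>i<a. linear_form R M (c i)) \<and>
    (\<forall>i<a. \<forall>v\<in>carrier (free_module R a). c i (h v) = v i) \<and>
    (\<forall>x\<in>carrier M. \<exists>x'\<in>N'. x = h (\<lambda>i\<in>{..<a}. c i x) \<oplus>\<^bsub>M\<^esub> x')"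

lemma splittingD:
  assumes "splitting R M N' a h c"
  shows "h \<in> carrier (free_module R a) \<rightarrow> carrier M"
    "v \<in> carrier (free_module R a) \<Longrightarrow> w \<in> carrier (free_module R a) \<Longrightarrow>
       h (v \<oplus>\<^bsub>free_module R a\<^esub> w) = h v \<oplus>\<^bsub>M\<^esub> h w"
    "r \<in> carrier R \<Longrightarrow> v \<in> carrier (free_module R a) \<Longrightarrow>
       h (r \<odot>\<^bsub>free_module R a\<^esub> v) = r \<odot>\<^bsub>M\<^esub> h v"
    "i < a \<Longrightarrow> linear_form R M (c i)"
    "i < a \<Longrightarrow> v \<in> carrier (free_module R a) \<Longrightarrow> c i (h v) = v i"
    "x \<in> carrier M \<Longrightarrow> \<exists>x'\<in>N'. x = h (\<lambda>i\<in>{..<a}. c i x) \<oplus>\<^bsub>M\<^esub> x'"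
  using assms unfolding splitting_def by blast+

lemma (in cring) carrier_free_module: "carrier (free_module R a) = {..<a} \<rightarrow>\<^sub>E carrier R"
  by (simp add: free_module_def)

lemma (in cring) free_module_ops:
  "v \<oplus>\<^bsub>free_module R a\<^esub> w = (\<lambda>i\<in>{..<a}. v i \<oplus> w i)"
  "r \<odot>\<^bsub>free_module R a\<^esub> v = (\<lambda>i\<in>{..<a}. r \<otimes> v i)"
  by (simp_all add: free_module_def)

lemma (in cring) free_module_closed:
  assumes "v \<in> carrier (free_module R a)"
  shows "w \<in> carrier (free_module R a) \<Longrightarrow> v \<oplus>\<^bsub>free_module R a\<^esub> w \<in> carrier (free_module R a)"
    "r \<in> carrier R \<Longrightarrow> r \<odot>\<^bsub>free_module R a\<^esub> v \<in> carrier (free_module R a)"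
  using assms by (auto simp: carrier_free_module free_module_ops)

context module
begin

lemma decomp_unique:
  assumes dec: "direct_decomp R M N N'"
    and "n \<in> N" "m \<in> N" "n' \<in> N'" "m' \<in> N'"
    and eq: "n \<oplus>\<^bsub>M\<^esub> n' = m \<oplus>\<^bsub>M\<^esub> m'"
  shows "n = m" "n' = m'"
proof -
  have sN: "submodule N R M" and sN': "submodule N' R M" and int: "N \<inter> N' = {\<zero>\<^bsub>M\<^esub>}"
    using dec by (auto simp: direct_decomp_def)
  note N = submoduleE[OF sN] and N' = submoduleE[OF sN']
  have c: "n \<in> carrier M" "m \<in> carrier M" "n' \<in> carrier M" "m' \<in> carrier M"
    using assms N(1) N'(1) by auto
  have e: "n \<ominus>\<^bsub>M\<^esub> m = m' \<ominus>\<^bsub>M\<^esub> n'"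
  proof -
    have "n = (n \<oplus>\<^bsub>M\<^esub> n') \<oplus>\<^bsub>M\<^esub> \<ominus>\<^bsub>M\<^esub> n'"
      using c by (simp add: M.a_assoc M.r_neg)
    also have "\<dots> = m \<oplus>\<^bsub>M\<^esub> (m' \<oplus>\<^bsub>M\<^esub> \<ominus>\<^bsub>M\<^esub> n')"
      using c unfolding eq by (simp add: M.a_assoc)
    finally have "n \<ominus>\<^bsub>M\<^esub> m = \<ominus>\<^bsub>M\<^esub> m \<oplus>\<^bsub>M\<^esub> (m \<oplus>\<^bsub>M\<^esub> (m' \<oplus>\<^bsub>M\<^esub> \<ominus>\<^bsub>M\<^esub> n'))"
      using c by (simp add: a_minus_def M.a_comm)
    also have "\<dots> = m' \<ominus>\<^bsub>M\<^esub> n'"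
      using c by (simp add: a_minus_def M.r_neg1)
    finally show ?thesis .
  qed
  moreover have "n \<ominus>\<^bsub>M\<^esub> m \<in> N" "m' \<ominus>\<^bsub>M\<^esub> n' \<in> N'"
    using assms N(3,5) N'(3,5) by (simp_all add: a_minus_def)
  ultimately have "n \<ominus>\<^bsub>M\<^esub> m \<in> N \<inter> N'" by simp
  then have "n \<ominus>\<^bsub>M\<^esub> m = \<zero>\<^bsub>M\<^esub>" unfolding int by simp
  then show nm: "n = m"
    using c by (metis M.minus_minus M.minus_equality M.a_inv_closed a_minus_def)
  show "n' = m'" using eq c unfolding nm by simp
qed

text \<open>The coordinates of \<open>x\<close> are those of its component in \<open>N\<close>; they are linear since components
  are unique.\<close>

lemma decomp_coords:
  assumes dec: "direct_decomp R M N N'"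
    and free: "free_of_rank R (M\<lparr>carrier := N\<rparr>) a"
  obtains h c where "splitting R M N' a h c"
proof -
  let ?F = "free_module R a"
  have sN: "submodule N R M" and sN': "submodule N' R M" and sum: "N <+>\<^bsub>M\<^esub> N' = carrier M"
    using dec by (auto simp: direct_decomp_def)
  note N = submoduleE[OF sN] and N' = submoduleE[OF sN']
  obtain h where h: "h \<in> module_iso R ?F (M\<lparr>carrier := N\<rparr>)"
    using free by (auto simp: free_of_rank_def)
  have bij: "bij_betw h (carrier ?F) N" using module_isoD(1)[OF h] by simp
  have hadd: "h (v \<oplus>\<^bsub>?F\<^esub> w) = h v \<oplus>\<^bsub>M\<^esub> h w" if "v \<in> carrier ?F" "w \<in> carrier ?F" for v w
    using module_isoD(2)[OF h that] by simp
  have hsm: "h (r \<odot>\<^bsub>?F\<^esub> v) = r \<odot>\<^bsub>M\<^esub> h v" if "r \<in> carrier R" "v \<in> carrier ?F" for r v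
    using module_isoD(3)[OF h that] by simp
  have hN: "h v \<in> N" if "v \<in> carrier ?F" for v using bij that by (auto dest: bij_betwE)
  have Fadd: "v \<oplus>\<^bsub>?F\<^esub> w \<in> carrier ?F" if "v \<in> carrier ?F" "w \<in> carrier ?F" for v w
    using that by (simp add: R.free_module_closed)
  have Fsm: "r \<odot>\<^bsub>?F\<^esub> w \<in> carrier ?F" if "r \<in> carrier R" "w \<in> carrier ?F" for r w
    using that by (simp add: R.free_module_closed)
  have "\<forall>x\<in>carrier M. \<exists>v. v \<in> carrier ?F \<and> (\<exists>x'\<in>N'. x = h v \<oplus>\<^bsub>M\<^esub> x')"
  proof
    fix x assume "x \<in> carrier M"
    then have "x \<in> N <+>\<^bsub>M\<^esub> N'" using sum by simp
    then obtain y x' where y: "y \<in> N" "x' \<in> N'" "x = y \<oplus>\<^bsub>M\<^esub> x'"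
      by (auto simp: set_add_def set_mult_def)
    then have "y \<in> h ` carrier ?F" using bij by (simp add: bij_betw_def)
    then show "\<exists>v. v \<in> carrier ?F \<and> (\<exists>x'\<in>N'. x = h v \<oplus>\<^bsub>M\<^esub> x')" using y by blast
  qed
  then obtain k where k: "\<And>x. x \<in> carrier M \<Longrightarrow> k x \<in> carrier ?F"
    and kx: "\<And>x. x \<in> carrier M \<Longrightarrow> \<exists>x'\<in>N'. x = h (k x) \<oplus>\<^bsub>M\<^esub> x'" by metis
  have kI: "k x = v" if "v \<in> carrier ?F" "x' \<in> N'" "x = h v \<oplus>\<^bsub>M\<^esub> x'" for x v x'
  proof -
    have xM: "x \<in> carrier M" using that hN N(1) N'(1) by auto
    obtain y' where y': "y' \<in> N'" "x = h (k x) \<oplus>\<^bsub>M\<^esub> y'" using kx[OF xM] by blast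
    have "h (k x) = h v"
      using decomp_unique(1)[OF dec hN[OF k[OF xM]] hN[OF that(1)] y'(1) that(2)] y' that by simp
    then show ?thesis using bij k[OF xM] that(1) by (auto simp: bij_betw_def dest: inj_onD)
  qed
  have kadd: "k (x \<oplus>\<^bsub>M\<^esub> y) = k x \<oplus>\<^bsub>?F\<^esub> k y" if xy: "x \<in> carrier M" "y \<in> carrier M" for x y
  proof -
    obtain x' y' where xy': "x' \<in> N'" "x = h (k x) \<oplus>\<^bsub>M\<^esub> x'" "y' \<in> N'" "y = h (k y) \<oplus>\<^bsub>M\<^esub> y'"
      using kx xy by metis
    have c: "h (k x) \<in> carrier M" "h (k y) \<in> carrier M" "x' \<in> carrier M" "y' \<in> carrier M"
      using hN k xy N(1) N'(1) xy' by auto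
    have "x \<oplus>\<^bsub>M\<^esub> y = (h (k x) \<oplus>\<^bsub>M\<^esub> x') \<oplus>\<^bsub>M\<^esub> (h (k y) \<oplus>\<^bsub>M\<^esub> y')"
      using xy' by simp
    also have "\<dots> = h (k x \<oplus>\<^bsub>?F\<^esub> k y) \<oplus>\<^bsub>M\<^esub> (x' \<oplus>\<^bsub>M\<^esub> y')"
      using c by (simp add: hadd k xy M.add.m_ac)
    finally show ?thesis using kI Fadd k xy N'(5) xy' by metis
  qed
  have ksm: "k (r \<odot>\<^bsub>M\<^esub> x) = r \<odot>\<^bsub>?F\<^esub> k x" if rx: "r \<in> carrier R" "x \<in> carrier M" for r x
  proof -
    obtain x' where x': "x' \<in> N'" "x = h (k x) \<oplus>\<^bsub>M\<^esub> x'" using kx rx by metis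
    have c: "h (k x) \<in> carrier M" "x' \<in> carrier M" using hN k rx N(1) N'(1) x' by auto
    have "r \<odot>\<^bsub>M\<^esub> x = r \<odot>\<^bsub>M\<^esub> (h (k x) \<oplus>\<^bsub>M\<^esub> x')" using x' by simp
    also have "\<dots> = h (r \<odot>\<^bsub>?F\<^esub> k x) \<oplus>\<^bsub>M\<^esub> (r \<odot>\<^bsub>M\<^esub> x')"
      using c rx k by (simp add: smult_r_distr hsm)
    finally show ?thesis using kI Fsm k rx N'(4) x' by metis
  qed
  show thesis
  proof (rule that[of h "\<lambda>i x. k x i"], unfold splitting_def, intro conjI ballI allI impI)
    show "h \<in> carrier ?F \<rightarrow> carrier M" using hN N(1) by auto
    show "linear_form R M (\<lambda>x. k x i)" if "i < a" for i
      unfolding linear_form_def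
    proof (intro conjI ballI Pi_I)
      fix x assume "x \<in> carrier M"
      then show "k x i \<in> carrier R" using k[of x] that by (auto simp: R.carrier_free_module)
    qed (use that in \<open>simp_all add: kadd ksm R.free_module_ops\<close>)
    show "k (h v) i = v i" if v: "v \<in> carrier ?F" for i v
    proof -
      have "h v \<in> carrier M" using hN[OF v] N(1) by auto
      then have "h v = h v \<oplus>\<^bsub>M\<^esub> \<zero>\<^bsub>M\<^esub>" by simp
      then have "k (h v) = v" using kI[OF v] N'(2)
        by (metis sN' submodule.axioms(1) subgroup.one_closed monoid.select_convs(2))
      then show ?thesis by simp
    qed
    fix x assume x: "x \<in> carrier M"
    have "(\<lambda>i\<in>{..<a}. k x i) = k x"
      using k[OF x] by (auto simp: R.carrier_free_module PiE_def extensional_def)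
    then show "\<exists>x'\<in>N'. x = h (\<lambda>i\<in>{..<a}. k x i) \<oplus>\<^bsub>M\<^esub> x'" using kx[OF x] by simp
  qed (use hadd hsm in auto)
qed

text \<open>Extend a coordinate function of the free summand by zero on the complement.\<close>

lemma has_free_summand_imp_unit_form:
  assumes "has_free_summand R M"
  obtains \<phi> x where "linear_form R M \<phi>" "x \<in> carrier M" "\<phi> x = \<one>"
proof -
  obtain N N' b where dec: "direct_decomp R M N N'" and b: "b > 0"
    and free: "free_of_rank R (M\<lparr>carrier := N\<rparr>) b"
    using assms by (auto simp: has_free_summand_def)
  obtain h c where "splitting R M N' b h c" using decomp_coords[OF dec free] .
  note h = splittingD(1)[OF this] and c = splittingD(4)[OF this] and ch = splittingD(5)[OF this]
  let ?v = "\<lambda>i\<in>{..<b}. \<one>"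
  have "?v \<in> carrier (free_module R b)" by (auto simp: R.carrier_free_module)
  then show thesis using that[OF c[OF b], of "h ?v"] h ch[OF b] b by auto
qed

text \<open>After scaling, \<open>\<phi> x = \<one>\<close>; then the multiples of \<open>x\<close> are free of rank one and the kernel of
  \<open>\<phi>\<close> is a complement.\<close>

lemma unit_form_imp_has_free_summand:
  assumes \<phi>: "linear_form R M \<phi>" and x0: "x0 \<in> carrier M" and unit: "\<phi> x0 \<in> Units R"
  shows "has_free_summand R M"
proof -
  define x where "x = inv (\<phi> x0) \<odot>\<^bsub>M\<^esub> x0"
  have x: "x \<in> carrier M" using x0 unit by (simp add: x_def)
  have \<phi>x: "\<phi> x = \<one>" using x0 unit linear_formD(3)[OF \<phi>] by (simp add: x_def)
  let ?N = "(\<lambda>r. r \<odot>\<^bsub>M\<^esub> x) ` carrier R"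
  let ?K = "{y \<in> carrier M. \<phi> y = \<zero>}"
  note \<phi>D = linear_formD[OF \<phi>]
  have \<phi>0: "\<phi> \<zero>\<^bsub>M\<^esub> = \<zero>" using \<phi>D(3)[of \<zero> x] x \<phi>x by simp
  have \<phi>neg: "\<phi> (\<ominus>\<^bsub>M\<^esub> y) = \<ominus> \<phi> y" if "y \<in> carrier M" for y
  proof -
    have "\<phi> y \<oplus> \<phi> (\<ominus>\<^bsub>M\<^esub> y) = \<zero>" using \<phi>D(2)[of y "\<ominus>\<^bsub>M\<^esub> y"] that by (simp add: M.r_neg \<phi>0)
    then show ?thesis using that \<phi>D(1) by (metis M.a_inv_closed R.minus_equality R.add.m_comm)
  qed
  have sN: "submodule ?N R M"
  proof (rule submoduleI)
    fix a assume "a \<in> ?N"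
    then obtain r where r: "r \<in> carrier R" "a = r \<odot>\<^bsub>M\<^esub> x" by auto
    then have "\<ominus>\<^bsub>M\<^esub> a = (\<ominus> r) \<odot>\<^bsub>M\<^esub> x" using x by (simp add: smult_l_minus)
    then show "\<ominus>\<^bsub>M\<^esub> a \<in> ?N" using r by auto
  next
    fix a b assume "a \<in> ?N" "b \<in> ?N"
    then obtain r s where r: "r \<in> carrier R" "a = r \<odot>\<^bsub>M\<^esub> x" "s \<in> carrier R" "b = s \<odot>\<^bsub>M\<^esub> x" by auto
    then have "a \<oplus>\<^bsub>M\<^esub> b = (r \<oplus> s) \<odot>\<^bsub>M\<^esub> x" using x by (simp add: smult_l_distr)
    then show "a \<oplus>\<^bsub>M\<^esub> b \<in> ?N" using r by auto
  next
    fix r a assume r: "r \<in> carrier R" and "a \<in> ?N"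
    then obtain s where s: "s \<in> carrier R" "a = s \<odot>\<^bsub>M\<^esub> x" by auto
    then have "r \<odot>\<^bsub>M\<^esub> a = (r \<otimes> s) \<odot>\<^bsub>M\<^esub> x" using r x by (simp add: smult_assoc1)
    then show "r \<odot>\<^bsub>M\<^esub> a \<in> ?N" using r s by auto
  next
    show "\<zero>\<^bsub>M\<^esub> \<in> ?N" using x by (auto intro!: image_eqI[of _ _ \<zero>])
  qed (use x in auto)
  have sK: "submodule ?K R M"
    by (rule submoduleI) (auto simp: \<phi>0 \<phi>neg \<phi>D)
  have dec: "direct_decomp R M ?N ?K"
    unfolding direct_decomp_def
  proof (intro conjI sN sK)
    show "?N <+>\<^bsub>M\<^esub> ?K = carrier M"
    proof (intro equalityI subsetI)
      fix y assume y: "y \<in> carrier M"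
      let ?z = "\<ominus>\<^bsub>M\<^esub> (\<phi> y \<odot>\<^bsub>M\<^esub> x)"
      have z: "?z \<in> carrier M" using x y \<phi>D by simp
      have "y = \<phi> y \<odot>\<^bsub>M\<^esub> x \<oplus>\<^bsub>M\<^esub> (y \<oplus>\<^bsub>M\<^esub> ?z)"
        using x y \<phi>D(1) by (simp add: M.add.m_lcomm M.r_neg)
      moreover have "\<phi> (y \<oplus>\<^bsub>M\<^esub> ?z) = \<zero>"
        using x y z by (simp add: \<phi>D \<phi>neg \<phi>x R.r_neg)
      ultimately show "y \<in> ?N <+>\<^bsub>M\<^esub> ?K"
        using x y z \<phi>D(1) unfolding set_add_def set_mult_def
        by (auto intro!: bexI[of _ "\<phi> y"] exI[of _ "y \<oplus>\<^bsub>M\<^esub> ?z"])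
    qed (use x in \<open>auto simp: set_add_def set_mult_def\<close>)
    show "?N \<inter> ?K = {\<zero>\<^bsub>M\<^esub>}"
    proof (intro equalityI subsetI)
      fix y assume "y \<in> ?N \<inter> ?K"
      then obtain r where r: "r \<in> carrier R" "y = r \<odot>\<^bsub>M\<^esub> x" "\<phi> y = \<zero>" by auto
      then have "r = \<zero>" using \<phi>D(3)[of r x] x \<phi>x by simp
      then show "y \<in> {\<zero>\<^bsub>M\<^esub>}" using r x by simp
    qed (use x \<phi>0 in \<open>auto intro!: image_eqI[of _ _ \<zero>]\<close>)
  qed
  have "(\<lambda>v. v 0 \<odot>\<^bsub>M\<^esub> x) \<in> module_iso R (free_module R 1) (M\<lparr>carrier := ?N\<rparr>)"
    unfolding module_iso_def
  proof (intro CollectI conjI ballI)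
    show "bij_betw (\<lambda>v. v 0 \<odot>\<^bsub>M\<^esub> x) (carrier (free_module R 1)) (carrier (M\<lparr>carrier := ?N\<rparr>))"
      unfolding bij_betw_def
    proof
      show "inj_on (\<lambda>v. v 0 \<odot>\<^bsub>M\<^esub> x) (carrier (free_module R 1))"
      proof (rule inj_onI)
        fix v w assume v: "v \<in> carrier (free_module R 1)" and w: "w \<in> carrier (free_module R 1)"
          and eq: "v 0 \<odot>\<^bsub>M\<^esub> x = w 0 \<odot>\<^bsub>M\<^esub> x"
        have c: "v 0 \<in> carrier R" "w 0 \<in> carrier R"
          using v w by (auto simp: R.carrier_free_module)
        have "v 0 = w 0" using arg_cong[OF eq, of \<phi>] c x \<phi>x by (simp add: \<phi>D)
        then show "v = w"
          using PiE_ext[OF v[unfolded R.carrier_free_module] w[unfolded R.carrier_free_module]] by simp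
      qed
      show "(\<lambda>v. v 0 \<odot>\<^bsub>M\<^esub> x) ` carrier (free_module R 1) = carrier (M\<lparr>carrier := ?N\<rparr>)"
      proof (intro equalityI subsetI)
        fix y assume "y \<in> carrier (M\<lparr>carrier := ?N\<rparr>)"
        then obtain r where "r \<in> carrier R" "y = r \<odot>\<^bsub>M\<^esub> x" by auto
        then show "y \<in> (\<lambda>v. v 0 \<odot>\<^bsub>M\<^esub> x) ` carrier (free_module R 1)"
          by (intro image_eqI[of _ _ "\<lambda>i\<in>{..<1}. r"]) (simp_all add: R.carrier_free_module)
      qed (auto simp: R.carrier_free_module)
    qed
  next
    fix v w assume "v \<in> carrier (free_module R 1)" "w \<in> carrier (free_module R 1)"
    then have "v 0 \<in> carrier R" "w 0 \<in> carrier R" by (auto simp: R.carrier_free_module)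
    then show "(v \<oplus>\<^bsub>free_module R 1\<^esub> w) 0 \<odot>\<^bsub>M\<^esub> x =
        v 0 \<odot>\<^bsub>M\<^esub> x \<oplus>\<^bsub>M\<lparr>carrier := ?N\<rparr>\<^esub> w 0 \<odot>\<^bsub>M\<^esub> x"
      using x by (simp add: R.free_module_ops smult_l_distr)
  next
    fix r v assume r: "r \<in> carrier R" and "v \<in> carrier (free_module R 1)"
    then have "v 0 \<in> carrier R" by (auto simp: R.carrier_free_module)
    then show "(r \<odot>\<^bsub>free_module R 1\<^esub> v) 0 \<odot>\<^bsub>M\<^esub> x = r \<odot>\<^bsub>M\<lparr>carrier := ?N\<rparr>\<^esub> (v 0 \<odot>\<^bsub>M\<^esub> x)"
      using x r by (simp add: R.free_module_ops smult_assoc1)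
  qed
  then have "free_of_rank R (M\<lparr>carrier := ?N\<rparr>) 1" by (auto simp: free_of_rank_def)
  then show ?thesis unfolding has_free_summand_def using dec by (metis zero_less_one)
qed

end

text \<open>A linear form on a free module is a combination of the coordinates.\<close>

lemma (in cring) linear_form_free_module_ideal:
  assumes f: "linear_form R (free_module R b) f" and I: "ideal I R"
    and v: "v \<in> carrier (free_module R b)" "\<And>i. i < b \<Longrightarrow> v i \<in> I"
  shows "f v \<in> I"
proof -
  interpret I: ideal I R by (rule I)
  let ?F = "free_module R b"
  \<comment> \<open>Truncation to the first \<open>k\<close> coordinates, for an induction on \<open>k\<close>.\<close>
  define tr where "tr k = (\<lambda>i\<in>{..<b}. if i < k then v i else \<zero>)" for k
  define e where "e k = (\<lambda>i\<in>{..<b}. if i = k then \<one> else \<zero>)" for k :: nat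
  have c: "tr k \<in> carrier ?F" "e k \<in> carrier ?F" for k
    using v by (auto simp: carrier_free_module tr_def e_def)
  have vc: "v i \<in> carrier R" if "i < b" for i using v that by (auto simp: carrier_free_module)
  have "f (tr k) \<in> I" if "k \<le> b" for k
    using that
  proof (induction k)
    case 0
    have "tr 0 = \<zero> \<odot>\<^bsub>?F\<^esub> tr 0" by (auto simp: free_module_ops tr_def)
    then have "f (tr 0) = \<zero> \<otimes> f (tr 0)" using linear_formD(3)[OF f] c by (metis zero_closed)
    then have "f (tr 0) = \<zero>" using linear_formD(1)[OF f] c by simp
    then show ?case by (simp add: I.zero_closed)
  next
    case (Suc k)
    have vk: "v k \<in> carrier R" using vc Suc by simp
    have "tr (Suc k) = tr k \<oplus>\<^bsub>?F\<^esub> (v k \<odot>\<^bsub>?F\<^esub> e k)"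
      using vc vk by (auto simp: free_module_ops tr_def e_def fun_eq_iff less_Suc_eq)
    moreover have "v k \<odot>\<^bsub>?F\<^esub> e k \<in> carrier ?F"
      using vk by (auto simp: carrier_free_module free_module_ops e_def)
    ultimately have "f (tr (Suc k)) = f (tr k) \<oplus> v k \<otimes> f (e k)"
      using linear_formD(2,3)[OF f] c vk by simp
    moreover have "v k \<otimes> f (e k) \<in> I"
      using v(2)[of k] Suc linear_formD(1)[OF f c(2)] by (intro I.I_r_closed) auto
    ultimately show ?case using Suc I.a_closed by simp
  qed
  moreover have "tr b = v" using v by (auto simp: tr_def carrier_free_module PiE_def extensional_def)
  ultimately show ?thesis by force
qed

text \<open>Finiteness of the residue field allows ranks to be compared by counting residues instead of
  by linear algebra.\<close>

locale finite_residue_local = cring R for R (structure) +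
  fixes m
  assumes max_ideal: "ideal m R" and nonunits: "m = carrier R - Units R"
    and finite_residue: "finite (a_rcosets m)"
begin

text \<open>Reducing modulo the maximal ideal, the inclusion of the free part \<open>N\<close> followed by the
  \<open>P\<close>-coordinates is a linear map between vector spaces of dimensions \<open>a\<close> and \<open>b\<close> over the residue
  field. It is injective, since a vector in its kernel lies in the sum of the maximal ideal times
  \<open>P\<close> and of \<open>P'\<close>, where all \<open>N\<close>-coordinates are nonunits.\<close>

lemma free_rank_le:
  assumes M: "module R M"
    and decN: "direct_decomp R M N N'" and freeN: "free_of_rank R (M\<lparr>carrier := N\<rparr>) a"
    and decP: "direct_decomp R M P P'" and freeP: "free_of_rank R (M\<lparr>carrier := P\<rparr>) b"
    and noP: "\<not> has_free_summand R (M\<lparr>carrier := P'\<rparr>)"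
  shows "a \<le> b"
proof -
  interpret M: module R M by (rule M)
  interpret m: ideal m R by (rule max_ideal)
  let ?F = "free_module R"
  obtain h c where hc: "splitting R M N' a h c" using M.decomp_coords[OF decN freeN] .
  note h = splittingD(1)[OF hc] and hadd = splittingD(2)[OF hc] and hsm = splittingD(3)[OF hc]
    and c = splittingD(4)[OF hc] and ch = splittingD(5)[OF hc]
  obtain g d where gd: "splitting R M P' b g d" using M.decomp_coords[OF decP freeP] .
  note g = splittingD(1)[OF gd] and gadd = splittingD(2)[OF gd] and gsm = splittingD(3)[OF gd]
    and d = splittingD(4)[OF gd] and dx = splittingD(6)[OF gd]
  have sP': "submodule P' R M" using decP by (simp add: direct_decomp_def)
  then have P'M: "P' \<subseteq> carrier M" using M.submoduleE(1) by blast
  have modP': "module R (M\<lparr>carrier := P'\<rparr>)" by (rule submodule.submodule_is_module[OF sP' M])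
  have cP': "c i w \<in> m" if "i < a" "w \<in> P'" for i w
  proof -
    have "linear_form R (M\<lparr>carrier := P'\<rparr>) (c i)"
      using c[OF that(1)] P'M by (auto simp: linear_form_def subset_iff)
    then have "c i w \<notin> Units R"
      using module.unit_form_imp_has_free_summand[OF modP', of "c i" w] noP that by auto
    then show ?thesis using linear_formD(1)[OF c[OF that(1)]] P'M that by (auto simp: nonunits)
  qed
  have cg: "c i (g v) \<in> m" if "i < a" "v \<in> carrier (?F b)" "\<And>j. j < b \<Longrightarrow> v j \<in> m" for i v
  proof (rule linear_form_free_module_ideal[OF _ max_ideal that(2,3)])
    show "linear_form R (?F b) (\<lambda>v. c i (g v))"
      unfolding linear_form_def
      using g gadd gsm linear_formD[OF c[OF that(1)]] by (auto simp: Pi_iff)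
  qed
  have key: "z i \<in> m" if i: "i < a" and z: "z \<in> carrier (?F a)" and dz: "\<And>j. j < b \<Longrightarrow> d j (h z) \<in> m" for z i
  proof -
    have hz: "h z \<in> carrier M" using h z by auto
    obtain w where w: "w \<in> P'" "h z = g (\<lambda>j\<in>{..<b}. d j (h z)) \<oplus>\<^bsub>M\<^esub> w"
      using dx[OF hz] by blast
    let ?v = "\<lambda>j\<in>{..<b}. d j (h z)"
    have v: "?v \<in> carrier (?F b)" using linear_formD(1)[OF d hz] by (auto simp: carrier_free_module)
    have "z i = c i (g ?v \<oplus>\<^bsub>M\<^esub> w)" using ch[OF i z] w by simp
    also have "\<dots> = c i (g ?v) \<oplus> c i w"
      using linear_formD(2)[OF c[OF i]] g v w(1) P'M by auto
    also have "\<dots> \<in> m" using cg[OF i v] dz cP'[OF i w(1)] by (intro m.a_closed) auto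
    finally show ?thesis .
  qed
  define Q where "Q = a_rcosets m"
  have finQ: "finite Q" using finite_residue by (simp add: Q_def)
  define rep where "rep A = (SOME x. x \<in> A)" for A :: "'a set"
  have rep: "rep A \<in> carrier R" "m +> rep A = A" if "A \<in> Q" for A
  proof -
    note A = that
    obtain x where x: "x \<in> carrier R" "A = m +> x" using A by (auto simp: Q_def A_RCOSETS_def')
    then have "x \<in> A" using m.a_rcos_self by auto
    then have rA: "rep A \<in> A" unfolding rep_def by (rule someI)
    then show "rep A \<in> carrier R" using x m.a_subset a_r_coset_subset_G by blast
    show "m +> rep A = A" using x rA m.a_repr_independence' by metis
  qed
  have cos_eq: "x \<ominus> y \<in> m" if "x \<in> carrier R" "y \<in> carrier R" "m +> x = m +> y" for x y
    using that quotient_eq_iff_same_a_r_cos[OF max_ideal] by metis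
  let ?Y = "{..<a} \<rightarrow>\<^sub>E Q" and ?Z = "{..<b} \<rightarrow>\<^sub>E Q"
  define lift where "lift y = (\<lambda>i\<in>{..<a}. rep (y i))" for y
  have lift: "lift y \<in> carrier (?F a)" if "y \<in> ?Y" for y
    using that rep(1) by (auto simp: lift_def carrier_free_module)
  define T where "T y = (\<lambda>j\<in>{..<b}. m +> d j (h (lift y)))" for y
  have "inj_on T ?Y"
  proof (rule inj_onI)
    fix y y' assume y: "y \<in> ?Y" and y': "y' \<in> ?Y" and eq: "T y = T y'"
    let ?y = "lift y" and ?y' = "lift y'"
    define z where "z = ?y \<oplus>\<^bsub>?F a\<^esub> (\<ominus> \<one> \<odot>\<^bsub>?F a\<^esub> ?y')"
    have m1: "\<ominus> \<one> \<odot>\<^bsub>?F a\<^esub> ?y' \<in> carrier (?F a)"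
      using lift[OF y'] by (intro free_module_closed) auto
    have hm: "h ?y \<in> carrier M" "h ?y' \<in> carrier M" using h lift y y' by auto
    have z: "z \<in> carrier (?F a)" using lift[OF y] m1 unfolding z_def by (rule free_module_closed)
    have "d j (h z) \<in> m" if j: "j < b" for j
    proof -
      note D = linear_formD[OF d[OF j]]
      have "d j (h z) = d j (h ?y) \<oplus> \<ominus> \<one> \<otimes> d j (h ?y')"
        unfolding z_def using lift y y' m1 hm by (simp add: hadd hsm D)
      also have "\<dots> = d j (h ?y) \<ominus> d j (h ?y')" using D(1) hm by (simp add: l_minus a_minus_def)
      also have "\<dots> \<in> m"
        using fun_cong[OF eq, of j] j hm D(1) by (intro cos_eq) (auto simp: T_def)
      finally show ?thesis .
    qed
    then have zi: "z i \<in> m" if "i < a" for i using key[OF that z] by blast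
    have "y i = y' i" if i: "i < a" for i
    proof -
      have Q: "y i \<in> Q" "y' i \<in> Q" using y y' i by auto
      note r = rep[OF Q(1)] rep[OF Q(2)]
      have "z i = rep (y i) \<ominus> rep (y' i)"
        using i r by (simp add: z_def free_module_ops lift_def l_minus a_minus_def)
      then have "rep (y i) \<ominus> rep (y' i) \<in> m" using zi[OF i] by simp
      then have "m +> rep (y i) = m +> rep (y' i)"
        using quotient_eq_iff_same_a_r_cos[OF max_ideal] r by metis
      then show ?thesis using r by simp
    qed
    then show "y = y'" using PiE_ext[OF y y'] by simp
  qed
  moreover have "T ` ?Y \<subseteq> ?Z"
  proof (rule image_subsetI)
    fix y assume "y \<in> ?Y"
    then have "h (lift y) \<in> carrier M" using h lift by auto
    then show "T y \<in> ?Z"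
      using linear_formD(1)[OF d] by (auto simp: T_def Q_def intro!: a_rcosetsI[OF m.a_subset])
  qed
  moreover have "finite ?Z" using finQ by (intro finite_PiE) auto
  ultimately have "card ?Y \<le> card ?Z" by (rule card_inj_on_le)
  then have le: "card Q ^ a \<le> card Q ^ b" by (simp add: card_PiE)
  have one: "\<one> \<notin> m" by (simp add: nonunits)
  have "m +> \<zero> \<noteq> m +> \<one>"
  proof
    assume "m +> \<zero> = m +> \<one>"
    then have "\<one> \<ominus> \<zero> \<in> m" by (intro cos_eq) auto
    then show False using one by (simp add: a_minus_def)
  qed
  moreover have "{m +> \<zero>, m +> \<one>} \<subseteq> Q" by (auto simp: Q_def intro!: a_rcosetsI[OF m.a_subset])
  ultimately have "card Q \<ge> 2" using card_mono[OF finQ, of "{m +> \<zero>, m +> \<one>}"] by simp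
  then show ?thesis using le power_increasing_iff[of "card Q" a b] by linarith
qed

text \<open>Two decompositions whose complements have no free summand bound each other.\<close>

theorem free_rank_eqI:
  assumes M: "module R M"
    and dec: "direct_decomp R M N N'" and free: "free_of_rank R (M\<lparr>carrier := N\<rparr>) a"
    and nounit: "\<And>\<phi> x. linear_form R (M\<lparr>carrier := N'\<rparr>) \<phi> \<Longrightarrow> x \<in> N' \<Longrightarrow> \<phi> x \<notin> Units R"
  shows "free_rank R M = a"
proof -
  interpret M: module R M by (rule M)
  have sN': "submodule N' R M" using dec by (simp add: direct_decomp_def)
  have mod: "module R (M\<lparr>carrier := N'\<rparr>)" by (rule submodule.submodule_is_module[OF sN' M])
  have no: "\<not> has_free_summand R (M\<lparr>carrier := N'\<rparr>)"
  proof
    assume "has_free_summand R (M\<lparr>carrier := N'\<rparr>)"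
    then obtain \<phi> x where "linear_form R (M\<lparr>carrier := N'\<rparr>) \<phi>" "x \<in> N'" "\<phi> x = \<one>"
      using module.has_free_summand_imp_unit_form[OF mod] by (metis partial_object.simps(1) partial_object.update_convs(1) partial_object.surjective)
    then show False using nounit by (metis Units_one_closed)
  qed
  show ?thesis
    unfolding free_rank_def
  proof (rule the_equality)
    show "\<exists>N N'. direct_decomp R M N N' \<and> free_of_rank R (M\<lparr>carrier := N\<rparr>) a \<and> \<not> has_free_summand R (M\<lparr>carrier := N'\<rparr>)"
      using dec free no by blast
    fix b assume "\<exists>N N'. direct_decomp R M N N' \<and> free_of_rank R (M\<lparr>carrier := N\<rparr>) b \<and> \<not> has_free_summand R (M\<lparr>carrier := N'\<rparr>)"
    then obtain P P' where P: "direct_decomp R M P P'" "free_of_rank R (M\<lparr>carrier := P\<rparr>) b" "\<not> has_free_summand R (M\<lparr>carrier := P'\<rparr>)"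
      by blast
    show "b = a"
      using free_rank_le[OF M dec free P] free_rank_le[OF M P(1,2) dec free no] by simp
  qed
qed

end

section \<open>Polynomials supported in the semigroup\<close>

definition toric_polys :: "nat \<Rightarrow> (expo \<Rightarrow>\<^sub>0 int) set"
  where "toric_polys n = {g. supp g \<subseteq> toric_exps n}"

lemma zero_toric_polys [simp]: "0 \<in> toric_polys n"
  by (simp add: toric_polys_def)

lemma frag_of_toric_polys [simp]: "frag_of v \<in> toric_polys n \<longleftrightarrow> v \<in> toric_exps n"
  by (simp add: toric_polys_def)

lemma one_toric_polys [simp]: "1 \<in> toric_polys n"
  using frag_of_toric_polys[of 0 n] by simp

lemma add_toric_polys [intro]: "f \<in> toric_polys n \<Longrightarrow> g \<in> toric_polys n \<Longrightarrow> f + g \<in> toric_polys n"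
  using keys_add[of f g] by (auto simp: toric_polys_def)

lemma diff_toric_polys [intro]: "f \<in> toric_polys n \<Longrightarrow> g \<in> toric_polys n \<Longrightarrow> f - g \<in> toric_polys n"
  using keys_diff[of f g] by (auto simp: toric_polys_def)

lemma mult_toric_polys [intro]: "f \<in> toric_polys n \<Longrightarrow> g \<in> toric_polys n \<Longrightarrow> f * g \<in> toric_polys n"
  using keys_mult[of f g] by (fastforce simp: toric_polys_def)

lemma power_toric_polys [intro]: "f \<in> toric_polys n \<Longrightarrow> f ^ k \<in> toric_polys n"
  by (induction k) auto

lemma sum_toric_polys [intro]: "(\<And>i. i \<in> A \<Longrightarrow> f i \<in> toric_polys n) \<Longrightarrow> sum f A \<in> toric_polys n"
  by (induction A rule: infinite_finite_induct) auto

lemma frob_toric_polys [intro]: "f \<in> toric_polys n \<Longrightarrow> frob q f \<in> toric_polys n"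
  using keys_frob[of q f] by (auto simp: toric_polys_def)

lemma frob_diff: "frob q (f - g) = frob q f - frob q g"
  by (simp add: frob_def frag_extend_diff)

lemma frob_add: "frob q (f + g) = frob q f + frob q g"
  by (simp add: frob_def frag_extend_add)

text \<open>The polynomials that do not vanish at the origin modulo \<open>p\<close>; they become units in the local
  ring.\<close>

definition toric_denoms :: "nat \<Rightarrow> nat \<Rightarrow> (expo \<Rightarrow>\<^sub>0 int) set"
  where "toric_denoms n p = {s \<in> toric_polys n. \<not> int p dvd coef s 0}"

lemma toric_denoms_mult:
  assumes "prime p" "s \<in> toric_denoms n p" "t \<in> toric_denoms n p"
  shows "s * t \<in> toric_denoms n p"
proof -
  have "prime (int p)" using assms(1) by simp
  then show ?thesis
    using assms(2,3) prime_dvd_multD[of "int p" "coef s 0" "coef t 0"]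
    by (auto simp: toric_denoms_def lookup_times_zero)
qed

lemma one_toric_denoms: "prime p \<Longrightarrow> 1 \<in> toric_denoms n p"
  by (auto simp: toric_denoms_def dest: not_prime_unit)

section \<open>The local ring of the semigroup\<close>

text \<open>Setting the variables with index in \<open>Z\<close> to zero. The exponents that survive form a face of
  the semigroup, which is why this is multiplicative.\<close>

definition face_part :: "(nat \<times> nat) set \<Rightarrow> (expo \<Rightarrow>\<^sub>0 int) \<Rightarrow> (expo \<Rightarrow>\<^sub>0 int)"
  where "face_part Z = frag_extend (\<lambda>v. if \<forall>x\<in>Z. coef v x = 0 then frag_of v else 0)"

lemma coef_face_part: "coef (face_part Z g) v = (if \<forall>x\<in>Z. coef v x = 0 then coef g v else 0)"
  using subset_UNIV
  by (induction g rule: frag_induction)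
    (auto simp: face_part_def frag_extend_diff lookup_minus lookup_single when_def)

lemma face_part_mult: "face_part Z (f * g) = face_part Z f * face_part Z g"
  unfolding face_part_def
  by (rule frag_extend_mult) (auto simp: lookup_add frag_of_mult simp del: single_one)

lemma vanishes_mod_face_part_mono:
  assumes "vanishes_mod p (face_part Z g)" "Z \<subseteq> Z'"
  shows "vanishes_mod p (face_part Z' g)"
  unfolding vanishes_mod_def
proof
  fix u
  have "int p dvd coef (face_part Z g) u" using assms(1) by (simp add: vanishes_mod_def)
  then show "int p dvd coef (face_part Z' g) u"
    using assms(2) by (auto simp: coef_face_part split: if_splits)
qed

lemma primeideal_subset: "primeideal P R \<Longrightarrow> P \<subseteq> carrier R"
  by (meson additive_subgroup.a_subset ideal.axioms(1) primeideal.axioms(1))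

text \<open>Every element is a fraction \<open>ev g / ev s\<close>, and equality of fractions is congruence modulo
  \<open>p\<close>. So these properties characterize the localization at the origin of the semigroup ring over
  the field with \<open>p\<close> elements.\<close>

locale toric_local_ring = cring R for R (structure) +
  fixes p n :: nat and ev :: "(expo \<Rightarrow>\<^sub>0 int) \<Rightarrow> 'a"
  assumes prime_p: "prime p" and n_pos: "n \<ge> 1"
    and ev_closed [simp]: "g \<in> toric_polys n \<Longrightarrow> ev g \<in> carrier R"
    and ev_add: "f \<in> toric_polys n \<Longrightarrow> g \<in> toric_polys n \<Longrightarrow> ev (f + g) = ev f \<oplus> ev g"
    and ev_mult: "f \<in> toric_polys n \<Longrightarrow> g \<in> toric_polys n \<Longrightarrow> ev (f * g) = ev f \<otimes> ev g"
    and ev_one: "ev 1 = \<one>"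
    and ev_eq_zero_iff: "g \<in> toric_polys n \<Longrightarrow> ev g = \<zero> \<longleftrightarrow> vanishes_mod p g"
    and ev_Units: "g \<in> toric_polys n \<Longrightarrow> \<not> int p dvd coef g 0 \<Longrightarrow> ev g \<in> Units R"
    and ev_fraction: "r \<in> carrier R \<Longrightarrow>
      \<exists>g\<in>toric_polys n. \<exists>s\<in>toric_polys n. \<not> int p dvd coef s 0 \<and> ev s \<otimes> r = ev g"
begin

abbreviation "polys \<equiv> toric_polys n"
abbreviation "denoms \<equiv> toric_denoms n p"

lemma p_pos: "p > 0" using prime_p by (rule prime_gt_0_nat)

lemma pow_pos: "p ^ e > 0" using p_pos by simp

lemma prime_int_p: "prime (int p)" using prime_p by simp

lemma denomsD: assumes "s \<in> denoms" shows "s \<in> polys" "ev s \<in> Units R" "ev s \<in> carrier R"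
  using assms ev_Units by (auto simp: toric_denoms_def)

lemma denoms_mult: "s \<in> denoms \<Longrightarrow> t \<in> denoms \<Longrightarrow> s * t \<in> denoms"
  using toric_denoms_mult[OF prime_p] .

lemma one_denoms: "1 \<in> denoms"
  using one_toric_denoms[OF prime_p] .

lemma ev_zero: "ev 0 = \<zero>"
  using ev_eq_zero_iff[of 0] by simp

lemma ev_minus:
  assumes "f \<in> polys" "g \<in> polys"
  shows "ev (f - g) = ev f \<ominus> ev g"
proof -
  have "ev (f - g) \<oplus> ev g = ev f" using ev_add[of "f - g" g] assms by (simp add: diff_toric_polys)
  then show ?thesis using assms by (metis a_minus_def add.inv_solve_right' ev_closed diff_toric_polys)
qed

lemma ev_eq_iff:
  assumes "f \<in> polys" "g \<in> polys"
  shows "ev f = ev g \<longleftrightarrow> vanishes_mod p (f - g)"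
proof -
  have "ev f = ev g \<longleftrightarrow> ev f \<ominus> ev g = \<zero>" using assms by simp
  also have "\<dots> \<longleftrightarrow> ev (f - g) = \<zero>" using assms by (simp add: ev_minus)
  also have "\<dots> \<longleftrightarrow> vanishes_mod p (f - g)" using assms by (intro ev_eq_zero_iff) auto
  finally show ?thesis .
qed

lemma ev_power: "g \<in> polys \<Longrightarrow> ev (g ^ k) = ev g [^] k"
  by (induction k) (auto simp: ev_one ev_mult power_toric_polys m_comm)

lemma ev_frobenius:
  assumes "g \<in> polys"
  shows "ev g [^] (p ^ e) = ev (frob (p ^ e) g)"
proof -
  have "ev (g ^ p ^ e) = ev (frob (p ^ e) g)"
    using assms frob_cong[OF prime_p] by (subst ev_eq_iff) auto
  then show ?thesis using assms by (simp add: ev_power)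
qed

lemma ev_sum:
  assumes "finite A" "\<And>i. i \<in> A \<Longrightarrow> g i \<in> polys"
  shows "ev (\<Sum>i\<in>A. g i) = (\<Oplus>i\<in>A. ev (g i))"
  using assms
proof (induction A rule: finite_induct)
  case (insert i A)
  then have "sum g A \<in> polys" by auto
  with insert show ?case by (simp add: ev_add finsum_insert Pi_iff)
qed (simp add: ev_zero)

lemma Units_cancel:
  assumes "u \<in> Units R" "x \<in> carrier R" "y \<in> carrier R" "u \<otimes> x = u \<otimes> y"
  shows "x = y"
  using assms Units_l_cancel by blast

lemma fraction_obtain:
  assumes "r \<in> carrier R"
  obtains g s where "g \<in> polys" "s \<in> denoms" "ev s \<otimes> r = ev g"
  using ev_fraction[OF assms] by (auto simp: toric_denoms_def)

lemma common_denominator: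
  assumes "finite A" "\<And>i. i \<in> A \<Longrightarrow> r i \<in> carrier R"
  shows "\<exists>s\<in>denoms. \<exists>g. \<forall>i\<in>A. g i \<in> polys \<and> ev s \<otimes> r i = ev (g i)"
  using assms
proof (induction A rule: finite_induct)
  case empty
  then show ?case using one_denoms by auto
next
  case (insert j A)
  then obtain s g where s: "s \<in> denoms" and g: "\<forall>i\<in>A. g i \<in> polys \<and> ev s \<otimes> r i = ev (g i)"
    by auto
  obtain f t where f: "f \<in> polys" "t \<in> denoms" "ev t \<otimes> r j = ev f"
    using fraction_obtain[of "r j"] insert by auto
  define g' where "g' i = (if i = j then s * f else t * g i)" for i
  have "g' i \<in> polys \<and> ev (s * t) \<otimes> r i = ev (g' i)" if i: "i \<in> insert j A" for i
  proof (cases "i = j")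
    case True
    have "ev (s * t) \<otimes> r j = ev s \<otimes> (ev t \<otimes> r j)"
      using denomsD[OF s] denomsD[OF f(2)] insert by (simp add: ev_mult m_assoc)
    then show ?thesis using denomsD[OF s] f by (simp add: True g'_def ev_mult mult_toric_polys)
  next
    case False
    then have iA: "i \<in> A" using i by auto
    have "ev (s * t) \<otimes> r i = ev t \<otimes> (ev s \<otimes> r i)"
      using denomsD[OF s] denomsD[OF f(2)] insert iA by (simp add: ev_mult m_ac)
    then show ?thesis using False g iA denomsD[OF f(2)] by (auto simp: g'_def ev_mult)
  qed
  then show ?case using denoms_mult[OF s f(2)] by blast
qed

lemma common_denominator2:
  assumes "x \<in> carrier R" "y \<in> carrier R"
  obtains s g h where "s \<in> denoms" "g \<in> polys" "ev s \<otimes> x = ev g"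
    "h \<in> polys" "ev s \<otimes> y = ev h"
proof -
  have "\<exists>s\<in>denoms. \<exists>g. \<forall>i\<in>{True, False}. g i \<in> polys \<and>
      ev s \<otimes> (if i then x else y) = ev (g i)"
    by (rule common_denominator) (use assms in auto)
  then show thesis using that by auto
qed

text \<open>The inverse of a fraction is a fraction, and the constant coefficient is multiplicative.\<close>

lemma fraction_unit_iff:
  assumes "r \<in> carrier R" "s \<in> denoms" "g \<in> polys" "ev s \<otimes> r = ev g"
  shows "r \<in> Units R \<longleftrightarrow> \<not> int p dvd coef g 0"
proof
  assume "\<not> int p dvd coef g 0"
  then have "ev s \<otimes> r \<in> Units R" using assms ev_Units by simp
  then show "r \<in> Units R" using assms denomsD(3) by (metis m_comm unit_factor)
next
  assume r: "r \<in> Units R"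
  obtain h t where h: "h \<in> polys" "t \<in> denoms" "ev t \<otimes> inv r = ev h"
    using fraction_obtain[of "inv r"] r by auto
  note d = denomsD[OF assms(2)] denomsD[OF h(2)]
  have "ev (g * h) = (ev s \<otimes> r) \<otimes> (ev t \<otimes> inv r)" using assms h by (simp add: ev_mult)
  also have "\<dots> = ev s \<otimes> ev t \<otimes> (r \<otimes> inv r)"
    using d(2,3,5,6) r assms(1) by (simp add: m_ac del: Units_r_inv Units_l_inv)
  also have "\<dots> = ev (s * t)" using d r by (simp add: ev_mult)
  finally have "vanishes_mod p (g * h - s * t)" using assms h d by (subst (asm) ev_eq_iff) auto
  then have "int p dvd coef (g * h) 0 - coef (s * t) 0" by (simp add: vanishes_mod_def lookup_minus)
  then have "int p dvd coef g 0 * coef h 0 - coef (s * t) 0" by (simp add: lookup_times_zero)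
  moreover have "\<not> int p dvd coef (s * t) 0" using denoms_mult[OF assms(2) h(2)] by (simp add: toric_denoms_def)
  ultimately show "\<not> int p dvd coef g 0"
    using dvd_diff[of "int p" "coef g 0 * coef h 0" "coef g 0 * coef h 0 - coef (s * t) 0"] by auto
qed

definition max_ideal :: "'a set"
  where "max_ideal = carrier R - Units R"

text \<open>The fractions whose numerators vanish on the face of exponents that are zero on \<open>Z\<close>. For \<open>Z\<close>
  empty this is the zero ideal, for \<open>Z = UNIV\<close> the maximal ideal.\<close>

definition face_ideal :: "(nat \<times> nat) set \<Rightarrow> 'a set"
  where "face_ideal Z = {r \<in> carrier R. \<exists>s\<in>denoms. \<exists>g\<in>polys.
    ev s \<otimes> r = ev g \<and> vanishes_mod p (face_part Z g)}"

text \<open>Denominators have a nonzero constant coefficient, which every face retains; so by Gauss the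
  choice of the fraction does not matter.\<close>

lemma face_ideal_iff:
  assumes r: "r \<in> carrier R" "s \<in> denoms" "g \<in> polys" "ev s \<otimes> r = ev g"
  shows "r \<in> face_ideal Z \<longleftrightarrow> vanishes_mod p (face_part Z g)"
proof
  assume "r \<in> face_ideal Z"
  then obtain t h where h: "t \<in> denoms" "h \<in> polys" "ev t \<otimes> r = ev h" "vanishes_mod p (face_part Z h)"
    by (auto simp: face_ideal_def)
  note d = denomsD[OF r(2)] denomsD[OF h(1)]
  have "ev (t * g) = ev t \<otimes> (ev s \<otimes> r)" using d r by (simp add: ev_mult)
  also have "\<dots> = ev s \<otimes> (ev t \<otimes> r)" using d r(1) by (simp add: m_ac)
  also have "\<dots> = ev (s * h)" using d h by (simp add: ev_mult)
  finally have v: "vanishes_mod p (t * g - s * h)" using d r h by (subst (asm) ev_eq_iff) auto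
  have "vanishes_mod p (face_part Z (t * g))"
    unfolding vanishes_mod_def
  proof
    fix u
    have "int p dvd coef (face_part Z (t * g) - face_part Z (s * h)) u"
      using v by (auto simp: coef_face_part lookup_minus vanishes_mod_def)
    moreover have "int p dvd coef (face_part Z (s * h)) u"
      using vanishes_mod_mult[OF h(4)] by (simp add: face_part_mult vanishes_mod_def)
    ultimately show "int p dvd coef (face_part Z (t * g)) u"
      using dvd_add[of "int p" "coef (face_part Z (t * g) - face_part Z (s * h)) u" "coef (face_part Z (s * h)) u"]
      by (simp add: lookup_minus)
  qed
  then have "vanishes_mod p (face_part Z t) \<or> vanishes_mod p (face_part Z g)"
    unfolding face_part_mult by (rule vanishes_mod_prime[OF prime_p])
  moreover have "\<not> vanishes_mod p (face_part Z t)"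
    using h(1) by (auto simp: toric_denoms_def vanishes_mod_def coef_face_part intro!: exI[of _ 0])
  ultimately show "vanishes_mod p (face_part Z g)" by blast
qed (use assms in \<open>auto simp: face_ideal_def\<close>)

text \<open>The semigroup ring of a face has no zero divisors.\<close>

lemma primeideal_face_ideal: "primeideal (face_ideal Z) R"
proof (rule primeidealI)
  have sub: "face_ideal Z \<subseteq> carrier R" by (auto simp: face_ideal_def)
  show "cring R" by (rule is_cring)
  show "ideal (face_ideal Z) R"
  proof (rule idealI)
    show "ring R" by (rule ring_axioms)
    show "subgroup (face_ideal Z) (add_monoid R)"
    proof (rule add.subgroupI)
      show "face_ideal Z \<subseteq> carrier R" by (rule sub)
      have "\<zero> \<in> face_ideal Z"
        using face_ideal_iff[of \<zero> 1 0] one_denoms denomsD[of 1] by (simp add: ev_zero face_part_def)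
      then show "face_ideal Z \<noteq> {}" by auto
      fix a assume a: "a \<in> face_ideal Z"
      then have aR: "a \<in> carrier R" using sub by auto
      obtain g s where g: "g \<in> polys" "s \<in> denoms" "ev s \<otimes> a = ev g"
        using fraction_obtain[OF aR] .
      have v: "vanishes_mod p (face_part Z g)" using face_ideal_iff[OF aR g(2,1,3)] a by simp
      have "ev (0 - g) = \<ominus> ev g" using ev_minus[of 0 g] g by (simp add: ev_zero minus_eq)
      then have "ev s \<otimes> (\<ominus> a) = ev (0 - g)" using g aR denomsD[OF g(2)] by (simp add: r_minus)
      moreover have "vanishes_mod p (face_part Z (0 - g))"
        using vanishes_mod_diff[OF vanishes_mod_zero v] unfolding face_part_def frag_extend_diff by simp
      moreover have "0 - g \<in> polys" using g by (intro diff_toric_polys) auto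
      ultimately show "\<ominus> a \<in> face_ideal Z" using aR g(2) by (subst face_ideal_iff[of _ s "0 - g"]) auto
      fix b assume b: "b \<in> face_ideal Z"
      then have bR: "b \<in> carrier R" using sub by auto
      obtain s g h where s: "s \<in> denoms" and g: "g \<in> polys" "ev s \<otimes> a = ev g"
        and h: "h \<in> polys" "ev s \<otimes> b = ev h"
        using common_denominator2[OF aR bR] .
      have v: "vanishes_mod p (face_part Z g)" "vanishes_mod p (face_part Z h)"
        using face_ideal_iff[OF aR s g] face_ideal_iff[OF bR s h] a b by auto
      have "ev s \<otimes> (a \<oplus> b) = ev (g + h)" using g h aR bR denomsD[OF s] by (simp add: r_distr ev_add)
      moreover have "vanishes_mod p (face_part Z (g + h))"
        using vanishes_mod_add[OF v] by (simp add: face_part_def frag_extend_add)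
      moreover have "g + h \<in> polys" using g h by auto
      ultimately show "a \<oplus> b \<in> face_ideal Z" using aR bR s by (subst face_ideal_iff[of _ s "g + h"]) auto
    qed
    fix a x assume a: "a \<in> face_ideal Z" and x: "x \<in> carrier R"
    then have aR: "a \<in> carrier R" using sub by auto
    obtain s g h where s: "s \<in> denoms" and g: "g \<in> polys" "ev s \<otimes> a = ev g"
      and h: "h \<in> polys" "ev s \<otimes> x = ev h"
      using common_denominator2[OF aR x] .
    have v: "vanishes_mod p (face_part Z g)" using face_ideal_iff[OF aR s g] a by auto
    have "ev (s * s) \<otimes> (a \<otimes> x) = (ev s \<otimes> a) \<otimes> (ev s \<otimes> x)"
      using aR x denomsD[OF s] by (simp add: ev_mult m_ac)
    also have "\<dots> = ev (g * h)" using g h by (simp add: ev_mult)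
    finally have "ev (s * s) \<otimes> (a \<otimes> x) = ev (g * h)" .
    moreover have "vanishes_mod p (face_part Z (g * h))"
      unfolding face_part_mult by (rule vanishes_mod_mult(2)[OF v])
    moreover have "g * h \<in> polys" using g h by auto
    ultimately show ax: "a \<otimes> x \<in> face_ideal Z"
      using aR x denoms_mult[OF s s] by (subst face_ideal_iff[of _ "s * s" "g * h"]) auto
    then show "x \<otimes> a \<in> face_ideal Z" using aR x by (simp add: m_comm)
  qed
  have "\<one> \<notin> face_ideal Z"
  proof -
    have "\<not> vanishes_mod p (face_part Z 1)"
      using one_denoms by (auto simp: toric_denoms_def vanishes_mod_def coef_face_part intro!: exI[of _ 0])
    then show ?thesis by (subst face_ideal_iff[of _ 1 1]) (auto simp: one_denoms ev_one)
  qed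
  then show "carrier R \<noteq> face_ideal Z" using one_closed by metis
  fix a b assume a: "a \<in> carrier R" and b: "b \<in> carrier R" and ab: "a \<otimes> b \<in> face_ideal Z"
  obtain s g h where s: "s \<in> denoms" and g: "g \<in> polys" "ev s \<otimes> a = ev g"
    and h: "h \<in> polys" "ev s \<otimes> b = ev h"
    using common_denominator2[OF a b] .
  have "ev (s * s) \<otimes> (a \<otimes> b) = (ev s \<otimes> a) \<otimes> (ev s \<otimes> b)"
    using a b denomsD[OF s] by (simp add: ev_mult m_ac)
  also have "\<dots> = ev (g * h)" using g h by (simp add: ev_mult)
  finally have e: "ev (s * s) \<otimes> (a \<otimes> b) = ev (g * h)" .
  have "vanishes_mod p (face_part Z (g * h))"
    using face_ideal_iff[OF _ denoms_mult[OF s s] _ e] a b g h ab by auto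
  then have "vanishes_mod p (face_part Z g) \<or> vanishes_mod p (face_part Z h)"
    unfolding face_part_mult by (rule vanishes_mod_prime[OF prime_p])
  then show "a \<in> face_ideal Z \<or> b \<in> face_ideal Z"
    using face_ideal_iff[OF a s g] face_ideal_iff[OF b s h] by blast
qed

lemma max_ideal_iff:
  assumes "r \<in> carrier R" "s \<in> denoms" "g \<in> polys" "ev s \<otimes> r = ev g"
  shows "r \<in> max_ideal \<longleftrightarrow> int p dvd coef g 0"
  using fraction_unit_iff[OF assms] assms(1) by (simp add: max_ideal_def)

lemma max_ideal_eq_face_ideal: "max_ideal = face_ideal UNIV"
proof (intro equalityI subsetI)
  have van: "vanishes_mod p (face_part UNIV g) \<longleftrightarrow> int p dvd coef g 0" for g
  proof -
    have "(\<forall>x. coef u x = 0) \<longleftrightarrow> u = 0" for u :: expo by (auto intro: poly_mapping_eqI)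
    then show ?thesis by (simp add: vanishes_mod_def coef_face_part)
  qed
  have iff: "r \<in> max_ideal \<longleftrightarrow> r \<in> face_ideal UNIV" if r: "r \<in> carrier R" for r
  proof -
    obtain g s where g: "g \<in> polys" "s \<in> denoms" "ev s \<otimes> r = ev g"
      using fraction_obtain[OF r] .
    show ?thesis using max_ideal_iff[OF r g(2,1,3)] face_ideal_iff[OF r g(2,1,3)] van by simp
  qed
  show "r \<in> face_ideal UNIV" if "r \<in> max_ideal" for r
    using that iff[of r] by (simp add: max_ideal_def)
  show "r \<in> max_ideal" if "r \<in> face_ideal UNIV" for r
    using that iff[of r] by (simp add: face_ideal_def)
qed

lemma ideal_max_ideal: "ideal max_ideal R"
  unfolding max_ideal_eq_face_ideal by (rule primeideal.axioms(1)[OF primeideal_face_ideal])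

lemma of_int_toric_polys: "of_int c \<in> polys"
  by (metis mult_1_right frag_cmul_conv_mult one_toric_polys keys_cmul toric_polys_def mem_Collect_eq subset_trans)

text \<open>A fraction \<open>g / s\<close> is congruent to an integer \<open>c\<close> that represents the quotient of the
  constant coefficients modulo \<open>p\<close>.\<close>

lemma finite_residue_field: "finite (a_rcosets max_ideal)"
proof -
  interpret m: ideal max_ideal R by (rule ideal_max_ideal)
  have "a_rcosets max_ideal \<subseteq> (\<lambda>c. max_ideal +> ev (of_int c)) ` {0..<int p}"
  proof
    fix A assume "A \<in> a_rcosets max_ideal"
    then obtain r where r: "r \<in> carrier R" "A = max_ideal +> r" by (auto simp: A_RCOSETS_def')
    obtain g s where gs: "g \<in> polys" "s \<in> denoms" "ev s \<otimes> r = ev g"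
      using fraction_obtain[OF r(1)] .
    have "coprime (int p) (coef s 0)"
      using gs(2) prime_int_p by (intro prime_imp_coprime) (auto simp: toric_denoms_def)
    then obtain d where d: "[coef s 0 * d = 1] (mod int p)"
      using cong_solve_coprime_int[of "coef s 0" "int p"] by (auto simp: coprime_commute)
    define c where "c = (d * coef g 0) mod int p"
    have "[c * coef s 0 = (coef s 0 * d) * coef g 0] (mod int p)"
      by (simp add: c_def cong_def mod_simps mult_ac)
    moreover have "[(coef s 0 * d) * coef g 0 = 1 * coef g 0] (mod int p)"
      using d by (rule cong_scalar_right)
    ultimately have "[coef g 0 = c * coef s 0] (mod int p)"
      by (metis cong_sym cong_trans mult_1)
    then have dvd: "int p dvd coef g 0 - c * coef s 0" by (simp add: cong_iff_dvd_diff)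
    have Zs: "s \<in> polys" "ev s \<in> carrier R" using denomsD[OF gs(2)] by auto
    have Z: "g - of_int c * s \<in> polys" "of_int c * s \<in> polys"
      using gs Zs of_int_toric_polys by auto
    have "ev s \<otimes> (r \<ominus> ev (of_int c)) = ev s \<otimes> r \<ominus> ev s \<otimes> ev (of_int c)"
      using r Zs of_int_toric_polys by (simp add: a_minus_def r_distr r_minus)
    also have "\<dots> = ev (g - of_int c * s)"
      using gs Z Zs of_int_toric_polys by (simp add: ev_minus ev_mult m_comm)
    finally have "r \<ominus> ev (of_int c) \<in> max_ideal"
      using max_ideal_iff[of "r \<ominus> ev (of_int c)" s "g - of_int c * s"] r gs Z of_int_toric_polys dvd
      by (simp add: lookup_minus flip: frag_cmul_conv_mult)
    then have "max_ideal +> r = max_ideal +> ev (of_int c)"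
      using quotient_eq_iff_same_a_r_cos[OF ideal_max_ideal] r of_int_toric_polys by simp
    moreover have "c \<in> {0..<int p}" using p_pos by (simp add: c_def)
    ultimately show "A \<in> (\<lambda>c. max_ideal +> ev (of_int c)) ` {0..<int p}" using r by blast
  qed
  then show ?thesis by (rule finite_subset) simp
qed

sublocale finite_residue_local R max_ideal
  by (intro finite_residue_local.intro finite_residue_local_axioms.intro is_cring ideal_max_ideal
      max_ideal_def finite_residue_field)

section \<open>Splitting the Frobenius pushforward\<close>

text \<open>With a common denominator this reduces to the additivity of \<open>frob\<close>.\<close>

lemma frobenius_add:
  assumes "x \<in> carrier R" "y \<in> carrier R"
  shows "(x \<oplus> y) [^] (p ^ e) = x [^] (p ^ e) \<oplus> y [^] (p ^ e)"
proof -
  let ?q = "p ^ e"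
  obtain s g h where s: "s \<in> denoms" and gx: "g \<in> polys" "ev s \<otimes> x = ev g"
    and gy: "h \<in> polys" "ev s \<otimes> y = ev h"
    using common_denominator2[OF assms] .
  note d = denomsD[OF s]
  have "ev s [^] ?q \<otimes> (x \<oplus> y) [^] ?q = (ev s \<otimes> (x \<oplus> y)) [^] ?q"
    using d assms by (simp add: nat_pow_distrib)
  also have "\<dots> = ev (g + h) [^] ?q" using d assms gx gy by (simp add: r_distr ev_add)
  also have "\<dots> = ev (frob ?q g + frob ?q h)"
    using gx gy by (simp add: ev_frobenius frob_add add_toric_polys)
  also have "\<dots> = ev g [^] ?q \<oplus> ev h [^] ?q"
    using gx gy by (simp add: ev_frobenius ev_add frob_toric_polys)
  also have "\<dots> = ev s [^] ?q \<otimes> (x [^] ?q \<oplus> y [^] ?q)"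
    unfolding gx(2)[symmetric] gy(2)[symmetric] using d assms by (simp add: nat_pow_distrib r_distr)
  finally have "ev s [^] ?q \<otimes> (x \<oplus> y) [^] ?q = ev s [^] ?q \<otimes> (x [^] ?q \<oplus> y [^] ?q)" .
  from Units_cancel[OF Units_pow_closed[OF d(2)] _ _ this] show ?thesis using assms by simp
qed

abbreviation "push e \<equiv> frob_pushforward p e R"

lemma push_simps [simp]:
  "carrier (push e) = carrier R" "x \<oplus>\<^bsub>push e\<^esub> y = x \<oplus> y" "\<zero>\<^bsub>push e\<^esub> = \<zero>"
  "r \<odot>\<^bsub>push e\<^esub> x = r [^] (p ^ e) \<otimes> x"
  by (simp_all add: frob_pushforward_def)

lemma push_a_inv [simp]: "\<ominus>\<^bsub>push e\<^esub> x = \<ominus> x"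
  by (simp add: a_inv_def m_inv_def frob_pushforward_def)

lemma module_push: "module R (push e)"
proof (rule moduleI)
  show "cring R" by (rule is_cring)
  show "abelian_group (push e)"
    by (rule abelian_groupI) (auto simp: a_ac intro: l_neg)
qed (auto simp: frobenius_add l_distr r_distr nat_pow_distrib m_assoc)

text \<open>The submodule of the pushforward generated by the monomials with exponent in \<open>V\<close>, provided
  that \<open>V\<close> is closed under adding \<open>p ^ e\<close> times a member of the semigroup. Scalars act by
  \<open>p ^ e\<close>-th powers, therefore so do the denominators.\<close>

definition span :: "nat \<Rightarrow> expo set \<Rightarrow> 'a set"
  where "span e V = {x \<in> carrier R. \<exists>s\<in>denoms. \<exists>g. supp g \<subseteq> V \<and> ev s [^] (p ^ e) \<otimes> x = ev g}"

lemma spanI: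
  "x \<in> carrier R \<Longrightarrow> s \<in> denoms \<Longrightarrow> supp g \<subseteq> V \<Longrightarrow> ev s [^] (p ^ e) \<otimes> x = ev g \<Longrightarrow> x \<in> span e V"
  unfolding span_def by blast

lemma supp_frobenius_mult:
  assumes V: "\<And>v u. v \<in> V \<Longrightarrow> u \<in> toric_exps n \<Longrightarrow> v + scale_exp q u \<in> V"
    and "f \<in> polys" "supp g \<subseteq> V"
  shows "supp (frob q f * g) \<subseteq> V"
proof
  fix w assume "w \<in> supp (frob q f * g)"
  then obtain a b where w: "w = a + b" "a \<in> supp (frob q f)" "b \<in> supp g"
    using keys_mult[of "frob q f" g] by auto
  then obtain u where "u \<in> supp f" "a = scale_exp q u" using keys_frob[of q f] by auto
  then show "w \<in> V" using V[of b u] w assms(2,3) by (auto simp: toric_polys_def add.commute)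
qed

lemma span_submodule:
  assumes VS: "V \<subseteq> toric_exps n"
    and V: "\<And>v u. v \<in> V \<Longrightarrow> u \<in> toric_exps n \<Longrightarrow> v + scale_exp (p ^ e) u \<in> V"
  shows "submodule (span e V) R (push e)"
proof -
  interpret M: module R "push e" by (rule module_push)
  let ?q = "p ^ e" and ?F = "frob (p ^ e)"
  have Z: "g \<in> polys" if "supp g \<subseteq> V" for g using that VS by (auto simp: toric_polys_def)
  show ?thesis
  proof (rule M.submoduleI)
    show "span e V \<subseteq> carrier (push e)" by (auto simp: span_def)
    show "\<zero>\<^bsub>push e\<^esub> \<in> span e V"
      using one_denoms by (auto simp: span_def ev_one ev_zero intro!: bexI[of _ 1] exI[of _ 0])
  next
    fix a assume "a \<in> span e V"
    then obtain s g where a: "a \<in> carrier R" "s \<in> denoms" "supp g \<subseteq> V" "ev s [^] ?q \<otimes> a = ev g"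
      by (auto simp: span_def)
    have "ev (0 - g) = \<ominus> ev g"
      using ev_minus[of 0 g] Z[OF a(3)] by (simp add: ev_zero minus_eq)
    then have "ev s [^] ?q \<otimes> (\<ominus> a) = ev (0 - g)"
      using a denomsD[OF a(2)] by (simp add: r_minus)
    moreover have "supp (0 - g) \<subseteq> V" using a by simp
    ultimately show "\<ominus>\<^bsub>push e\<^esub> a \<in> span e V" using a(1,2) by (intro spanI[of _ s "0 - g"]) simp_all
  next
    fix a b assume "a \<in> span e V" "b \<in> span e V"
    then obtain s g t h where a: "a \<in> carrier R" "s \<in> denoms" "supp g \<subseteq> V" "ev s [^] ?q \<otimes> a = ev g"
      and b: "b \<in> carrier R" "t \<in> denoms" "supp h \<subseteq> V" "ev t [^] ?q \<otimes> b = ev h"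
      by (auto simp: span_def)
    note d = denomsD[OF a(2)] denomsD[OF b(2)] Z[OF a(3)] Z[OF b(3)]
    have "ev (s * t) [^] ?q \<otimes> (a \<oplus> b) =
       ev t [^] ?q \<otimes> (ev s [^] ?q \<otimes> a) \<oplus> ev s [^] ?q \<otimes> (ev t [^] ?q \<otimes> b)"
      using d a(1) b(1) by (simp add: ev_mult nat_pow_distrib r_distr l_distr m_ac)
    also have "\<dots> = ev (?F t * g + ?F s * h)"
      unfolding a(4) b(4) using d
      by (simp add: ev_frobenius ev_add ev_mult mult_toric_polys frob_toric_polys)
    finally have e: "ev (s * t) [^] ?q \<otimes> (a \<oplus> b) = ev (?F t * g + ?F s * h)" .
    have "supp (?F t * g + ?F s * h) \<subseteq> V"
      using keys_add[of "?F t * g" "?F s * h"]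
        supp_frobenius_mult[where V = V and q = ?q, OF V d(1) b(3)] supp_frobenius_mult[where V = V and q = ?q, OF V d(4) a(3)] by blast
    then show "a \<oplus>\<^bsub>push e\<^esub> b \<in> span e V"
      using e a b denoms_mult[OF a(2) b(2)] unfolding span_def by auto
  next
    fix r x assume r: "r \<in> carrier R" and "x \<in> span e V"
    then obtain s g where x: "x \<in> carrier R" "s \<in> denoms" "supp g \<subseteq> V" "ev s [^] ?q \<otimes> x = ev g"
      by (auto simp: span_def)
    obtain f t where f: "f \<in> polys" "t \<in> denoms" "ev t \<otimes> r = ev f"
      using fraction_obtain[OF r] .
    note d = denomsD[OF x(2)] denomsD[OF f(2)] Z[OF x(3)]
    have "ev (s * t) [^] ?q \<otimes> (r [^] ?q \<otimes> x) = (ev t \<otimes> r) [^] ?q \<otimes> (ev s [^] ?q \<otimes> x)"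
      using d x(1) r by (simp add: ev_mult nat_pow_distrib m_ac)
    also have "\<dots> = ev (?F f * g)"
      unfolding x(4) f(3) using d f
      by (simp add: ev_frobenius ev_mult frob_toric_polys)
    finally have "ev (s * t) [^] ?q \<otimes> (r [^] ?q \<otimes> x) = ev (?F f * g)" .
    moreover have "supp (?F f * g) \<subseteq> V" by (rule supp_frobenius_mult[where V = V and q = ?q, OF V f(1) x(3)])
    ultimately show "r \<odot>\<^bsub>push e\<^esub> x \<in> span e V"
      using x r denoms_mult[OF x(2) f(2)] unfolding span_def by auto
  qed
qed

text \<open>Polynomials split along a partition of their exponents. The denominators interfere neither
  with existence nor with uniqueness, because the Frobenius powers of denominators have exponents
  divisible by \<open>p ^ e\<close> and so preserve both parts.\<close>

lemma span_decomp:
  assumes VW: "V \<union> W = toric_exps n" "V \<inter> W = {}"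
    and V: "\<And>v u. v \<in> V \<Longrightarrow> u \<in> toric_exps n \<Longrightarrow> v + scale_exp (p ^ e) u \<in> V"
    and W: "\<And>v u. v \<in> W \<Longrightarrow> u \<in> toric_exps n \<Longrightarrow> v + scale_exp (p ^ e) u \<in> W"
  shows "direct_decomp R (push e) (span e V) (span e W)"
  unfolding direct_decomp_def
proof (intro conjI)
  let ?q = "p ^ e" and ?F = "frob (p ^ e)"
  have sub: "V \<subseteq> toric_exps n" "W \<subseteq> toric_exps n" using VW by auto
  show sV: "submodule (span e V) R (push e)" using sub(1) V by (rule span_submodule)
  show sW: "submodule (span e W) R (push e)" using sub(2) W by (rule span_submodule)
  interpret M: module R "push e" by (rule module_push)
  note zero = M.submoduleE[OF sV] M.submoduleE[OF sW]
  show "span e V <+>\<^bsub>push e\<^esub> span e W = carrier (push e)"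
  proof (intro equalityI subsetI)
    fix x assume "x \<in> span e V <+>\<^bsub>push e\<^esub> span e W"
    then show "x \<in> carrier (push e)" by (auto simp: set_add_def set_mult_def span_def)
  next
    fix x assume "x \<in> carrier (push e)"
    then have x: "x \<in> carrier R" by simp
    obtain g s where gs: "g \<in> polys" "s \<in> denoms" "ev s \<otimes> x = ev g"
      using fraction_obtain[OF x] .
    note d = denomsD[OF gs(2)]
    \<comment> \<open>Expand the fraction \<open>g / s\<close> such that its denominator becomes the \<open>q\<close>-th power of \<open>s\<close>.\<close>
    define h where "h = s ^ (?q - 1) * g"
    have h: "h \<in> polys" using gs d by (auto simp: h_def)
    have "Suc (?q - 1) = ?q" using pow_pos by simp
    then have "ev s [^] ?q = ev s [^] (?q - 1) \<otimes> ev s" by (metis nat_pow_Suc)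
    then have hx: "ev s [^] ?q \<otimes> x = ev h"
      using d gs x by (simp add: h_def ev_mult ev_power power_toric_polys m_assoc)
    obtain h1 h2 where hh: "supp h1 \<subseteq> V" "supp h2 \<subseteq> W" "h1 + h2 = h"
      using frag_split[of h V W] h VW by (auto simp: toric_polys_def)
    have Z: "h1 \<in> polys" "h2 \<in> polys" using hh sub by (auto simp: toric_polys_def)
    have u: "ev s [^] ?q \<in> Units R" using d by (simp add: Units_pow_closed)
    define x1 where "x1 = inv (ev s [^] ?q) \<otimes> ev h1"
    define x2 where "x2 = inv (ev s [^] ?q) \<otimes> ev h2"
    have c: "x1 \<in> carrier R" "x2 \<in> carrier R" using u Z by (auto simp: x1_def x2_def)
    have sx: "ev s [^] ?q \<otimes> x1 = ev h1" "ev s [^] ?q \<otimes> x2 = ev h2"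
      using u Z Units_closed[OF u] by (simp_all add: x1_def x2_def m_assoc[symmetric])
    have "ev s [^] ?q \<otimes> (x1 \<oplus> x2) = ev s [^] ?q \<otimes> x"
      using c sx hx hh(3) Z d by (simp add: r_distr ev_add[symmetric])
    then have "x = x1 \<oplus> x2" using Units_cancel[OF u] c x by (metis a_closed)
    moreover have "x1 \<in> span e V" "x2 \<in> span e W"
      using c sx hh gs(2) by (auto simp: span_def)
    ultimately show "x \<in> span e V <+>\<^bsub>push e\<^esub> span e W"
      by (auto simp: set_add_def set_mult_def)
  qed
  show "span e V \<inter> span e W = {\<zero>\<^bsub>push e\<^esub>}"
  proof (intro equalityI subsetI)
    fix x assume "x \<in> span e V \<inter> span e W"
    then obtain s g t h where a: "x \<in> carrier R" "s \<in> denoms" "supp g \<subseteq> V" "ev s [^] ?q \<otimes> x = ev g"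
      and b: "t \<in> denoms" "supp h \<subseteq> W" "ev t [^] ?q \<otimes> x = ev h"
      by (auto simp: span_def)
    have Z: "g \<in> polys" "h \<in> polys" using a b sub by (auto simp: toric_polys_def)
    note d = denomsD[OF a(2)] denomsD[OF b(1)]
    have "ev (?F t * g) = ev t [^] ?q \<otimes> (ev s [^] ?q \<otimes> x)"
      unfolding a(4) using d Z by (simp add: ev_mult ev_frobenius frob_toric_polys)
    also have "\<dots> = ev s [^] ?q \<otimes> (ev t [^] ?q \<otimes> x)" using d a(1) by (simp add: m_ac)
    also have "\<dots> = ev (?F s * h)"
      unfolding b(3) using d Z by (simp add: ev_mult ev_frobenius frob_toric_polys)
    finally have v: "vanishes_mod p (?F t * g - ?F s * h)"
      using d Z by (subst (asm) ev_eq_iff) (auto simp: frob_toric_polys)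
    have sV': "supp (?F t * g) \<subseteq> V" by (rule supp_frobenius_mult[where V = V and q = ?q, OF V d(4) a(3)])
    have sW': "supp (?F s * h) \<subseteq> W" by (rule supp_frobenius_mult[where V = W and q = ?q, OF W d(1) b(2)])
    have "vanishes_mod p (?F t * g)"
      unfolding vanishes_mod_def
    proof
      fix u
      show "int p dvd coef (?F t * g) u"
      proof (cases "u \<in> V")
        case True
        then have "u \<notin> supp (?F s * h)" using sW' VW(2) by auto
        then have "coef (?F t * g) u = coef (?F t * g - ?F s * h) u"
          by (simp add: lookup_minus in_keys_iff)
        then show ?thesis using v by (simp add: vanishes_mod_def)
      next
        case False
        then have "u \<notin> supp (?F t * g)" using sV' by auto
        then show ?thesis by (simp add: in_keys_iff)
      qed
    qed
    then have "ev (?F t * g) = \<zero>" using d Z by (subst ev_eq_zero_iff) (auto simp: frob_toric_polys)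
    then have "ev t [^] ?q \<otimes> (ev s [^] ?q \<otimes> x) = \<zero>"
      unfolding a(4) using d Z by (simp add: ev_mult ev_frobenius frob_toric_polys)
    also have "\<dots> = ev t [^] ?q \<otimes> (ev s [^] ?q \<otimes> \<zero>)" using d by simp
    finally have "ev t [^] ?q \<otimes> (ev s [^] ?q \<otimes> x) = ev t [^] ?q \<otimes> (ev s [^] ?q \<otimes> \<zero>)" .
    from Units_cancel[OF Units_pow_closed[OF d(5)] _ _ this]
    have "ev s [^] ?q \<otimes> x = ev s [^] ?q \<otimes> \<zero>" using d a(1) by simp
    from Units_cancel[OF Units_pow_closed[OF d(2)] _ _ this]
    have "x = \<zero>" using a(1) by simp
    then show "x \<in> {\<zero>\<^bsub>push e\<^esub>}" by simp
  next
    fix x assume "x \<in> {\<zero>\<^bsub>push e\<^esub>}"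
    then show "x \<in> span e V \<inter> span e W"
      using one_denoms by (auto simp: span_def ev_one ev_zero intro!: bexI[of _ 1] exI[of _ 0])
  qed
qed

section \<open>The free part of the pushforward\<close>

text \<open>The isomorphism from the free module: the basis vector with index \<open>i\<close> goes to the monomial
  with exponent \<open>t i\<close>.\<close>

definition monomial_sum :: "nat \<Rightarrow> (nat \<Rightarrow> expo) \<Rightarrow> nat \<Rightarrow> (nat \<Rightarrow> 'a) \<Rightarrow> 'a"
  where "monomial_sum e t a v = (\<Oplus>i\<in>{..<a}. v i [^] (p ^ e) \<otimes> ev (frag_of (t i)))"

lemma monomial_sum_fraction:
  assumes s: "s \<in> denoms"
    and g: "\<And>i. i < a \<Longrightarrow> g i \<in> polys"
    and v: "\<And>i. i < a \<Longrightarrow> v i \<in> carrier R" "\<And>i. i < a \<Longrightarrow> ev s \<otimes> v i = ev (g i)"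
    and t: "\<And>i. i < a \<Longrightarrow> t i \<in> toric_exps n"
  shows "ev s [^] (p ^ e) \<otimes> monomial_sum e t a v =
    ev (\<Sum>i<a. frag_of (t i) * frob (p ^ e) (g i))"
proof -
  note d = denomsD[OF s]
  let ?q = "p ^ e"
  have "ev s [^] ?q \<otimes> monomial_sum e t a v = (\<Oplus>i\<in>{..<a}. ev s [^] ?q \<otimes> (v i [^] ?q \<otimes> ev (frag_of (t i))))"
    unfolding monomial_sum_def using d v t by (intro finsum_rdistr) auto
  also have "\<dots> = (\<Oplus>i\<in>{..<a}. ev (frag_of (t i) * frob ?q (g i)))"
  proof (rule finsum_cong')
    fix i assume i: "i \<in> {..<a}"
    then have c: "v i \<in> carrier R" "g i \<in> polys" "t i \<in> toric_exps n" using v g t by auto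
    have "ev s [^] ?q \<otimes> (v i [^] ?q \<otimes> ev (frag_of (t i))) = (ev s \<otimes> v i) [^] ?q \<otimes> ev (frag_of (t i))"
      using d c by (simp add: nat_pow_distrib m_assoc)
    also have "\<dots> = ev (frag_of (t i) * frob ?q (g i))"
      using i v(2) c by (simp add: ev_frobenius ev_mult frob_toric_polys m_comm)
    finally show "ev s [^] ?q \<otimes> (v i [^] ?q \<otimes> ev (frag_of (t i))) = ev (frag_of (t i) * frob ?q (g i))" .
  qed (use g t in \<open>auto intro!: ev_closed mult_toric_polys frob_toric_polys\<close>)
  also have "\<dots> = ev (\<Sum>i<a. frag_of (t i) * frob ?q (g i))"
    using g t by (intro ev_sum[symmetric]) (auto intro!: mult_toric_polys frob_toric_polys)
  finally show ?thesis .
qed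

text \<open>An exponent has at most one expression as a small exponent plus a multiple of \<open>q\<close>, so the
  polynomials \<open>g j\<close> can be read off from the sum. This gives injectivity.\<close>

lemma coef_monomial_sum:
  fixes t :: "nat \<Rightarrow> expo"
  assumes t: "bij_betw t {..<a} (small_exps n q)" and q: "q > 0" and j: "j < a"
  shows "coef (\<Sum>i<a. frag_of (t i) * frob q (g i)) (t j + scale_exp q u) = coef (g j) u"
proof -
  have "coef (frag_of (t i) * frob q (g i)) (t j + scale_exp q u) = (if i = j then coef (g j) u else 0)"
    if i: "i < a" for i
  proof (cases "i = j")
    case True
    then show ?thesis by (simp add: lookup_frag_of_times lookup_frob[OF q])
  next
    case False
    have "t j + scale_exp q u \<notin> supp (frag_of (t i) * frob q (g i))"
    proof
      assume "t j + scale_exp q u \<in> supp (frag_of (t i) * frob q (g i))"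
      then obtain w where w: "w \<in> supp (frob q (g i))" "t j + scale_exp q u = t i + w"
        unfolding keys_frag_of_times by blast
      then obtain u' where "t j + scale_exp q u = t i + scale_exp q u'"
        using keys_frob[of q "g i"] by blast
      then have "t j = t i" using small_exps_decomp_unique[of "t j" n q "t i" u u'] t i j
        by (auto dest: bij_betwE)
      then show False using t i j False by (auto simp: bij_betw_def inj_on_def)
    qed
    then show ?thesis using False by (simp add: in_keys_iff)
  qed
  then have "coef (\<Sum>i<a. frag_of (t i) * frob q (g i)) (t j + scale_exp q u) =
      (\<Sum>i\<in>{..<a}. if i = j then coef (g j) u else 0)"
    unfolding lookup_sum by (intro sum.cong) auto
  also have "\<dots> = coef (g j) u" using j by (subst sum.delta) auto
  finally show ?thesis .
qed

text \<open>The counterpart for surjectivity: each monomial with exponent in \<open>free_exps\<close> is a small one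
  times a Frobenius power.\<close>

lemma free_exps_poly_decomp:
  fixes t :: "nat \<Rightarrow> expo"
  assumes t: "bij_betw t {..<a} (small_exps n q)" and g: "supp g \<subseteq> free_exps n q"
  shows "\<exists>f. (\<forall>i<a. f i \<in> polys) \<and> g = (\<Sum>i<a. frag_of (t i) * frob q (f i))"
  using g
proof (induction g rule: frag_induction)
  case zero
  show ?case by (rule exI[of _ "\<lambda>_. 0"]) (simp add: frob_def)
next
  case (one x)
  then obtain t' u where x: "t' \<in> small_exps n q" "u \<in> toric_exps n" "x = t' + scale_exp q u"
    by (auto simp: free_exps_def)
  then have "t' \<in> t ` {..<a}" using t by (simp add: bij_betw_def)
  then obtain j where j: "j < a" "t' = t j" by auto
  let ?f = "\<lambda>i. if i = j then frag_of u else 0"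
  have "(\<Sum>i<a. frag_of (t i) * frob q (?f i)) =
     (\<Sum>i<a. if i = j then frag_of (t j) * frag_of (scale_exp q u) else 0)"
    by (rule sum.cong) (auto simp: frob_def)
  also have "\<dots> = frag_of x" using j x by (subst sum.delta) (auto simp: frag_of_mult)
  finally show ?case using x by (intro exI[of _ ?f]) auto
next
  case (diff g h)
  then obtain f f' where f: "\<forall>i<a. f i \<in> polys" "g = (\<Sum>i<a. frag_of (t i) * frob q (f i))"
    and f': "\<forall>i<a. f' i \<in> polys" "h = (\<Sum>i<a. frag_of (t i) * frob q (f' i))"
    by blast
  have "g - h = (\<Sum>i<a. frag_of (t i) * frob q (f i - f' i))"
    unfolding f f' by (simp add: frob_diff right_diff_distrib sum_subtractf)
  then show ?case using f(1) f'(1) by (intro exI[of _ "\<lambda>i. f i - f' i"]) auto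
qed

lemma free_of_rank_free_span:
  "free_of_rank R ((push e)\<lparr>carrier := span e (free_exps n (p ^ e))\<rparr>) (card (small_exps n (p ^ e)))"
proof -
  let ?q = "p ^ e"
  define a where "a = card (small_exps n ?q)"
  let ?F = "free_module R a" and ?N = "span e (free_exps n ?q)"
  have q: "?q > 0" by (rule pow_pos)
  obtain t where t: "bij_betw t {..<a} (small_exps n ?q)"
    using ex_bij_betw_nat_finite[OF finite_small_exps[OF n_pos, of ?q]]
    by (auto simp: a_def atLeast0LessThan)
  have tT: "t i \<in> toric_exps n" "t i \<in> small_exps n ?q" if "i < a" for i
    using t that by (auto dest!: bij_betwE simp: small_exps_def)
  define h where "h = monomial_sum e t a"
  have Fc: "v i \<in> carrier R" if "v \<in> carrier ?F" "i < a" for v i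
    using that by (auto simp: carrier_free_module)
  have hc: "h v \<in> carrier R" if "v \<in> carrier ?F" for v
    unfolding h_def monomial_sum_def using Fc[OF that] tT by (intro finsum_closed) auto
  have frac: "\<exists>s\<in>denoms. \<exists>g. (\<forall>i<a. g i \<in> polys) \<and> (\<forall>i<a. ev s \<otimes> v i = ev (g i)) \<and>
     ev s [^] ?q \<otimes> h v = ev (\<Sum>i<a. frag_of (t i) * frob ?q (g i))" if v: "v \<in> carrier ?F" for v
  proof -
    obtain s g where "s \<in> denoms" "\<forall>i\<in>{..<a}. g i \<in> polys \<and> ev s \<otimes> v i = ev (g i)"
      using common_denominator[of "{..<a}" v] Fc[OF v] by auto
    then show ?thesis
      using monomial_sum_fraction[of s a g v t e] Fc[OF v] tT unfolding h_def by blast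
  qed
  have hN: "h v \<in> ?N" if v: "v \<in> carrier ?F" for v
  proof -
    obtain s g where s: "s \<in> denoms" and g: "\<forall>i<a. g i \<in> polys"
      and e: "ev s [^] ?q \<otimes> h v = ev (\<Sum>i<a. frag_of (t i) * frob ?q (g i))"
      using frac[OF v] by blast
    have "supp (\<Sum>i<a. frag_of (t i) * frob ?q (g i)) \<subseteq> free_exps n ?q"
    proof
      fix w assume "w \<in> supp (\<Sum>i<a. frag_of (t i) * frob ?q (g i))"
      then obtain i where i: "i < a" "w \<in> supp (frag_of (t i) * frob ?q (g i))"
        using keys_sum[of "\<lambda>i. frag_of (t i) * frob ?q (g i)" "{..<a}"] by blast
      then obtain u where "u \<in> supp (g i)" "w = t i + scale_exp ?q u"
        using keys_frob[of ?q "g i"] unfolding keys_frag_of_times by blast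
      then show "w \<in> free_exps n ?q"
        using g i(1) tT(2)[OF i(1)] unfolding free_exps_def toric_polys_def by blast
    qed
    then show ?thesis using spanI[OF hc[OF v] s _ e] by blast
  qed
  have hadd: "h (v \<oplus>\<^bsub>?F\<^esub> w) = h v \<oplus> h w" if "v \<in> carrier ?F" "w \<in> carrier ?F" for v w
  proof -
    have "h (v \<oplus>\<^bsub>?F\<^esub> w) = (\<Oplus>i\<in>{..<a}. v i [^] ?q \<otimes> ev (frag_of (t i)) \<oplus> w i [^] ?q \<otimes> ev (frag_of (t i)))"
      unfolding h_def monomial_sum_def
      by (rule finsum_cong') (use that[THEN Fc] tT in \<open>auto simp: free_module_ops frobenius_add l_distr\<close>)
    also have "\<dots> = h v \<oplus> h w"
      unfolding h_def monomial_sum_def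
      by (rule finsum_addf) (use that[THEN Fc] tT in auto)
    finally show ?thesis .
  qed
  have hsm: "h (r \<odot>\<^bsub>?F\<^esub> v) = r [^] ?q \<otimes> h v" if "r \<in> carrier R" "v \<in> carrier ?F" for r v
  proof -
    have "h (r \<odot>\<^bsub>?F\<^esub> v) = (\<Oplus>i\<in>{..<a}. r [^] ?q \<otimes> (v i [^] ?q \<otimes> ev (frag_of (t i))))"
      unfolding h_def monomial_sum_def
      by (rule finsum_cong') (use that(1) Fc[OF that(2)] tT in \<open>auto simp: free_module_ops nat_pow_distrib m_assoc\<close>)
    also have "\<dots> = r [^] ?q \<otimes> h v"
      unfolding h_def monomial_sum_def
      by (rule finsum_rdistr[symmetric]) (use that(1) Fc[OF that(2)] tT in auto)
    finally show ?thesis .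
  qed
  have inj: "inj_on h (carrier ?F)"
  proof (rule inj_onI)
    fix v w assume v: "v \<in> carrier ?F" and w: "w \<in> carrier ?F" and eq: "h v = h w"
    obtain s g where s: "s \<in> denoms" and g: "\<forall>i<a. g i \<in> polys" "\<forall>i<a. ev s \<otimes> v i = ev (g i)"
      using frac[OF v] by blast
    obtain s' g' where s': "s' \<in> denoms" and g': "\<forall>i<a. g' i \<in> polys" "\<forall>i<a. ev s' \<otimes> w i = ev (g' i)"
      using frac[OF w] by blast
    note d = denomsD[OF s] denomsD[OF s']
    define f f' where "f i = s' * g i" and "f' i = s * g' i" for i
    have f: "f i \<in> polys" "ev (s * s') \<otimes> v i = ev (f i)"
      and f': "f' i \<in> polys" "ev (s * s') \<otimes> w i = ev (f' i)" if "i < a" for i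
    proof -
      have gi: "g i \<in> polys" "ev s \<otimes> v i = ev (g i)" "g' i \<in> polys" "ev s' \<otimes> w i = ev (g' i)"
        using g g' that by auto
      note c = Fc[OF v that] Fc[OF w that]
      show "f i \<in> polys" "f' i \<in> polys" using gi d by (auto simp: f_def f'_def)
      have "ev (s * s') \<otimes> v i = ev s' \<otimes> (ev s \<otimes> v i)" using d c by (simp add: ev_mult m_ac)
      then show "ev (s * s') \<otimes> v i = ev (f i)" unfolding gi(2) using d gi by (simp add: f_def ev_mult)
      have "ev (s * s') \<otimes> w i = ev s \<otimes> (ev s' \<otimes> w i)" using d c by (simp add: ev_mult m_assoc)
      then show "ev (s * s') \<otimes> w i = ev (f' i)" unfolding gi(4) using d gi by (simp add: f'_def ev_mult)
    qed
    let ?S = "\<lambda>f. \<Sum>i<a. frag_of (t i) * frob ?q (f i)"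
    have ss: "s * s' \<in> denoms" using s s' by (rule denoms_mult)
    have "ev (?S f) = ev (s * s') [^] ?q \<otimes> h v"
      unfolding h_def using Fc[OF v] f tT by (intro monomial_sum_fraction[symmetric] ss) auto
    also have "\<dots> = ev (?S f')"
      unfolding eq unfolding h_def using Fc[OF w] f' tT by (intro monomial_sum_fraction ss) auto
    finally have van: "vanishes_mod p (?S f - ?S f')"
      using f f' tT by (subst (asm) ev_eq_iff) (auto intro!: sum_toric_polys mult_toric_polys frob_toric_polys)
    have "v i = w i" if i: "i < a" for i
    proof -
      have "int p dvd coef (f i - f' i) u" for u
      proof -
        have "int p dvd coef (?S f - ?S f') (t i + scale_exp ?q u)"
          using van unfolding vanishes_mod_def ..
        then show ?thesis unfolding lookup_minus coef_monomial_sum[OF t q i] .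
      qed
      then have "ev (f i) = ev (f' i)"
        using f(1)[OF i] f'(1)[OF i] by (simp add: ev_eq_iff vanishes_mod_def)
      then have "ev (s * s') \<otimes> v i = ev (s * s') \<otimes> w i" using f(2)[OF i] f'(2)[OF i] by simp
      from Units_cancel[OF denomsD(2)[OF ss] _ _ this] show ?thesis using Fc[OF v i] Fc[OF w i] by simp
    qed
    then show "v = w" using PiE_ext[OF v[unfolded carrier_free_module] w[unfolded carrier_free_module]] by simp
  qed
  have surj: "x \<in> h ` carrier ?F" if "x \<in> ?N" for x
  proof -
    note xN = that
    obtain s g where x: "x \<in> carrier R" "s \<in> denoms" "supp g \<subseteq> free_exps n ?q" "ev s [^] ?q \<otimes> x = ev g"
      using xN by (auto simp: span_def)
    obtain f where f: "\<forall>i<a. f i \<in> polys" "g = (\<Sum>i<a. frag_of (t i) * frob ?q (f i))"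
      using free_exps_poly_decomp[OF t x(3)] by blast
    note d = denomsD[OF x(2)]
    define v where "v = (\<lambda>i\<in>{..<a}. inv (ev s) \<otimes> ev (f i))"
    have v: "v \<in> carrier ?F" using d f by (auto simp: v_def carrier_free_module)
    have "ev s \<otimes> v i = ev (f i)" if "i < a" for i
      using d f that by (simp add: v_def m_assoc[symmetric])
    then have "ev s [^] ?q \<otimes> h v = ev g"
      unfolding f(2) h_def using f(1) Fc[OF v] tT by (intro monomial_sum_fraction x(2)) auto
    then have "ev s [^] ?q \<otimes> h v = ev s [^] ?q \<otimes> x" using x(4) by simp
    from Units_cancel[OF Units_pow_closed[OF d(2)] hc[OF v] x(1) this] show ?thesis using v by blast
  qed
  have "bij_betw h (carrier ?F) ?N"
    unfolding bij_betw_def using inj hN surj by blast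
  then have "h \<in> module_iso R ?F ((push e)\<lparr>carrier := ?N\<rparr>)"
    by (simp add: module_iso_def hadd hsm)
  then show ?thesis unfolding free_of_rank_def a_def by blast
qed

section \<open>The complement of the free part\<close>

text \<open>If \<open>\<phi>\<close> took a unit at the monomial of \<open>v\<close>, then the relation between the monomials of \<open>v\<close>
  and of the moved exponent \<open>v'\<close> would show that the monomial of \<open>m2\<close> divides that of \<open>m1\<close> in the
  local ring. Comparing coefficients at \<open>m1\<close>, this contradicts \<open>m1 - m2\<close> being outside the
  semigroup.\<close>

lemma monomial_form_nonunit:
  assumes \<phi>: "linear_form R ((push e)\<lparr>carrier := span e (toric_exps n - free_exps n (p ^ e))\<rparr>) \<phi>"
    and v: "v \<in> toric_exps n - free_exps n (p ^ e)"
  shows "\<phi> (ev (frag_of v)) \<in> max_ideal"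
proof (rule ccontr)
  let ?q = "p ^ e"
  let ?V = "toric_exps n - free_exps n ?q"
  assume "\<phi> (ev (frag_of v)) \<notin> max_ideal"
  have mono: "ev (frag_of w) \<in> span e ?V" if "w \<in> ?V" for w
    using that one_denoms by (intro spanI[of _ 1 "frag_of w"]) (auto simp: ev_one)
  have \<phi>c: "\<phi> x \<in> carrier R" if "x \<in> span e ?V" for x using linear_formD(1)[OF \<phi>, of x] that by simp
  have \<phi>s: "\<phi> (r [^] ?q \<otimes> x) = r \<otimes> \<phi> x" if "x \<in> span e ?V" "r \<in> carrier R" for x r
    using linear_formD(3)[OF \<phi>, of r x] that by simp
  have unit: "\<phi> (ev (frag_of v)) \<in> Units R"
    using \<open>\<phi> (ev (frag_of v)) \<notin> max_ideal\<close> \<phi>c[OF mono[OF v]] by (simp add: max_ideal_def)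
  obtain v' m1 m2 where m: "v' \<in> ?V" "m1 \<in> toric_exps n" "m2 \<in> toric_exps n"
    "v' + scale_exp ?q m2 = v + scale_exp ?q m1" "\<And>w. m1 \<noteq> m2 + w"
    using nonfree_exps_move[OF v pow_pos] by blast
  have T: "v \<in> toric_exps n" "v' \<in> toric_exps n" using v m by auto
  let ?f = "\<lambda>m. ev (frag_of m)"
  have pw: "?f m [^] ?q \<otimes> ?f w = ?f (w + scale_exp ?q m)" if "m \<in> toric_exps n" "w \<in> toric_exps n" for m w
  proof -
    have "?f m [^] ?q \<otimes> ?f w = ev (frag_of (scale_exp ?q m) * frag_of w)"
      using that by (subst ev_mult) (auto simp: ev_power[symmetric] frag_of_power scale_exp_in_toric_exps)
    then show ?thesis by (simp add: frag_of_mult add.commute)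
  qed
  have "?f m2 \<otimes> \<phi> (?f v') = \<phi> (?f m2 [^] ?q \<otimes> ?f v')" using \<phi>s mono m by simp
  also have "\<dots> = \<phi> (?f m1 [^] ?q \<otimes> ?f v)" using pw T m by simp
  also have "\<dots> = ?f m1 \<otimes> \<phi> (?f v)" using \<phi>s mono m v by simp
  finally have eq: "?f m2 \<otimes> \<phi> (?f v') = ?f m1 \<otimes> \<phi> (?f v)" .
  define r where "r = \<phi> (?f v') \<otimes> inv (\<phi> (?f v))"
  have c: "\<phi> (?f v') \<in> carrier R" "\<phi> (?f v) \<in> carrier R" using \<phi>c mono m v by auto
  have r: "r \<in> carrier R" using c unit by (simp add: r_def)
  have "?f m2 \<otimes> r = ?f m2 \<otimes> \<phi> (?f v') \<otimes> inv (\<phi> (?f v))"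
    using c unit m by (simp add: r_def m_assoc)
  also have "\<dots> = ?f m1" unfolding eq using c unit m by (simp add: m_assoc)
  finally have fr: "?f m2 \<otimes> r = ?f m1" .
  obtain g s where gs: "g \<in> polys" "s \<in> denoms" "ev s \<otimes> r = ev g"
    using fraction_obtain[OF r] .
  note d = denomsD[OF gs(2)]
  have "ev (frag_of m1 * s) = (?f m2 \<otimes> r) \<otimes> ev s" using fr d m by (simp add: ev_mult)
  also have "\<dots> = ?f m2 \<otimes> (ev s \<otimes> r)" using d m r by (simp add: m_ac)
  also have "\<dots> = ev (frag_of m2 * g)" using gs m by (simp add: ev_mult)
  finally have "vanishes_mod p (frag_of m1 * s - frag_of m2 * g)"
    using d gs m by (subst (asm) ev_eq_iff) auto
  then have "int p dvd coef (frag_of m1 * s) m1 - coef (frag_of m2 * g) m1"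
    by (simp add: vanishes_mod_def lookup_minus)
  moreover have "coef (frag_of m1 * s) m1 = coef s 0"
    using lookup_frag_of_times[of m1 s 0] by simp
  moreover have "m1 \<notin> supp (frag_of m2 * g)" unfolding keys_frag_of_times using m(5) by blast
  then have "coef (frag_of m2 * g) m1 = 0" by (simp add: in_keys_iff)
  ultimately show False using gs(2) by (simp add: toric_denoms_def)
qed

text \<open>Monomials generate the complement, and the nonunits form an ideal.\<close>

lemma nonfree_form_nonunit:
  assumes \<phi>: "linear_form R ((push e)\<lparr>carrier := span e (toric_exps n - free_exps n (p ^ e))\<rparr>) \<phi>"
    and x: "x \<in> span e (toric_exps n - free_exps n (p ^ e))"
  shows "\<phi> x \<notin> Units R"
proof
  let ?q = "p ^ e"
  let ?V = "toric_exps n - free_exps n ?q"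
  interpret m: ideal max_ideal R by (rule ideal_max_ideal)
  assume unit: "\<phi> x \<in> Units R"
  have Vc: "v + scale_exp ?q u \<in> ?V" if "v \<in> ?V" "u \<in> toric_exps n" for v u
    using that free_exps_sub[OF _ _ pow_pos] by blast
  interpret M: module R "push e" by (rule module_push)
  have sub: "submodule (span e ?V) R (push e)" using Vc by (intro span_submodule) auto
  have \<phi>c: "\<phi> x \<in> carrier R" if "x \<in> span e ?V" for x using linear_formD(1)[OF \<phi>, of x] that by simp
  have \<phi>s: "\<phi> (r [^] ?q \<otimes> x) = r \<otimes> \<phi> x" if "x \<in> span e ?V" "r \<in> carrier R" for x r
    using linear_formD(3)[OF \<phi>, of r x] that by simp
  have \<phi>a: "\<phi> (x \<oplus> y) = \<phi> x \<oplus> \<phi> y" if "x \<in> span e ?V" "y \<in> span e ?V" for x y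
    using linear_formD(2)[OF \<phi>, of x y] that by simp
  have poly: "ev g \<in> span e ?V" if "supp g \<subseteq> ?V" for g
  proof (rule spanI[of _ 1 g])
    have "g \<in> polys" using that by (auto simp: toric_polys_def)
    then show "ev g \<in> carrier R" "ev 1 [^] (p ^ e) \<otimes> ev g = ev g" by (simp_all add: ev_one)
  qed (use that one_denoms in auto)
  have mem: "supp g \<subseteq> ?V \<and> \<phi> (ev g) \<in> max_ideal" if "supp g \<subseteq> ?V" for g
    using that
  proof (induction g rule: frag_induction)
    case zero
    have 0: "ev 0 \<in> span e ?V" by (rule poly) simp
    have "\<phi> (\<zero> [^] ?q \<otimes> ev 0) = \<zero>" using \<phi>s[OF 0, of \<zero>] \<phi>c[OF 0] by simp
    then show ?case by (simp add: ev_zero m.zero_closed)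
  next
    case (one v)
    then show ?case using monomial_form_nonunit[OF \<phi>] by simp
  next
    case (diff g h)
    have V: "supp (g - h) \<subseteq> ?V" using diff keys_diff[of g h] by blast
    have Z: "g \<in> polys" "h \<in> polys" "g - h \<in> polys"
      using diff V by (auto simp: toric_polys_def)
    have s: "ev g \<in> span e ?V" "ev h \<in> span e ?V" "ev (g - h) \<in> span e ?V" using diff V poly by auto
    have "ev g = ev (g - h) \<oplus> ev h" using ev_add[OF Z(3,2)] by simp
    then have "\<phi> (ev g) = \<phi> (ev (g - h)) \<oplus> \<phi> (ev h)" using \<phi>a s by simp
    then have "\<phi> (ev (g - h)) = \<phi> (ev g) \<ominus> \<phi> (ev h)"
      using s[THEN \<phi>c] by (metis a_minus_def add.inv_solve_right')
    also have "\<dots> \<in> max_ideal" using diff by (simp add: a_minus_def m.a_closed)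
    finally show ?case using V by simp
  qed
  obtain s g where a: "x \<in> carrier R" "s \<in> denoms" "supp g \<subseteq> ?V" "ev s [^] ?q \<otimes> x = ev g"
    using x by (auto simp: span_def)
  note d = denomsD[OF a(2)]
  have "ev s \<otimes> \<phi> x = \<phi> (ev g)" using \<phi>s[OF x d(3)] a(4) by simp
  then have "ev s \<otimes> \<phi> x \<in> max_ideal" using mem[OF a(3)] by simp
  then show False using d unit by (simp add: max_ideal_def)
qed

theorem free_rank_push: "free_rank R (push e) = card (small_exps n (p ^ e))"
proof (rule free_rank_eqI[OF module_push _ free_of_rank_free_span])
  show "direct_decomp R (push e) (span e (free_exps n (p ^ e)))
     (span e (toric_exps n - free_exps n (p ^ e)))"
  proof (rule span_decomp)
    fix v u assume "v \<in> toric_exps n - free_exps n (p ^ e)" "u \<in> toric_exps n"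
    then show "v + scale_exp (p ^ e) u \<in> toric_exps n - free_exps n (p ^ e)"
      using free_exps_sub[OF _ _ pow_pos] by blast
  qed (use free_exps_subset free_exps_add in auto)
qed (rule nonfree_form_nonunit)

section \<open>A long chain of primes\<close>

text \<open>The monomial of \<open>w\<close> lives on the larger face only.\<close>

lemma face_ideal_psubset:
  assumes "w \<in> toric_exps n" "\<And>x. x \<in> Z \<Longrightarrow> coef w x = 0" "coef w z \<noteq> 0"
  shows "face_ideal Z \<subset> face_ideal (insert z Z)"
proof
  show "face_ideal Z \<subseteq> face_ideal (insert z Z)"
    unfolding face_ideal_def using vanishes_mod_face_part_mono[of p Z _ "insert z Z"] by blast
  have iff: "ev (frag_of w) \<in> face_ideal Y \<longleftrightarrow> vanishes_mod p (face_part Y (frag_of w))" for Y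
    using assms(1) one_denoms by (intro face_ideal_iff[of _ 1]) (auto simp: ev_one)
  have "vanishes_mod p (face_part (insert z Z) (frag_of w))"
    using assms(3) by (simp add: face_part_def)
  moreover have "\<not> vanishes_mod p (face_part Z (frag_of w))"
    using assms(2) one_denoms by (auto simp: face_part_def vanishes_mod_def toric_denoms_def lookup_single intro!: exI[of _ w])
  ultimately show "face_ideal Z \<noteq> face_ideal (insert z Z)" using iff by blast
qed

text \<open>Each prime of the chain belongs to a face of the semigroup. The faces shrink as the entries
  of the first column and then those of the first row are set to zero; these \<open>2 * n - 1\<close> entries
  determine an exponent, so the last face is the origin.\<close>

lemma long_chain:
  "\<exists>P. (\<forall>i\<le>2 * n - 1. primeideal (P i) R) \<and> (\<forall>i<2 * n - 1. P i \<subset> P (Suc i))"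
proof -
  \<comment> \<open>Each step needs an exponent that is nonzero at the new entry but zero at the earlier ones; the row of \<open>x\<^sub>i\<close> or the column of \<open>y\<^sub>j\<close> through the new entry serves.\<close>
  define L where "L k = (if k < n then (k + 1, 1) else (1, k - n + 2))" for k
  have "face_ideal (L ` {..<k}) \<subset> face_ideal (L ` {..<Suc k})" if k: "k < 2 * n - 1" for k
  proof -
    have "\<exists>w\<in>toric_exps n. (\<forall>x\<in>L ` {..<k}. coef w x = 0) \<and> coef w (L k) \<noteq> 0"
    proof (cases "k < n")
      case True
      then show ?thesis
        by (intro bexI[of _ "outer_sum n (\<lambda>i. if i = k + 1 then 1 else 0) (\<lambda>_. 0)"])
          (auto simp: L_def lookup_outer_sum)
    next
      case False
      then show ?thesis using k
        by (intro bexI[of _ "outer_sum n (\<lambda>_. 0) (\<lambda>j. if j = k - n + 2 then 1 else 0)"])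
          (auto simp: L_def lookup_outer_sum)
    qed
    then obtain w where w: "w \<in> toric_exps n" "\<forall>x\<in>L ` {..<k}. coef w x = 0" "coef w (L k) \<noteq> 0"
      by blast
    have "face_ideal (L ` {..<k}) \<subset> face_ideal (insert (L k) (L ` {..<k}))"
      by (rule face_ideal_psubset[OF w(1) _ w(3)]) (rule bspec[OF w(2)])
    then show ?thesis by (simp only: lessThan_Suc image_insert)
  qed
  then show ?thesis using primeideal_face_ideal by (intro exI[of _ "\<lambda>k. face_ideal (L ` {..<k})"]) auto
qed

section \<open>Bounding chains of primes by growth\<close>

text \<open>Elements that become polynomials of degree at most \<open>k * D\<close> in each variable after
  multiplication by the \<open>k\<close>-th power of one fixed denominator.\<close>

definition growth :: "(expo \<Rightarrow>\<^sub>0 int) \<Rightarrow> nat \<Rightarrow> nat \<Rightarrow> 'a set"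
  where "growth s D k = {r \<in> carrier R. \<exists>g. supp g \<subseteq> bounded_exps n (k * D) \<and> ev s [^] k \<otimes> r = ev g}"

lemma bounded_exps_toric: "supp g \<subseteq> bounded_exps n D \<Longrightarrow> g \<in> polys"
  by (auto simp: toric_polys_def bounded_exps_def)

lemma bounded_mult:
  assumes "supp f \<subseteq> bounded_exps n a" "supp g \<subseteq> bounded_exps n b"
  shows "supp (f * g) \<subseteq> bounded_exps n (a + b)"
proof
  fix w assume "w \<in> supp (f * g)"
  then obtain u v where "w = u + v" "u \<in> supp f" "v \<in> supp g" using keys_mult[of f g] by blast
  then show "w \<in> bounded_exps n (a + b)"
    using assms by (auto simp: bounded_exps_def lookup_add add_in_toric_exps subset_iff intro: add_mono)
qed

lemma bounded_power:
  assumes "supp f \<subseteq> bounded_exps n a"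
  shows "supp (f ^ k) \<subseteq> bounded_exps n (k * a)"
proof (induction k)
  case 0 then show ?case by (auto simp: bounded_exps_def)
next
  case (Suc k) then show ?case using bounded_mult[OF assms Suc] by simp
qed

lemma bounded_add:
  assumes "supp f \<subseteq> bounded_exps n a" "supp g \<subseteq> bounded_exps n a"
  shows "supp (f + g) \<subseteq> bounded_exps n a"
  using assms keys_add[of f g] by blast

text \<open>Such an element is determined by the coefficients modulo \<open>p\<close> of its numerator.\<close>

lemma growth_card:
  assumes s: "s \<in> denoms"
  shows "finite (growth s D k)" "card (growth s D k) \<le> p ^ ((k * D + 1) ^ (2 * n - 1))"
proof -
  note d = denomsD[OF s]
  let ?B = "bounded_exps n (k * D)"
  note B = bounded_exps_finite_card[OF n_pos, of "k * D"]
  let ?P = "?B \<rightarrow>\<^sub>E {0..<int p}"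
  let ?e = "\<lambda>c. ev (\<Sum>v\<in>?B. frag_cmul (c v) (frag_of v))"
  have fin: "finite ?P" using B(1) by (intro finite_PiE) auto
  have img: "(\<lambda>r. ev s [^] k \<otimes> r) ` growth s D k \<subseteq> ?e ` ?P"
  proof (rule image_subsetI)
    fix r assume "r \<in> growth s D k"
    then obtain g where g: "supp g \<subseteq> ?B" "ev s [^] k \<otimes> r = ev g" by (auto simp: growth_def)
    define c where "c = (\<lambda>v\<in>?B. coef g v mod int p)"
    have c: "c \<in> ?P" using p_pos by (auto simp: c_def)
    let ?h = "\<Sum>v\<in>?B. frag_cmul (c v) (frag_of v)"
    have coef: "coef ?h u = (if u \<in> ?B then c u else 0)" for u
    proof -
      have "coef ?h u = (\<Sum>v\<in>?B. if v = u then c v else 0)"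
        unfolding lookup_sum by (rule sum.cong) (auto simp: lookup_single when_def)
      then show ?thesis using B(1) by (simp add: sum.delta)
    qed
    have "vanishes_mod p (g - ?h)"
      unfolding vanishes_mod_def lookup_minus coef
    proof
      fix u
      show "int p dvd coef g u - (if u \<in> ?B then c u else 0)"
      proof (cases "u \<in> ?B")
        case True
        then show ?thesis by (simp add: c_def mod_eq_dvd_iff[symmetric])
      next
        case False
        then have "u \<notin> supp g" using g(1) by auto
        then show ?thesis using False by (simp add: in_keys_iff)
      qed
    qed
    moreover have "supp ?h \<subseteq> ?B" by (auto simp: in_keys_iff coef split: if_splits)
    then have "?h \<in> polys" by (rule bounded_exps_toric)
    ultimately have "ev g = ev ?h" using  bounded_exps_toric[OF g(1)] by (simp add: ev_eq_iff)
    then show "ev s [^] k \<otimes> r \<in> ?e ` ?P" using g(2) c by auto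
  qed
  have inj: "inj_on (\<lambda>r. ev s [^] k \<otimes> r) (growth s D k)"
  proof (rule inj_onI)
    fix x y assume "x \<in> growth s D k" "y \<in> growth s D k" and eq: "ev s [^] k \<otimes> x = ev s [^] k \<otimes> y"
    then have "x \<in> carrier R" "y \<in> carrier R" by (auto simp: growth_def)
    then show "x = y" using Units_cancel[OF Units_pow_closed[OF d(2)] _ _ eq] by simp
  qed
  have finI: "finite (?e ` ?P)" using fin by simp
  show "finite (growth s D k)" by (rule inj_on_finite[OF inj img finI])
  have "card (growth s D k) \<le> card (?e ` ?P)" by (rule card_inj_on_le[OF inj img finI])
  also have "\<dots> \<le> card ?P" by (rule card_image_le[OF fin])
  also have "\<dots> = p ^ card ?B" using B(1) by (simp add: card_PiE)
  also have "\<dots> \<le> p ^ ((k * D + 1) ^ (2 * n - 1))" using B(2) p_pos by (intro power_increasing) auto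
  finally show "card (growth s D k) \<le> p ^ ((k * D + 1) ^ (2 * n - 1))" .
qed

lemma growth_step:
  assumes s: "s \<in> denoms" "supp s \<subseteq> bounded_exps n D"
    and b: "b \<in> carrier R" "ev s \<otimes> b = ev g" "supp g \<subseteq> bounded_exps n D"
    and f: "f \<in> growth s D k" and h: "h \<in> growth s D (k + m)"
  shows "f \<oplus> b \<otimes> h \<in> growth s D (k + Suc m)"
proof -
  note d = denomsD[OF s(1)]
  obtain u where u: "f \<in> carrier R" "supp u \<subseteq> bounded_exps n (k * D)" "ev s [^] k \<otimes> f = ev u"
    using f by (auto simp: growth_def)
  obtain w where w: "h \<in> carrier R" "supp w \<subseteq> bounded_exps n ((k + m) * D)" "ev s [^] (k + m) \<otimes> h = ev w"
    using h by (auto simp: growth_def)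
  have Z: "u \<in> polys" "w \<in> polys" "g \<in> polys"
    using u w b bounded_exps_toric by blast+
  have "ev s [^] (k + Suc m) \<otimes> (f \<oplus> b \<otimes> h) =
     ev s [^] (k + Suc m) \<otimes> f \<oplus> ev s [^] (k + Suc m) \<otimes> (b \<otimes> h)"
    using d u(1) w(1) b(1) by (simp add: r_distr)
  also have "ev s [^] (k + Suc m) \<otimes> f = ev s [^] Suc m \<otimes> (ev s [^] k \<otimes> f)"
    using d u(1) by (simp add: nat_pow_mult[symmetric] m_ac del: nat_pow_Suc)
  also have "\<dots> = ev (s ^ Suc m * u)"
    unfolding u(3) using d Z by (simp only: ev_power[symmetric] ev_mult power_toric_polys)
  also have "ev s [^] (k + Suc m) \<otimes> (b \<otimes> h) = (ev s \<otimes> b) \<otimes> (ev s [^] (k + m) \<otimes> h)"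
    using d w(1) b(1) by (simp add: m_ac)
  also have "\<dots> = ev (g * w)" unfolding b(2) w(3) using Z by (simp add: ev_mult)
  also have "ev (s ^ Suc m * u) \<oplus> ev (g * w) = ev (s ^ Suc m * u + g * w)"
    using d Z by (intro ev_add[symmetric] mult_toric_polys power_toric_polys)
  finally have e: "ev s [^] (k + Suc m) \<otimes> (f \<oplus> b \<otimes> h) = ev (s ^ Suc m * u + g * w)" .
  have "supp (s ^ Suc m * u) \<subseteq> bounded_exps n ((k + Suc m) * D)"
    using bounded_mult[OF bounded_power[OF s(2), of "Suc m"] u(2)] by (simp add: algebra_simps)
  moreover have "supp (g * w) \<subseteq> bounded_exps n ((k + Suc m) * D)"
    using bounded_mult[OF b(3) w(2)] by (simp add: algebra_simps)
  ultimately show ?thesis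
    unfolding growth_def using e bounded_add u(1) w(1) b(1) by blast
qed

text \<open>For the additive group \<open>E\<close> this says that distinct elements of \<open>E\<close> remain distinct modulo
  \<open>P\<close>.\<close>

definition independent_mod :: "'a set \<Rightarrow> 'a set \<Rightarrow> bool"
  where "independent_mod P E \<longleftrightarrow> E \<subseteq> carrier R \<and> (\<forall>x\<in>E. \<forall>y\<in>E. x \<ominus> y \<in> E) \<and>
    (\<forall>x\<in>E. x \<in> P \<longrightarrow> x = \<zero>)"

text \<open>One step of Horner's scheme in a new variable \<open>b\<close>. If \<open>f + b h\<close> lies in \<open>P\<close>, then \<open>f\<close> lies
  in \<open>Q\<close> and so is zero; then \<open>b h\<close> lies in the prime \<open>P\<close>, which does not contain \<open>b\<close>, so \<open>h\<close> is
  zero as well.\<close>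

lemma independent_step:
  assumes P: "primeideal P R" and Q: "primeideal Q R" and PQ: "P \<subseteq> Q" and b: "b \<in> Q" "b \<notin> P"
    and E: "independent_mod Q E" and H: "independent_mod P H"
  shows "independent_mod P ((\<lambda>(f, h). f \<oplus> b \<otimes> h) ` (E \<times> H))"
    and "inj_on (\<lambda>(f, h). f \<oplus> b \<otimes> h) (E \<times> H)"
proof -
  interpret P: primeideal P R by (rule P)
  interpret Q: primeideal Q R by (rule Q)
  have bR: "b \<in> carrier R" using b(1) Q.a_subset by auto
  have ER: "x \<in> carrier R" if "x \<in> E" for x using E that by (auto simp: independent_mod_def)
  have HR: "x \<in> carrier R" if "x \<in> H" for x using H that by (auto simp: independent_mod_def)
  have diff: "(f \<oplus> b \<otimes> h) \<ominus> (f' \<oplus> b \<otimes> h') = (f \<ominus> f') \<oplus> b \<otimes> (h \<ominus> h')"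
    if "f \<in> carrier R" "h \<in> carrier R" "f' \<in> carrier R" "h' \<in> carrier R" for f h f' h'
    using that bR by (simp add: a_minus_def r_distr minus_add r_minus a_ac)
  have key: "f = \<zero> \<and> h = \<zero>" if f: "f \<in> E" and h: "h \<in> H" and fh: "f \<oplus> b \<otimes> h \<in> P" for f h
  proof -
    have bh: "b \<otimes> h \<in> Q" using Q.I_r_closed[OF b(1) HR[OF h]] .
    have "f = (f \<oplus> b \<otimes> h) \<ominus> b \<otimes> h" using ER[OF f] HR[OF h] bR by (simp add: a_minus_def a_assoc r_neg)
    also have "\<dots> \<in> Q"
      unfolding a_minus_def by (rule Q.a_closed[OF subsetD[OF PQ fh] Q.a_inv_closed[OF bh]])
    finally have f0: "f = \<zero>" using E f by (auto simp: independent_mod_def)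
    then have "b \<otimes> h \<in> P" using fh HR[OF h] bR by simp
    then have "h \<in> P" using P.I_prime[OF bR HR[OF h]] b(2) by blast
    then show ?thesis using f0 H h by (auto simp: independent_mod_def)
  qed
  show "independent_mod P ((\<lambda>(f, h). f \<oplus> b \<otimes> h) ` (E \<times> H))"
    unfolding independent_mod_def
  proof (intro conjI ballI impI)
    show "(\<lambda>(f, h). f \<oplus> b \<otimes> h) ` (E \<times> H) \<subseteq> carrier R" using ER HR bR by auto
  next
    fix x y assume "x \<in> (\<lambda>(f, h). f \<oplus> b \<otimes> h) ` (E \<times> H)" "y \<in> (\<lambda>(f, h). f \<oplus> b \<otimes> h) ` (E \<times> H)"
    then obtain f h f' h' where xy: "f \<in> E" "h \<in> H" "x = f \<oplus> b \<otimes> h" "f' \<in> E" "h' \<in> H" "y = f' \<oplus> b \<otimes> h'"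
      by auto
    have "f \<ominus> f' \<in> E" "h \<ominus> h' \<in> H" using E H xy by (auto simp: independent_mod_def)
    moreover have "x \<ominus> y = (f \<ominus> f') \<oplus> b \<otimes> (h \<ominus> h')"
      unfolding xy using xy ER HR by (intro diff)
    ultimately show "x \<ominus> y \<in> (\<lambda>(f, h). f \<oplus> b \<otimes> h) ` (E \<times> H)" by auto
  next
    fix x assume "x \<in> (\<lambda>(f, h). f \<oplus> b \<otimes> h) ` (E \<times> H)" and xP: "x \<in> P"
    then obtain f h where fh: "f \<in> E" "h \<in> H" "x = f \<oplus> b \<otimes> h" by auto
    have "f = \<zero> \<and> h = \<zero>" using key[OF fh(1,2)] fh(3) xP by blast
    then show "x = \<zero>" using fh(3) bR by simp
  qed
  show "inj_on (\<lambda>(f, h). f \<oplus> b \<otimes> h) (E \<times> H)"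
  proof (rule inj_onI, clarify)
    fix f h f' h' assume xy: "f \<in> E" "h \<in> H" "f' \<in> E" "h' \<in> H" and eq: "f \<oplus> b \<otimes> h = f' \<oplus> b \<otimes> h'"
    have m: "f \<ominus> f' \<in> E" "h \<ominus> h' \<in> H" using E H xy by (auto simp: independent_mod_def)
    note c = ER[OF xy(1)] HR[OF xy(2)] ER[OF xy(3)] HR[OF xy(4)]
    have "(f \<ominus> f') \<oplus> b \<otimes> (h \<ominus> h') = (f \<oplus> b \<otimes> h) \<ominus> (f' \<oplus> b \<otimes> h')" using diff[OF c] by simp
    also have "\<dots> = \<zero>" unfolding eq using c bR by simp
    finally have "(f \<ominus> f') \<oplus> b \<otimes> (h \<ominus> h') \<in> P" by (simp add: P.zero_closed)
    then have "f \<ominus> f' = \<zero>" "h \<ominus> h' = \<zero>" using key[OF m] by auto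
    then show "f = f' \<and> h = h'" using c by simp
  qed
qed

text \<open>The prime field, which meets a proper ideal only in zero.\<close>

lemma constants_independent:
  assumes P: "primeideal P R"
  shows "\<exists>E. independent_mod P E \<and> E \<subseteq> growth s D 0 \<and> card E = p"
proof -
  interpret P: primeideal P R by (rule P)
  let ?E = "(\<lambda>c. ev (of_int c)) ` {0..<int p}"
  have modp: "ev (of_int c) = ev (of_int (c mod int p))" for c
    by (auto simp: ev_eq_iff of_int_toric_polys vanishes_mod_def lookup_minus lookup_of_int when_def mod_eq_dvd_iff[symmetric])
  have eq: "c mod int p = c' mod int p" if "ev (of_int c) = ev (of_int c')" for c c'
  proof -
    have "int p dvd coef (of_int c - of_int c' :: expo \<Rightarrow>\<^sub>0 int) 0"
      using that by (simp add: ev_eq_iff of_int_toric_polys vanishes_mod_def)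
    then show ?thesis by (simp add: lookup_minus lookup_of_int mod_eq_dvd_iff)
  qed
  have "independent_mod P ?E"
    unfolding independent_mod_def
  proof (intro conjI ballI impI)
    show "?E \<subseteq> carrier R" by (auto simp: of_int_toric_polys)
  next
    fix x y assume "x \<in> ?E" "y \<in> ?E"
    then obtain c c' where "x = ev (of_int c)" "y = ev (of_int c')" by auto
    then have "x \<ominus> y = ev (of_int c - of_int c')" by (simp add: ev_minus of_int_toric_polys)
    then have "x \<ominus> y = ev (of_int ((c - c') mod int p))" using modp[of "c - c'"] by simp
    then show "x \<ominus> y \<in> ?E" using p_pos by auto
  next
    fix x assume "x \<in> ?E" and xP: "x \<in> P"
    then obtain c where c: "x = ev (of_int c)" by auto
    show "x = \<zero>"
    proof (cases "int p dvd c")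
      case True
      then show ?thesis using modp[of c] c by (simp add: ev_zero dvd_eq_mod_eq_0)
    next
      case False
      then have "x \<in> Units R" using c by (simp add: ev_Units of_int_toric_polys lookup_of_int)
      then have "\<one> \<in> P" using xP P.I_r_closed[OF xP, of "inv x"] by simp
      then have "P = carrier R" by (rule P.one_imp_carrier)
      then show ?thesis using P.I_notcarr by simp
    qed
  qed
  moreover have "?E \<subseteq> growth s D 0"
  proof (rule image_subsetI)
    fix c
    have "supp (of_int c :: expo \<Rightarrow>\<^sub>0 int) \<subseteq> bounded_exps n (0 * D)"
      by (auto simp: in_keys_iff lookup_of_int bounded_exps_def split: if_splits)
    then show "ev (of_int c) \<in> growth s D 0"
      unfolding growth_def by (auto simp: of_int_toric_polys intro!: exI[of _ "of_int c"])
  qed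
  moreover have "card ?E = p"
  proof -
    have "inj_on (\<lambda>c. ev (of_int c)) {0..<int p}"
    proof (rule inj_onI)
      fix c c' assume "c \<in> {0..<int p}" "c' \<in> {0..<int p}" "ev (of_int c) = ev (of_int c')"
      then show "c = c'" using eq[of c c'] by simp
    qed
    then show ?thesis by (simp add: card_image)
  qed
  ultimately show ?thesis by blast
qed

text \<open>Polynomials of degree at most \<open>N\<close> in each of \<open>b (l - j), \<dots>, b (l - 1)\<close>, with coefficients in
  the prime field: they are independent modulo \<open>P (l - j)\<close> because each \<open>b i\<close> lies in \<open>P (Suc i)\<close>
  but not in \<open>P i\<close>. In other words, elements chosen along a chain of primes are algebraically
  independent.\<close>

lemma chain_independent:
  assumes P: "\<And>i. i \<le> l \<Longrightarrow> primeideal (P i) R" and PP: "\<And>i. i < l \<Longrightarrow> P i \<subset> P (Suc i)"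
    and b: "\<And>i. i < l \<Longrightarrow> b i \<in> P (Suc i) - P i"
    and s: "s \<in> denoms" "supp s \<subseteq> bounded_exps n D"
    and g: "\<And>i. i < l \<Longrightarrow> ev s \<otimes> b i = ev (g i) \<and> supp (g i) \<subseteq> bounded_exps n D"
    and j: "j \<le> l"
  shows "\<exists>E. independent_mod (P (l - j)) E \<and> E \<subseteq> growth s D (j * N) \<and> card E = p ^ ((N + 1) ^ j)"
  using j
proof (induction j)
  case 0
  then show ?case using constants_independent[OF P[of l], of s D] by simp
next
  case (Suc j)
  then obtain E where E: "independent_mod (P (l - j)) E" "E \<subseteq> growth s D (j * N)" "card E = p ^ ((N + 1) ^ j)"
    by auto
  define i where "i = l - Suc j"
  have i: "i < l" "l - j = Suc i" using Suc.prems by (auto simp: i_def)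
  have bi: "b i \<in> carrier R"
    using b[OF i(1)] primeideal_subset[OF P[of "Suc i"]] i(1) by auto
  have "\<exists>H. independent_mod (P i) H \<and> H \<subseteq> growth s D (j * N + m) \<and> card H = card E ^ (m + 1)" for m
  proof (induction m)
    case 0
    have "independent_mod (P i) E" using E(1) PP[OF i(1)] i by (auto simp: independent_mod_def)
    then show ?case using E(2) by (intro exI[of _ E]) auto
  next
    case (Suc m)
    then obtain H where H: "independent_mod (P i) H" "H \<subseteq> growth s D (j * N + m)" "card H = card E ^ (m + 1)"
      by blast
    let ?H = "(\<lambda>(f, h). f \<oplus> b i \<otimes> h) ` (E \<times> H)"
    have prime: "primeideal (P i) R" "primeideal (P (Suc i)) R" and sub: "P i \<subseteq> P (Suc i)"
      and bb: "b i \<in> P (Suc i)" "b i \<notin> P i"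
      using P[of i] P[of "Suc i"] PP[OF i(1)] b[OF i(1)] i by auto
    note st = independent_step[OF prime sub bb E(1)[unfolded i(2)] H(1)]
    have "f \<oplus> b i \<otimes> h \<in> growth s D (j * N + Suc m)" if "f \<in> E" "h \<in> H" for f h
      using growth_step[OF s bi conjunct1[OF g[OF i(1)]] conjunct2[OF g[OF i(1)]], of f "j * N" h m]
        E(2) H(2) that by blast
    then have "?H \<subseteq> growth s D (j * N + Suc m)" by auto
    moreover have "card ?H = card E ^ (Suc m + 1)"
      using card_image[OF st(2)] H(3) by (simp add: card_cartesian_product)
    ultimately show ?case using st(1) by blast
  qed
  from this[of N] obtain H where "independent_mod (P i) H" "H \<subseteq> growth s D (j * N + N)" "card H = card E ^ (N + 1)"
    by blast
  moreover have "card E ^ (N + 1) = p ^ ((N + 1) ^ Suc j)"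
    unfolding E(3) power_Suc2 power_mult ..
  moreover have "j * N + N = Suc j * N" by simp
  ultimately show ?case unfolding i_def by metis
qed

text \<open>The independent elements number \<open>p\<close> to the power \<open>(N + 1) ^ l\<close>, but at most \<open>p\<close> to the power
  \<open>(l * N * D + 1) ^ (2 * n - 1)\<close> elements have that growth. For large \<open>N\<close> this forces
  \<open>l \<le> 2 * n - 1\<close>.\<close>

lemma chain_length_le:
  assumes P: "\<And>i. i \<le> l \<Longrightarrow> primeideal (P i) R" and PP: "\<And>i. i < l \<Longrightarrow> P i \<subset> P (Suc i)"
  shows "l \<le> 2 * n - 1"
proof (rule ccontr)
  let ?d = "2 * n - 1"
  assume "\<not> l \<le> ?d"
  then have l: "Suc ?d \<le> l" by simp
  have "\<forall>i\<in>{..<l}. \<exists>x. x \<in> P (Suc i) - P i" using PP by blast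
  then obtain b where b: "\<forall>i\<in>{..<l}. b i \<in> P (Suc i) - P i" by metis
  have bR: "b i \<in> carrier R" if "i < l" for i
    using b that primeideal_subset[OF P[of "Suc i"]] by auto
  obtain s g where s: "s \<in> denoms" and g: "\<forall>i\<in>{..<l}. g i \<in> polys \<and> ev s \<otimes> b i = ev (g i)"
    using common_denominator[of "{..<l}" b] bR by auto
  define V where "V = supp s \<union> (\<Union>i<l. supp (g i))"
  define C where "C = (\<lambda>(v, x). coef v x) ` (V \<times> ({1..n} \<times> {1..n}))"
  define D where "D = Max (insert 0 C)"
  have finC: "finite C" by (simp add: C_def V_def)
  have VT: "V \<subseteq> toric_exps n" using denomsD[OF s] g by (auto simp: V_def toric_polys_def)
  have "coef v (i, j) \<le> D" if "v \<in> V" for v i j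
  proof (cases "i \<in> {1..n} \<and> j \<in> {1..n}")
    case True
    then have "coef v (i, j) \<in> C" using that by (force simp: C_def)
    then show ?thesis using finC by (simp add: D_def)
  next
    case False
    then show ?thesis using toric_exps_outside[of v n i j] VT that by auto
  qed
  then have V: "V \<subseteq> bounded_exps n D" using VT by (auto simp: bounded_exps_def)
  have "N + 1 \<le> (l * D + 1) ^ ?d" for N
  proof -
    have "\<exists>E. independent_mod (P (l - l)) E \<and> E \<subseteq> growth s D (l * N) \<and> card E = p ^ ((N + 1) ^ l)"
    proof (rule chain_independent[where b = b and g = g and l = l and P = P])
      fix i assume "i < l"
      then show "b i \<in> P (Suc i) - P i" "ev s \<otimes> b i = ev (g i) \<and> supp (g i) \<subseteq> bounded_exps n D"
        using b g V by (auto simp: V_def)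
    next
      show "supp s \<subseteq> bounded_exps n D" using V by (auto simp: V_def)
    qed (use P PP s in simp_all)
    then obtain E where E: "E \<subseteq> growth s D (l * N)" "card E = p ^ ((N + 1) ^ l)" by blast
    have "p ^ ((N + 1) ^ l) \<le> p ^ ((l * N * D + 1) ^ ?d)"
      using card_mono[OF growth_card(1)[OF s] E(1)] growth_card(2)[OF s, of D "l * N"] E(2) by linarith
    then have le: "(N + 1) ^ l \<le> (l * N * D + 1) ^ ?d"
      using prime_gt_1_nat[OF prime_p] by (simp add: power_increasing_iff)
    have "(N + 1) ^ ?d * (N + 1) \<le> (N + 1) ^ l"
      using power_increasing[OF l, of "N + 1"] by (simp add: mult.commute)
    also have "\<dots> \<le> ((l * D + 1) * (N + 1)) ^ ?d"
      by (rule order_trans[OF le]) (intro power_mono, auto simp: algebra_simps)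
    also have "\<dots> = (N + 1) ^ ?d * (l * D + 1) ^ ?d" unfolding power_mult_distrib by (rule mult.commute)
    finally have "(N + 1) ^ ?d * (N + 1) \<le> (N + 1) ^ ?d * (l * D + 1) ^ ?d" .
    moreover have "0 < (N + 1) ^ ?d" by simp
    ultimately show ?thesis by (simp only: nat_mult_le_cancel1)
  qed
  from this[of "(l * D + 1) ^ ?d"] show False by simp
qed

section \<open>Dimension and F-signature\<close>

theorem krull_dim_eq: "krull_dim R = enat (2 * n - 1)"
  unfolding krull_dim_def
proof (rule antisym)
  show "(SUP l\<in>{l. \<exists>P :: nat \<Rightarrow> 'a set. (\<forall>i\<le>l. primeideal (P i) R) \<and> (\<forall>i<l. P i \<subset> P (Suc i))}. enat l)
      \<le> enat (2 * n - 1)"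
  proof (rule SUP_least)
    fix l assume "l \<in> {l. \<exists>P :: nat \<Rightarrow> 'a set. (\<forall>i\<le>l. primeideal (P i) R) \<and> (\<forall>i<l. P i \<subset> P (Suc i))}"
    then obtain P :: "nat \<Rightarrow> 'a set" where "\<forall>i\<le>l. primeideal (P i) R" "\<forall>i<l. P i \<subset> P (Suc i)" by auto
    then show "enat l \<le> enat (2 * n - 1)" using chain_length_le[of l P] by simp
  qed
  show "enat (2 * n - 1) \<le>
    (SUP l\<in>{l. \<exists>P :: nat \<Rightarrow> 'a set. (\<forall>i\<le>l. primeideal (P i) R) \<and> (\<forall>i<l. P i \<subset> P (Suc i))}. enat l)"
    by (rule SUP_upper) (use long_chain in simp)
qed

theorem F_signature_eq: "F_signature p R = (fact n)\<^sup>2 / fact (2 * n - 1)"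
  unfolding F_signature_def free_rank_push krull_dim_eq the_enat.simps
  by (rule limI[OF card_small_exps_limit[OF n_pos prime_ge_2_nat[OF prime_p]]])

end

section \<open>The hypersurface ring as a semigroup ring\<close>

text \<open>The ring axioms are inherited by a structure onto which a commutative ring maps
  homomorphically. Applied to \<open>reduce\<close> below, this spares a direct proof that convolution modulo
  \<open>p\<close> is associative.\<close>

lemma cring_image:
  fixes h :: "'b::comm_ring_1 \<Rightarrow> 'a" and R (structure)
  assumes surj: "range h = carrier R"
    and add: "\<And>x y. h (x + y) = h x \<oplus> h y" and mult: "\<And>x y. h (x * y) = h x \<otimes> h y"
    and one: "h 1 = \<one>" and zero: "h 0 = \<zero>"
  shows "cring R"
proof -
  have elem: "\<exists>x. a = h x" if "a \<in> carrier R" for a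
    using that surj by auto
  have closed: "h x \<in> carrier R" for x using surj by auto
  show ?thesis
  proof (rule cringI)
    show "abelian_group R"
    proof (rule abelian_groupI)
      fix x assume "x \<in> carrier R"
      then obtain a where "x = h a" using elem by blast
      then have "h (- a) \<oplus> x = \<zero>" by (simp add: add[symmetric] zero)
      then show "\<exists>y\<in>carrier R. y \<oplus> x = \<zero>" using closed by blast
    qed (auto dest!: elem simp: closed add[symmetric] zero[symmetric] ac_simps)
    show "comm_monoid R"
      by (rule comm_monoidI) (auto dest!: elem simp: closed mult[symmetric] one[symmetric] ac_simps)
  qed (auto dest!: elem simp: closed mult[symmetric] add[symmetric] algebra_simps)
qed

lemma finite_submultisets: "finite {a. a \<subseteq># m}"
proof (induction m)
  case (add x m)
  have sub: "{a. a \<subseteq># add_mset x m} \<subseteq> {a. a \<subseteq># m} \<union> add_mset x ` {a. a \<subseteq># m}"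
  proof
    fix a assume "a \<in> {a. a \<subseteq># add_mset x m}"
    then have a: "a \<subseteq># add_mset x m" by simp
    show "a \<in> {a. a \<subseteq># m} \<union> add_mset x ` {a. a \<subseteq># m}"
    proof (cases "x \<in># a")
      case True
      then obtain b where "a = add_mset x b" by (metis insert_DiffM)
      then show ?thesis using a by auto
    next
      case False
      then have "a \<subseteq># m" using a
        by (metis add_mset_remove_trivial diff_single_trivial insert_subset_eq_iff subset_eq_diff_conv subset_mset.diff_add
            diff_subset_eq_self mset_subset_eq_multiset_union_diff_commute add_mset_add_single)
      then show ?thesis by simp
    qed
  qed
  show ?case by (rule finite_subset[OF sub]) (use add.IH in simp)
qed simp

lemma lookup_times_submultisets:
  fixes f g :: "'c multiset \<Rightarrow>\<^sub>0 int"
  shows "coef (f * g) m = (\<Sum>a | a \<subseteq># m. coef f a * coef g (m - a))"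
proof -
  have "coef (f * g) m = (\<Sum>(a, b) | a \<in> supp f \<and> b \<in> supp g \<and> m = a + b. coef f a * coef g b)"
    by (rule lookup_times_unfold)
  also have "\<dots> = (\<Sum>a | a \<in> supp f \<and> a \<subseteq># m \<and> m - a \<in> supp g. coef f a * coef g (m - a))"
    by (rule sum.reindex_bij_witness[of _ "\<lambda>a. (a, m - a)" fst]) (auto simp: subset_mset.add_diff_inverse)
  also have "\<dots> = (\<Sum>a | a \<subseteq># m. coef f a * coef g (m - a))"
    by (rule sum.mono_neutral_left) (auto simp: finite_submultisets in_keys_iff)
  finally show ?thesis .
qed

lemma frag_of_sum: "finite A \<Longrightarrow> (\<Prod>i\<in>A. frag_of (f i)) = frag_of (\<Sum>i\<in>A. f i)"
  by (induction A rule: finite_induct) (simp_all add: frag_of_mult del: single_one, simp)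

lemma power_diff_dvd: "(x - y) dvd (x ^ k - y ^ k :: 'a::comm_ring_1)"
  by (simp add: power_diff_sumr2)

lemma repeat_frag_of: "frag_of (repeat_mset k m) = (frag_of m) ^ k"
  by (induction k) (simp_all add: frag_of_mult[symmetric])

type_synonym mon_poly = "(nat + nat) multiset \<Rightarrow>\<^sub>0 int"

locale hypersurface =
  fixes p n :: nat
  assumes prime_p: "prime p" and n_pos: "n \<ge> 1"
begin

sublocale K: residues_prime p "residue_ring (int p)"
  by (simp add: residues_prime_def prime_p)

abbreviation "K \<equiv> residue_ring (int p)"
abbreviation "polys \<equiv> toric_polys n"
abbreviation "denoms \<equiv> toric_denoms n p"
abbreviation "P \<equiv> B_poly n p"
abbreviation "B \<equiv> B_ring n p"

text \<open>Reduction of the coefficients modulo \<open>p\<close>. Variables that do not occur in \<open>B\<close> are sent to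
  zero, so that the map is a homomorphism from a full polynomial ring.\<close>

definition reduce :: "mon_poly \<Rightarrow> (nat + nat) multiset \<Rightarrow> int"
  where "reduce g = (\<lambda>m. if set_mset m \<subseteq> B_vars n then coef g m mod int p else 0)"

lemma p_gt_1: "int p > 1"
  using prime_gt_1_nat[OF prime_p] by simp

lemma P_simps:
  "carrier P = K.indexed_pset (B_vars n) (carrier K)"
  "f \<otimes>\<^bsub>P\<^esub> g = (\<lambda>m. \<Oplus>\<^bsub>K\<^esub>a\<in>{a. a \<subseteq># m}. f a \<otimes>\<^bsub>K\<^esub> g (m - a))"
  "\<one>\<^bsub>P\<^esub> = K.indexed_const \<one>\<^bsub>K\<^esub>"
  "\<zero>\<^bsub>P\<^esub> = K.indexed_const \<zero>\<^bsub>K\<^esub>"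
  "f \<oplus>\<^bsub>P\<^esub> g = (\<lambda>m. f m \<oplus>\<^bsub>K\<^esub> g m)"
  by (simp_all add: B_poly_def indexed_poly_ring_def K.indexed_padd_def)

lemma reduce_add: "reduce (f + g) = reduce f \<oplus>\<^bsub>P\<^esub> reduce g"
  by (auto simp: P_simps reduce_def K.res_add_eq lookup_add mod_simps fun_eq_iff)

lemma reduce_zero: "reduce 0 = \<zero>\<^bsub>P\<^esub>"
  by (auto simp: P_simps reduce_def K.indexed_const_def K.res_zero_eq fun_eq_iff)

lemma reduce_one: "reduce 1 = \<one>\<^bsub>P\<^esub>"
  using p_gt_1
  by (auto simp: P_simps reduce_def K.indexed_const_def K.res_zero_eq K.res_one_eq lookup_one when_def fun_eq_iff)

lemma reduce_mult: "reduce (f * g) = reduce f \<otimes>\<^bsub>P\<^esub> reduce g"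
proof
  fix m
  show "reduce (f * g) m = (reduce f \<otimes>\<^bsub>P\<^esub> reduce g) m"
  proof (cases "set_mset m \<subseteq> B_vars n")
    case True
    have sub: "set_mset a \<subseteq> B_vars n" "set_mset (m - a) \<subseteq> B_vars n" if "a \<subseteq># m" for a
      using that True by (auto dest: mset_subset_eqD in_diffD)
    have "(reduce f \<otimes>\<^bsub>P\<^esub> reduce g) m = (\<Oplus>\<^bsub>K\<^esub>a\<in>{a. a \<subseteq># m}. (coef f a * coef g (m - a)) mod int p)"
      unfolding P_simps
      by (rule K.finsum_cong')
        (use p_gt_1 in \<open>auto simp: reduce_def sub K.res_mult_eq mod_simps K.res_carrier_eq\<close>)
    also have "\<dots> = (\<Sum>a | a \<subseteq># m. coef f a * coef g (m - a)) mod int p"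
      by (rule K.sum_cong) (rule finite_submultisets)
    finally show ?thesis using True by (simp add: reduce_def lookup_times_submultisets)
  next
    case False
    have "(reduce f \<otimes>\<^bsub>P\<^esub> reduce g) m = (\<Oplus>\<^bsub>K\<^esub>a\<in>{a. a \<subseteq># m}. \<zero>\<^bsub>K\<^esub>)"
      unfolding P_simps
    proof (rule K.finsum_cong')
      fix a assume "a \<in> {a. a \<subseteq># m}"
      then have "m = a + (m - a)" by simp
      then have "set_mset m = set_mset a \<union> set_mset (m - a)" by (metis set_mset_union)
      then have "\<not> set_mset a \<subseteq> B_vars n \<or> \<not> set_mset (m - a) \<subseteq> B_vars n" using False by auto
      then show "reduce f a \<otimes>\<^bsub>K\<^esub> reduce g (m - a) = \<zero>\<^bsub>K\<^esub>"
        by (auto simp: reduce_def K.res_mult_eq K.res_zero_eq)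
    qed auto
    also have "\<dots> = \<zero>\<^bsub>K\<^esub>" by simp
    finally show ?thesis using False by (simp add: reduce_def K.res_zero_eq)
  qed
qed

lemma B_var_eq: "v \<in> B_vars n \<Longrightarrow> B_var p v = reduce (frag_of {#v#})"
  using p_gt_1
  by (auto simp: B_var_def K.indexed_var_def K.indexed_pmult_def K.indexed_const_def reduce_def
      K.res_zero_eq K.res_one_eq fun_eq_iff lookup_single when_def single_is_union diff_single_eq_union
      dest!: multi_member_split)

lemma reduce_const: "reduce (of_int c) = K.indexed_const (c mod int p)"
  by (auto simp: reduce_def K.indexed_const_def K.res_zero_eq lookup_of_int when_def fun_eq_iff)

lemma reduce_pmult:
  assumes "i \<in> B_vars n"
  shows "reduce (frag_of {#i#} * f) = K.indexed_pmult (reduce f) i"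
proof
  fix m
  show "reduce (frag_of {#i#} * f) m = K.indexed_pmult (reduce f) i m"
  proof (cases "i \<in># m")
    case True
    then obtain m' where m': "m = {#i#} + m'" using multi_member_split by force
    then show ?thesis using assms lookup_frag_of_times[of "{#i#}" f m']
      by (simp add: K.indexed_pmult_def reduce_def)
  next
    case False
    then have "m \<notin> supp (frag_of {#i#} * f)" unfolding keys_frag_of_times by auto
    then show ?thesis using False
      by (simp add: K.indexed_pmult_def reduce_def in_keys_iff K.res_zero_eq)
  qed
qed

text \<open>The polynomials over the residue ring are given inductively; sums and products with a
  variable lift to integer polynomials.\<close>

lemma range_reduce: "range reduce = carrier P"
proof (intro equalityI subsetI)
  fix x assume "x \<in> carrier P"
  then have "x \<in> K.indexed_pset (B_vars n) (carrier K)" by (simp add: P_simps)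
  then show "x \<in> range reduce"
  proof (induction rule: K.indexed_pset.induct)
    case (indexed_const k)
    then have "k mod int p = k" by (simp add: K.res_carrier_eq)
    then show ?case using reduce_const[of k] by (metis rangeI)
  next
    case (indexed_padd f g)
    then obtain a b where ab: "f = reduce a" "g = reduce b" by auto
    have "K.indexed_padd f g = reduce (a + b)"
      unfolding ab reduce_add P_simps K.indexed_padd_def ..
    then show ?case by simp
  next
    case (indexed_pmult f i)
    then obtain a where "f = reduce a" by auto
    then have "K.indexed_pmult f i = reduce (frag_of {#i#} * a)" using reduce_pmult indexed_pmult by simp
    then show ?case by simp
  qed
next
  fix x assume "x \<in> range reduce"
  then obtain g where g: "x = reduce g" by auto
  have const: "reduce (of_int c) \<in> carrier P" for c
    unfolding reduce_const P_simps
    by (rule K.indexed_pset.indexed_const) (use p_gt_1 in \<open>simp add: K.res_carrier_eq\<close>)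
  have zero: "reduce 0 \<in> carrier P" using const[of 0] by simp
  have mono: "reduce (frag_cmul c (frag_of m)) \<in> carrier P" for c m
  proof (induction m)
    case empty
    then show ?case using const[of c] by (simp add: frag_cmul_conv_mult)
  next
    case (add i m)
    show ?case
    proof (cases "i \<in> B_vars n")
      case True
      have "frag_cmul c (frag_of (add_mset i m)) = frag_of {#i#} * frag_cmul c (frag_of m)"
        by (simp add: frag_cmul_conv_mult mult.left_commute frag_of_mult)
      then have "reduce (frag_cmul c (frag_of (add_mset i m))) = K.indexed_pmult (reduce (frag_cmul c (frag_of m))) i"
        using reduce_pmult[OF True] by simp
      then show ?thesis using add True by (simp add: P_simps K.indexed_pset.indexed_pmult)
    next
      case False
      then have "reduce (frag_cmul c (frag_of (add_mset i m))) = reduce 0"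
        by (auto simp: reduce_def fun_eq_iff lookup_single when_def)
      then show ?thesis using zero by simp
    qed
  qed
  have "reduce (\<Sum>m\<in>A. frag_cmul (coef g m) (frag_of m)) \<in> carrier P" if "finite A" for A
    using that
  proof (induction A rule: finite_induct)
    case empty then show ?case using zero by simp
  next
    case (insert m A)
    then show ?case using mono[of "coef g m" m] K.indexed_pset.indexed_padd
      by (simp add: reduce_add P_simps K.indexed_padd_def)
  qed
  from this[of "supp g"] have "reduce (frag_extend frag_of g) \<in> carrier P"
    by (simp add: frag_extend_def)
  then show "x \<in> carrier P" using frag_expansion[of g] g by simp
qed

lemma cring_P: "cring P"
  using range_reduce reduce_add reduce_mult reduce_one reduce_zero by (rule cring_image)

sublocale P: cring P by (rule cring_P)

lemma reduce_closed [simp]: "reduce g \<in> carrier P"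
  using range_reduce by auto

lemma reduce_minus: "reduce (f - g) = reduce f \<ominus>\<^bsub>P\<^esub> reduce g"
proof -
  have "reduce (f - g) \<oplus>\<^bsub>P\<^esub> reduce g = reduce f" by (simp add: reduce_add[symmetric])
  then show ?thesis by (metis P.minus_eq P.add.inv_solve_right' reduce_closed)
qed

lemma reduce_prod: "finite A \<Longrightarrow> reduce (\<Prod>i\<in>A. f i) = (\<Otimes>\<^bsub>P\<^esub>i\<in>A. reduce (f i))"
  by (induction A rule: finite_induct) (simp_all add: reduce_one reduce_mult P.finprod_insert)

definition xmon :: "(nat + nat) multiset" where "xmon = (\<Sum>i\<in>{1..n}. {#Inl i#})"
definition ymon :: "(nat + nat) multiset" where "ymon = (\<Sum>i\<in>{1..n}. {#Inr i#})"

definition eqn :: mon_poly where "eqn = frag_of xmon - frag_of ymon"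

lemma B_ideal_eq: "B_ideal n p = {reduce (u * eqn) | u. True}"
proof -
  have v: "Inl i \<in> B_vars n \<and> Inr i \<in> B_vars n" if "i \<in> {1..n}" for i
    using that by (auto simp: B_vars_def)
  have "(\<Otimes>\<^bsub>P\<^esub>i\<in>{1..n}. B_var p (Inl i)) = (\<Otimes>\<^bsub>P\<^esub>i\<in>{1..n}. reduce (frag_of {#Inl i#}))"
    by (rule P.finprod_cong') (use v in \<open>auto simp: B_var_eq\<close>)
  moreover have "(\<Otimes>\<^bsub>P\<^esub>i\<in>{1..n}. B_var p (Inr i)) = (\<Otimes>\<^bsub>P\<^esub>i\<in>{1..n}. reduce (frag_of {#Inr i#}))"
    by (rule P.finprod_cong') (use v in \<open>auto simp: B_var_eq\<close>)
  ultimately have "B_ideal n p = Idl\<^bsub>P\<^esub> {reduce eqn}"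
    by (simp add: B_ideal_def reduce_prod[symmetric] frag_of_sum reduce_minus[symmetric] eqn_def xmon_def ymon_def)
  also have "\<dots> = PIdl\<^bsub>P\<^esub> (reduce eqn)" by (rule P.cgenideal_eq_genideal[symmetric]) simp
  also have "\<dots> = {reduce (u * eqn) | u. True}"
    unfolding cgenideal_def reduce_mult range_reduce[symmetric] by auto
  finally show ?thesis .
qed

lemma ideal_B_ideal: "ideal (B_ideal n p) P"
  unfolding B_ideal_def
proof (rule P.genideal_ideal)
  have "B_var p (Inl i) \<in> carrier P" "B_var p (Inr i) \<in> carrier P" if "i \<in> {1..n}" for i
  proof -
    have "Inl i \<in> B_vars n" "Inr i \<in> B_vars n" using that by (auto simp: B_vars_def)
    then show "B_var p (Inl i) \<in> carrier P" "B_var p (Inr i) \<in> carrier P" by (simp_all add: B_var_eq)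
  qed
  then show "{(\<Otimes>\<^bsub>P\<^esub>i\<in>{1..n}. B_var p (Inl i)) \<ominus>\<^bsub>P\<^esub> (\<Otimes>\<^bsub>P\<^esub>i\<in>{1..n}. B_var p (Inr i))} \<subseteq> carrier P"
    by (auto intro!: P.minus_closed P.finprod_closed)
qed

sublocale I: ideal "B_ideal n p" P by (rule ideal_B_ideal)

sublocale B: cring B
  unfolding B_ring_def by (rule I.quotient_is_cring[OF cring_P])

definition proj :: "mon_poly \<Rightarrow> ((nat + nat) multiset \<Rightarrow> int) set"
  where "proj g = B_ideal n p +>\<^bsub>P\<^esub> reduce g"

lemma proj_hom:
  "proj g \<in> carrier B" "proj (f + g) = proj f \<oplus>\<^bsub>B\<^esub> proj g"
  "proj (f * g) = proj f \<otimes>\<^bsub>B\<^esub> proj g" "proj 1 = \<one>\<^bsub>B\<^esub>"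
  using I.rcos_ring_hom unfolding proj_def B_ring_def reduce_add reduce_mult reduce_one
  by (simp_all add: ring_hom_closed ring_hom_add ring_hom_mult ring_hom_one)

lemma range_proj: "range proj = carrier B"
proof
  show "carrier B \<subseteq> range proj"
  proof
    fix x assume "x \<in> carrier B"
    then obtain a where "a \<in> carrier P" "x = B_ideal n p +>\<^bsub>P\<^esub> a"
      by (auto simp: B_ring_def FactRing_def A_RCOSETS_def')
    then obtain g where "a = reduce g" using range_reduce by blast
    then show "x \<in> range proj" using \<open>x = B_ideal n p +>\<^bsub>P\<^esub> a\<close> by (auto simp: proj_def)
  qed
qed (use proj_hom in auto)

lemma proj_eq_iff_ideal: "proj f = proj g \<longleftrightarrow> (\<exists>u. reduce (f - g) = reduce (u * eqn))"
  using P.quotient_eq_iff_same_a_r_cos[OF ideal_B_ideal, of "reduce f" "reduce g"]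
  by (auto simp: proj_def reduce_minus[symmetric] B_ideal_eq)

definition mon_exp :: "(nat + nat) multiset \<Rightarrow> expo"
  where "mon_exp m = outer_sum n (\<lambda>i. count m (Inl i)) (\<lambda>j. count m (Inr j))"

lemma mon_exp_add: "mon_exp (a + b) = mon_exp a + mon_exp b"
  by (rule expo_eqI) (auto simp: mon_exp_def lookup_outer_sum lookup_add)

text \<open>The substitution of the product of row \<open>i\<close> for \<open>x\<^sub>i\<close> and of the product of column \<open>j\<close> for
  \<open>y\<^sub>j\<close>.\<close>

definition toric_map :: "mon_poly \<Rightarrow> expo \<Rightarrow>\<^sub>0 int"
  where "toric_map = frag_extend (\<lambda>m. if set_mset m \<subseteq> B_vars n then frag_of (mon_exp m) else 0)"

lemma toric_map_diff: "toric_map (f - g) = toric_map f - toric_map g"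
  by (simp add: toric_map_def frag_extend_diff)

lemma toric_map_add: "toric_map (f + g) = toric_map f + toric_map g"
  by (simp add: toric_map_def frag_extend_add)

lemma toric_map_mult: "toric_map (f * g) = toric_map f * toric_map g"
  unfolding toric_map_def
  by (rule frag_extend_mult) (auto simp: frag_of_mult mon_exp_add simp del: single_one)

lemma toric_map_frag_of: "set_mset m \<subseteq> B_vars n \<Longrightarrow> toric_map (frag_of m) = frag_of (mon_exp m)"
  by (simp add: toric_map_def)

lemma mon_exp_empty: "mon_exp {#} = 0"
  by (rule expo_eqI) (simp add: mon_exp_def lookup_outer_sum)

lemma toric_map_one: "toric_map 1 = 1"
  using toric_map_frag_of[of "{#}"] by (simp add: mon_exp_empty)

lemma toric_map_toric_polys: "toric_map g \<in> polys"
proof -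
  have "supp (toric_map g) \<subseteq> toric_exps n"
    unfolding toric_map_def by (rule order_trans[OF keys_frag_extend]) (auto simp: mon_exp_def split: if_splits)
  then show ?thesis by (simp add: toric_polys_def)
qed

lemma toric_map_surj:
  assumes "g \<in> polys"
  shows "\<exists>h. toric_map h = g"
proof -
  have "supp g \<subseteq> toric_exps n" using assms by (simp add: toric_polys_def)
  then show ?thesis
  proof (induction g rule: frag_induction)
    case zero
    show ?case by (rule exI[of _ 0]) (simp add: toric_map_def)
  next
    case (one v)
    then obtain a b where v: "v = outer_sum n a b" by (auto simp: toric_exps_def)
    define m where "m = (\<Sum>i\<in>{1..n}. replicate_mset (a i) (Inl i)) + (\<Sum>i\<in>{1..n}. replicate_mset (b i) (Inr i :: nat + nat))"
    have c: "count m (Inl i) = a i" "count m (Inr i) = b i" if "i \<in> {1..n}" for i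
      using that by (auto simp: m_def count_sum)
    have "set_mset m \<subseteq> B_vars n" by (auto simp: m_def B_vars_def set_mset_sum split: if_splits)
    moreover have "mon_exp m = v"
      unfolding v mon_exp_def by (rule expo_eqI) (auto simp: lookup_outer_sum c)
    ultimately show ?case using toric_map_frag_of by metis
  next
    case (diff f g)
    then show ?case using toric_map_diff by metis
  qed
qed

lemma count_xymon:
  "count xmon (Inl i) = (if i \<in> {1..n} then 1 else 0)" "count xmon (Inr i) = 0"
  "count ymon (Inr i) = (if i \<in> {1..n} then 1 else 0)" "count ymon (Inl i) = 0"
proof -
  have "count xmon (Inl i) = (\<Sum>a\<in>{1..n}. if a = i then 1 else 0)"
    unfolding xmon_def count_sum by (rule sum.cong) auto
  then show "count xmon (Inl i) = (if i \<in> {1..n} then 1 else 0)" by simp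
  have "count ymon (Inr i) = (\<Sum>a\<in>{1..n}. if a = i then 1 else 0)"
    unfolding ymon_def count_sum by (rule sum.cong) auto
  then show "count ymon (Inr i) = (if i \<in> {1..n} then 1 else 0)" by simp
qed (simp_all add: xmon_def ymon_def count_sum)

lemma toric_map_eqn: "toric_map eqn = 0"
proof -
  have "mon_exp xmon = mon_exp ymon"
    unfolding mon_exp_def by (rule expo_eqI) (auto simp: lookup_outer_sum count_xymon)
  moreover have "set_mset xmon \<subseteq> B_vars n" "set_mset ymon \<subseteq> B_vars n"
    by (auto simp: xmon_def ymon_def set_mset_sum B_vars_def)
  ultimately show ?thesis by (simp add: eqn_def toric_map_diff toric_map_frag_of)
qed

lemma reduce_zero_toric_map:
  assumes "reduce d = reduce 0"
  shows "vanishes_mod p (toric_map d)"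
  unfolding vanishes_mod_def
proof
  fix u
  have d: "int p dvd coef d m" if "set_mset m \<subseteq> B_vars n" for m
    using fun_cong[OF assms, of m] that by (auto simp: reduce_def)
  show "int p dvd coef (toric_map d) u"
    unfolding toric_map_def lookup_frag_extend
    by (rule dvd_sum) (auto intro: d dvd_mult2)
qed

text \<open>Two monomials with the same image differ by trading the product of all \<open>x\<^sub>i\<close> for the product
  of all \<open>y\<^sub>j\<close>, some number \<open>c\<close> of times; and the difference of the \<open>c\<close>-th powers is a multiple of
  the equation.\<close>

lemma same_exp_eqn_dvd:
  assumes m: "set_mset m \<subseteq> B_vars n" and m': "set_mset m' \<subseteq> B_vars n" and eq: "mon_exp m = mon_exp m'"
  shows "eqn dvd frag_of m - frag_of m'"
proof -
  have main: "eqn dvd frag_of m - frag_of m'"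
    if v: "set_mset m \<subseteq> B_vars n" "set_mset m' \<subseteq> B_vars n" and e: "mon_exp m = mon_exp m'"
      and le: "count m (Inl 1) \<le> count m' (Inl 1)" for m m'
  proof -
    \<comment> \<open>By equality of the images, the \<open>x\<close>-exponents of \<open>m'\<close> all exceed those of \<open>m\<close> by the same \<open>c\<close>, and the \<open>y\<close>-exponents fall short by \<open>c\<close>; \<open>r\<close> is the common part.\<close>
    define c where "c = count m' (Inl 1) - count m (Inl 1)"
    have e2: "count m (Inl i) + count m (Inr j) = count m' (Inl i) + count m' (Inr j)"
      if "i \<in> {1..n}" "j \<in> {1..n}" for i j
      using arg_cong[OF e, of "\<lambda>v. coef v (i, j)"] that by (simp add: mon_exp_def lookup_outer_sum)
    have one: "1 \<in> {1..n}" using n_pos by simp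
    have R: "count m (Inr j) = count m' (Inr j) + c" if "j \<in> {1..n}" for j
      using e2[OF one that] le by (simp add: c_def)
    have L: "count m' (Inl i) = count m (Inl i) + c" if "i \<in> {1..n}" for i
      using e2[OF that one] R[OF one] by simp
    define r where "r = m - repeat_mset c ymon"
    have out: "count m (Inl i) = 0 \<and> count m (Inr i) = 0 \<and> count m' (Inl i) = 0 \<and> count m' (Inr i) = 0"
      if "i \<notin> {1..n}" for i
    proof -
      have "Inl i \<notin> B_vars n" "Inr i \<notin> B_vars n" using that by (auto simp: B_vars_def)
      then show ?thesis using v by (auto simp: count_eq_zero_iff)
    qed
    have mr: "m = r + repeat_mset c ymon"
    proof (rule multiset_eqI)
      fix x show "count m x = count (r + repeat_mset c ymon) x"
      proof (cases x)
        case (Inl i) then show ?thesis by (simp add: r_def count_xymon)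
      next
        case (Inr i) then show ?thesis using R[of i] by (simp add: r_def count_xymon)
      qed
    qed
    have mr': "m' = r + repeat_mset c xmon"
    proof (rule multiset_eqI)
      fix x show "count m' x = count (r + repeat_mset c xmon) x"
      proof (cases x)
        case (Inl i) then show ?thesis using L[of i] out[of i] by (simp add: r_def count_xymon)
      next
        case (Inr i) then show ?thesis using R[of i] out[of i] by (simp add: r_def count_xymon)
      qed
    qed
    have "frag_of m' - frag_of m = frag_of r * (frag_of xmon ^ c - frag_of ymon ^ c)"
      unfolding mr mr' frag_of_mult[symmetric] repeat_frag_of by (simp add: right_diff_distrib)
    then have "eqn dvd frag_of m' - frag_of m" by (simp add: eqn_def power_diff_dvd dvd_mult)
    then show ?thesis by (metis dvd_minus_iff minus_diff_eq)
  qed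
  show ?thesis
  proof (cases "count m (Inl 1) \<le> count m' (Inl 1)")
    case True then show ?thesis using main[OF m m' eq] by blast
  next
    case False
    then have "eqn dvd frag_of m' - frag_of m" using main[OF m' m eq[symmetric]] by simp
    then show ?thesis by (metis dvd_minus_iff minus_diff_eq)
  qed
qed

text \<open>Any section of \<open>mon_exp\<close> serves to rewrite a polynomial in terms of its image.\<close>

definition rep_mon :: "expo \<Rightarrow> (nat + nat) multiset"
  where "rep_mon v = (SOME m. set_mset m \<subseteq> B_vars n \<and> mon_exp m = v)"

lemma rep_mon:
  assumes "set_mset m \<subseteq> B_vars n"
  shows "set_mset (rep_mon (mon_exp m)) \<subseteq> B_vars n" "mon_exp (rep_mon (mon_exp m)) = mon_exp m"
  unfolding rep_mon_def
  using someI[of "\<lambda>m'. set_mset m' \<subseteq> B_vars n \<and> mon_exp m' = mon_exp m" m] assms by auto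

text \<open>Modulo the equation, a polynomial can be recovered from its image under \<open>toric_map\<close>.\<close>

lemma toric_map_lift:
  "\<exists>u. reduce (g - frag_extend (\<lambda>v. frag_of (rep_mon v)) (toric_map g)) = reduce (u * eqn)"
  using subset_UNIV
proof (induction g rule: frag_induction)
  case zero
  show ?case by (rule exI[of _ 0]) (simp add: toric_map_def)
next
  case (one m)
  show ?case
  proof (cases "set_mset m \<subseteq> B_vars n")
    case True
    have "eqn dvd frag_of m - frag_of (rep_mon (mon_exp m))"
      using rep_mon[OF True] by (intro same_exp_eqn_dvd True) auto
    then obtain u where "frag_of m - frag_of (rep_mon (mon_exp m)) = eqn * u" by (auto elim: dvdE)
    then show ?thesis using toric_map_frag_of[OF True] by (metis mult.commute frag_extend_of)
  next
    case False
    then have "reduce (frag_of m) = reduce 0"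
      by (auto simp: reduce_def fun_eq_iff lookup_single when_def)
    moreover have "toric_map (frag_of m) = 0" using False by (simp add: toric_map_def)
    ultimately show ?thesis by (intro exI[of _ 0]) simp
  qed
next
  case (diff f g)
  let ?N = "\<lambda>g. frag_extend (\<lambda>v. frag_of (rep_mon v)) (toric_map g)"
  obtain u w where u: "reduce (f - ?N f) = reduce (u * eqn)" "reduce (g - ?N g) = reduce (w * eqn)"
    using diff by blast
  have "f - g - ?N (f - g) = (f - ?N f) - (g - ?N g)"
    by (simp add: toric_map_diff frag_extend_diff)
  then have "reduce (f - g - ?N (f - g)) = reduce (f - ?N f) \<ominus>\<^bsub>P\<^esub> reduce (g - ?N g)"
    by (simp only: reduce_minus[of "f - ?N f" "g - ?N g"])
  also have "\<dots> = reduce (u * eqn - w * eqn)" unfolding u by (rule reduce_minus[symmetric])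
  finally have "reduce (f - g - ?N (f - g)) = reduce ((u - w) * eqn)" by (simp add: left_diff_distrib)
  then show ?case by blast
qed

text \<open>The kernel of \<open>toric_map\<close> modulo \<open>p\<close> is generated by the equation: \<open>B\<close> is the semigroup ring
  of \<open>toric_exps\<close>.\<close>

theorem proj_eq_iff: "proj f = proj g \<longleftrightarrow> vanishes_mod p (toric_map f - toric_map g)"
proof
  assume "proj f = proj g"
  then obtain u where "reduce (f - g) = reduce (u * eqn)" using proj_eq_iff_ideal by blast
  then have "reduce (f - g - u * eqn) = reduce 0" by (simp add: reduce_minus reduce_zero P.r_right_minus_eq)
  then have "vanishes_mod p (toric_map (f - g - u * eqn))" by (rule reduce_zero_toric_map)
  then show "vanishes_mod p (toric_map f - toric_map g)"
    by (simp add: toric_map_diff toric_map_mult toric_map_eqn)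
next
  assume "vanishes_mod p (toric_map f - toric_map g)"
  then have "vanishes_mod p (toric_map (f - g))" by (simp add: toric_map_diff)
  then obtain h where h: "toric_map (f - g) = of_nat p * h" by (auto simp: vanishes_mod_iff_dvd elim: dvdE)
  let ?N = "frag_extend (\<lambda>v. frag_of (rep_mon v))"
  have "?N (toric_map (f - g)) = of_nat p * ?N h"
    unfolding h using frag_extend_cmul[of "\<lambda>v. frag_of (rep_mon v)" "int p" h]
    by (simp add: frag_cmul_conv_mult)
  then have "reduce (?N (toric_map (f - g))) = reduce 0"
    by (auto simp: reduce_def fun_eq_iff lookup_of_nat_mult)
  moreover obtain u where "reduce (f - g - ?N (toric_map (f - g))) = reduce (u * eqn)"
    using toric_map_lift by blast
  ultimately have "reduce (f - g) = reduce (u * eqn)"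
    by (simp add: reduce_minus[of "f - g"] reduce_zero P.minus_eq)
  then show "proj f = proj g" using proj_eq_iff_ideal by blast
qed

section \<open>The localization at the origin\<close>

text \<open>The inverse of the isomorphism: the element of \<open>B\<close> that corresponds to a polynomial
  supported in the semigroup.\<close>

definition cls :: "(expo \<Rightarrow>\<^sub>0 int) \<Rightarrow> ((nat + nat) multiset \<Rightarrow> int) set"
  where "cls g = proj (SOME h. toric_map h = g)"

lemma cls_toric_map: "cls (toric_map h) = proj h"
proof -
  have "toric_map (SOME h'. toric_map h' = toric_map h) = toric_map h"
    by (rule someI[of _ h]) simp
  then show ?thesis by (simp add: cls_def proj_eq_iff)
qed

lemma toric_polys_obtain:
  assumes "g \<in> polys"
  obtains h where "g = toric_map h"
  using toric_map_surj[OF assms] by blast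

lemma cls_closed: "g \<in> polys \<Longrightarrow> cls g \<in> carrier B"
  by (metis toric_polys_obtain cls_toric_map proj_hom(1))

lemma cls_add:
  "f \<in> polys \<Longrightarrow> g \<in> polys \<Longrightarrow> cls (f + g) = cls f \<oplus>\<^bsub>B\<^esub> cls g"
  by (metis toric_polys_obtain cls_toric_map proj_hom(2) toric_map_add)

lemma cls_mult:
  "f \<in> polys \<Longrightarrow> g \<in> polys \<Longrightarrow> cls (f * g) = cls f \<otimes>\<^bsub>B\<^esub> cls g"
  by (metis toric_polys_obtain cls_toric_map proj_hom(3) toric_map_mult)

lemma cls_one: "cls 1 = \<one>\<^bsub>B\<^esub>"
  by (metis cls_toric_map proj_hom(4) toric_map_one)

lemma cls_eq_iff:
  "f \<in> polys \<Longrightarrow> g \<in> polys \<Longrightarrow> cls f = cls g \<longleftrightarrow> vanishes_mod p (f - g)"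
  by (metis toric_polys_obtain cls_toric_map proj_eq_iff)

lemma cls_minus:
  assumes "f \<in> polys" "g \<in> polys"
  shows "cls (f - g) = cls f \<ominus>\<^bsub>B\<^esub> cls g"
proof -
  have "cls (f - g) \<oplus>\<^bsub>B\<^esub> cls g = cls f"
    using cls_add[of "f - g" g] assms by (simp add: diff_toric_polys)
  then show ?thesis using assms cls_closed
    by (metis B.minus_eq B.add.inv_solve_right' diff_toric_polys)
qed

lemma cls_zero: "cls 0 = \<zero>\<^bsub>B\<^esub>"
  using cls_minus[of 0 0] cls_closed[of 0] B.r_right_minus_eq[of "cls 0" "cls 0"] by simp

lemma cls_surj: "x \<in> carrier B \<Longrightarrow> \<exists>g\<in>polys. x = cls g"
  using range_proj cls_toric_map toric_map_toric_polys by (metis rangeE)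

definition origin :: "((nat + nat) multiset \<Rightarrow> int) set set"
  where "origin = {cls g | g. g \<in> polys \<and> int p dvd coef g 0}"

lemma cls_in_origin:
  assumes "g \<in> polys"
  shows "cls g \<in> origin \<longleftrightarrow> int p dvd coef g 0"
proof
  assume "cls g \<in> origin"
  then obtain h where h: "h \<in> polys" "int p dvd coef h 0" "cls g = cls h"
    by (auto simp: origin_def)
  then have "int p dvd coef g 0 - coef h 0"
    using cls_eq_iff[OF assms h(1)] by (simp add: vanishes_mod_def lookup_minus)
  then have "int p dvd (coef g 0 - coef h 0) + coef h 0" using h(2) by (rule dvd_add)
  then show "int p dvd coef g 0" by simp
qed (use assms in \<open>auto simp: origin_def\<close>)

lemma ideal_origin: "ideal origin B"
proof (rule idealI)
  show "ring B" by (rule B.ring_axioms)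
  have sub: "origin \<subseteq> carrier B" by (auto simp: origin_def cls_closed)
  show "subgroup origin (add_monoid B)"
  proof (rule B.add.subgroupI)
    show "origin \<subseteq> carrier B" by (rule sub)
    show "origin \<noteq> {}" using cls_in_origin[of 0] by auto
    fix a assume "a \<in> origin"
    then obtain g where g: "g \<in> polys" "int p dvd coef g 0" "a = cls g" by (auto simp: origin_def)
    have "\<ominus>\<^bsub>B\<^esub> a = cls (0 - g)"
      using cls_minus[of 0 g] g cls_closed by (simp add: cls_zero B.minus_eq)
    moreover have "cls (0 - g) \<in> origin"
      using g by (subst cls_in_origin) (auto intro!: diff_toric_polys simp: lookup_minus simp del: diff_0)
    ultimately show "\<ominus>\<^bsub>B\<^esub> a \<in> origin" by simp
    fix b assume "b \<in> origin"
    then obtain h where h: "h \<in> polys" "int p dvd coef h 0" "b = cls h" by (auto simp: origin_def)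
    have "cls (g + h) \<in> origin"
      using g h by (subst cls_in_origin) (auto simp: lookup_add)
    then show "a \<oplus>\<^bsub>B\<^esub> b \<in> origin" using g h by (simp add: cls_add)
  qed
  fix a x assume "a \<in> origin" and x: "x \<in> carrier B"
  then obtain g h where g: "g \<in> polys" "int p dvd coef g 0" "a = cls g"
    and h: "h \<in> polys" "x = cls h"
    using cls_surj[OF x] by (auto simp: origin_def)
  have "cls (g * h) \<in> origin"
    using g h by (subst cls_in_origin) (auto simp: lookup_times_zero)
  then show ax: "a \<otimes>\<^bsub>B\<^esub> x \<in> origin" using g h by (simp add: cls_mult)
  then show "x \<otimes>\<^bsub>B\<^esub> a \<in> origin" using g h cls_closed by (simp add: B.m_comm)
qed

text \<open>A monomial other than \<open>1\<close> contains a variable, so every polynomial is congruent to a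
  constant modulo the ideal of the variables; and a constant in \<open>origin\<close> is a multiple of \<open>p\<close>.\<close>

lemma B_max_eq: "B_max n p = origin"
proof
  let ?V = "(\<lambda>v. B_ideal n p +>\<^bsub>P\<^esub> B_var p v) ` B_vars n"
  have V: "B_ideal n p +>\<^bsub>P\<^esub> B_var p v = proj (frag_of {#v#})" if "v \<in> B_vars n" for v
    using B_var_eq[OF that] by (simp add: proj_def)
  have VB: "?V \<subseteq> carrier B" using V proj_hom(1) by auto
  have Vo: "?V \<subseteq> origin"
  proof (rule image_subsetI)
    fix v assume v: "v \<in> B_vars n"
    have "mon_exp {#v#} \<noteq> 0"
    proof
      assume 0: "mon_exp {#v#} = 0"
      obtain i where i: "i \<in> {1..n}" "v = Inl i \<or> v = Inr i" using v by (auto simp: B_vars_def)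
      have "coef (mon_exp {#v#}) (i, i) \<noteq> 0"
        using i by (auto simp: mon_exp_def lookup_outer_sum)
      then show False using 0 by simp
    qed
    then have "coef (toric_map (frag_of {#v#})) 0 = 0"
      using v by (subst toric_map_frag_of) (auto simp: lookup_single_not_eq)
    then have "cls (toric_map (frag_of {#v#})) \<in> origin"
      using cls_in_origin[OF toric_map_toric_polys] by simp
    then show "B_ideal n p +>\<^bsub>P\<^esub> B_var p v \<in> origin" using V[OF v] by (simp add: cls_toric_map)
  qed
  show sub: "B_max n p \<subseteq> origin"
    unfolding B_max_def by (rule B.genideal_minimal[OF ideal_origin Vo])
  have idl: "ideal (B_max n p) B" unfolding B_max_def by (rule B.genideal_ideal[OF VB])
  interpret m: ideal "B_max n p" B by (rule idl)
  have Vm: "proj (frag_of {#v#}) \<in> B_max n p" if "v \<in> B_vars n" for v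
    using subsetD[OF B.genideal_self[OF VB], of "proj (frag_of {#v#})"] V[OF that] that
    unfolding B_max_def by (metis imageI)
  have const: "\<exists>c. proj (h - of_int c) \<in> B_max n p" for h
    using subset_UNIV
  proof (induction h rule: frag_induction)
    case zero
    have "proj (0 - of_int 0) = \<zero>\<^bsub>B\<^esub>" using cls_toric_map[of 0] by (simp add: toric_map_def cls_zero)
    then show ?case by (metis m.zero_closed)
  next
    case (one m)
    show ?case
    proof (cases "\<exists>v. v \<in># m")
      case False
      then have "frag_of m - of_int 1 = 0" by (cases m) auto
      then have "proj (frag_of m - of_int 1) = \<zero>\<^bsub>B\<^esub>"
        using cls_toric_map[of 0] by (simp add: toric_map_def cls_zero)
      then show ?thesis by (metis m.zero_closed)
    next
      case True
      have "proj (frag_of m) \<in> B_max n p"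
      proof (cases "set_mset m \<subseteq> B_vars n")
        case True
        obtain v m' where m': "m = {#v#} + m'" using \<open>\<exists>v. v \<in># m\<close> multi_member_split by force
        then have "proj (frag_of m) = proj (frag_of {#v#}) \<otimes>\<^bsub>B\<^esub> proj (frag_of m')"
          by (simp only: proj_hom(3)[symmetric] frag_of_mult)
        then show ?thesis using Vm[of v] True m' m.I_r_closed[OF _ proj_hom(1)] by simp
      next
        case False
        then have "toric_map (frag_of m) = toric_map 0" by (simp add: toric_map_def)
        then have "proj (frag_of m) = \<zero>\<^bsub>B\<^esub>"
          using cls_toric_map[of "frag_of m"] cls_toric_map[of 0] by (simp add: toric_map_def cls_zero)
        then show ?thesis by (simp add: m.zero_closed)
      qed
      then show ?thesis by (intro exI[of _ 0]) simp
    qed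
  next
    case (diff f g)
    then obtain c d where cd: "proj (f - of_int c) \<in> B_max n p" "proj (g - of_int d) \<in> B_max n p" by blast
    have "proj (f - g - of_int (c - d)) \<oplus>\<^bsub>B\<^esub> proj (g - of_int d) = proj (f - of_int c)"
      by (simp add: proj_hom(2)[symmetric])
    then have "proj (f - g - of_int (c - d)) = proj (f - of_int c) \<ominus>\<^bsub>B\<^esub> proj (g - of_int d)"
      by (metis B.minus_eq B.add.inv_solve_right' proj_hom(1))
    then have "proj (f - g - of_int (c - d)) \<in> B_max n p"
      using cd by (simp only: a_minus_def m.a_closed m.a_inv_closed)
    then show ?case by blast
  qed
  show "origin \<subseteq> B_max n p"
  proof
    fix x assume "x \<in> origin"
    then obtain g where g: "g \<in> polys" "int p dvd coef g 0" "x = cls g" by (auto simp: origin_def)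
    then obtain h where h: "g = toric_map h" using toric_polys_obtain by blast
    obtain c where c: "proj (h - of_int c) \<in> B_max n p" using const by blast
    have tc: "toric_map (of_int c) = of_int c"
      using frag_extend_cmul[of "\<lambda>m. if set_mset m \<subseteq> B_vars n then frag_of (mon_exp m) else 0" c 1] toric_map_one
      by (simp add: toric_map_def frag_cmul_conv_mult)
    have "cls (toric_map (h - of_int c)) \<in> origin" using c sub by (auto simp: cls_toric_map)
    then have "int p dvd coef (toric_map (h - of_int c)) 0"
      using cls_in_origin[OF toric_map_toric_polys] by blast
    then have "int p dvd coef g 0 - c"
      by (simp add: toric_map_diff tc h lookup_minus lookup_of_int)
    from dvd_diff[OF g(2) this] have pc: "int p dvd c" by simp
    have "vanishes_mod p (toric_map h - toric_map (h - of_int c))"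
      using pc by (auto simp: toric_map_diff tc vanishes_mod_def lookup_of_int when_def)
    then have "proj h = proj (h - of_int c)" by (simp add: proj_eq_iff)
    then show "x \<in> B_max n p" using c g(3) h by (simp add: cls_toric_map)
  qed
qed

abbreviation "S \<equiv> carrier B - B_max n p"

lemma S_eq: "S = cls ` denoms"
proof
  show "S \<subseteq> cls ` denoms"
  proof
    fix x assume x: "x \<in> S"
    then obtain g where g: "g \<in> polys" "x = cls g" using cls_surj by blast
    then have "g \<in> denoms" using x cls_in_origin[OF g(1)] by (simp add: B_max_eq toric_denoms_def)
    then show "x \<in> cls ` denoms" using g by simp
  qed
  show "cls ` denoms \<subseteq> S"
    using cls_in_origin cls_closed by (auto simp: B_max_eq toric_denoms_def)
qed

definition frac :: "(expo \<Rightarrow>\<^sub>0 int) \<Rightarrow> (expo \<Rightarrow>\<^sub>0 int) \<Rightarrow>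
    (((nat + nat) multiset \<Rightarrow> int) set \<times> ((nat + nat) multiset \<Rightarrow> int) set) set"
  where "frac g s = fraction B S (cls g) (cls s)"

lemma denoms_toric: "s \<in> denoms \<Longrightarrow> s \<in> polys"
  by (simp add: toric_denoms_def)

text \<open>\<open>B\<close> has no zero divisors, so the factor \<open>u\<close> in the equality of fractions can be dropped.\<close>

lemma denom_cancel:
  assumes "s \<in> denoms" "vanishes_mod p (s * g)"
  shows "vanishes_mod p g"
  using vanishes_mod_prime[OF prime_p assms(2)] assms(1) by (auto simp: toric_denoms_def vanishes_mod_def)

lemma cls_in_frac:
  assumes g: "g \<in> polys" and s: "s \<in> denoms"
    and h: "h \<in> polys" and t: "t \<in> denoms"
  shows "(cls h, cls t) \<in> frac g s \<longleftrightarrow> vanishes_mod p (t * g - s * h)"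
proof -
  note T = denoms_toric[OF s] denoms_toric[OF t]
  have key: "cls u \<otimes>\<^bsub>B\<^esub> (cls t \<otimes>\<^bsub>B\<^esub> cls g) = cls u \<otimes>\<^bsub>B\<^esub> (cls s \<otimes>\<^bsub>B\<^esub> cls h) \<longleftrightarrow>
      vanishes_mod p (u * (t * g - s * h))" if u: "u \<in> denoms" for u
  proof -
    note U = denoms_toric[OF u]
    have "cls u \<otimes>\<^bsub>B\<^esub> (cls t \<otimes>\<^bsub>B\<^esub> cls g) = cls (u * (t * g))"
      "cls u \<otimes>\<^bsub>B\<^esub> (cls s \<otimes>\<^bsub>B\<^esub> cls h) = cls (u * (s * h))"
      using T U g h by (simp_all add: cls_mult mult_toric_polys)
    then show ?thesis using T U g h by (simp add: cls_eq_iff mult_toric_polys right_diff_distrib)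
  qed
  have tS: "cls t \<in> S" using t by (simp add: S_eq)
  have "(cls h, cls t) \<in> frac g s \<longleftrightarrow> (\<exists>u\<in>denoms. vanishes_mod p (u * (t * g - s * h)))"
    unfolding frac_def fraction_def using tS cls_closed[OF h] key by (auto simp: S_eq)
  also have "\<dots> \<longleftrightarrow> vanishes_mod p (t * g - s * h)"
    using denom_cancel vanishes_mod_mult(1) one_toric_denoms[OF prime_p] by blast
  finally show ?thesis .
qed

lemma frac_members:
  assumes "x \<in> frac g s"
  obtains h t where "h \<in> polys" "t \<in> denoms" "x = (cls h, cls t)"
proof -
  obtain b t where x: "x = (b, t)" "b \<in> carrier B" "t \<in> S"
    using assms unfolding frac_def fraction_def by auto
  obtain h where "h \<in> polys" "b = cls h" using cls_surj[OF x(2)] by blast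
  moreover obtain t' where "t' \<in> denoms" "t = cls t'" using x(3) unfolding S_eq by blast
  ultimately show thesis using that x(1) by blast
qed

lemma frac_eq_iff:
  assumes g: "g \<in> polys" and s: "s \<in> denoms"
    and h: "h \<in> polys" and t: "t \<in> denoms"
  shows "frac g s = frac h t \<longleftrightarrow> vanishes_mod p (t * g - s * h)"
proof
  assume "frac g s = frac h t"
  moreover have "(cls h, cls t) \<in> frac h t" using cls_in_frac[OF h t h t] by simp
  ultimately show "vanishes_mod p (t * g - s * h)" using cls_in_frac[OF g s h t] by simp
next
  have sub: "frac g s \<subseteq> frac h t"
    if g: "g \<in> polys" and s: "s \<in> denoms"
      and h: "h \<in> polys" and t: "t \<in> denoms" and v: "vanishes_mod p (t * g - s * h)"
    for g s h t
  proof
    fix x assume x: "x \<in> frac g s"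
    then obtain k w where k: "k \<in> polys" "w \<in> denoms" "x = (cls k, cls w)"
      using frac_members by blast
    have v2: "vanishes_mod p (w * g - s * k)" using x cls_in_frac[OF g s k(1,2)] k(3) by simp
    have "s * (w * h - t * k) = t * (w * g - s * k) - w * (t * g - s * h)"
      by (simp add: algebra_simps)
    then have "vanishes_mod p (s * (w * h - t * k))"
      using vanishes_mod_diff[OF vanishes_mod_mult(1)[OF v2] vanishes_mod_mult(1)[OF v]] by simp
    then have "vanishes_mod p (w * h - t * k)" by (rule denom_cancel[OF s])
    then show "x \<in> frac h t" using cls_in_frac[OF h t k(1,2)] k(3) by simp
  qed
  assume v: "vanishes_mod p (t * g - s * h)"
  have "vanishes_mod p (0 - (t * g - s * h))" by (rule vanishes_mod_diff[OF vanishes_mod_zero v])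
  then have "vanishes_mod p (s * h - t * g)" by simp
  then show "frac g s = frac h t" using sub[OF g s h t v] sub[OF h t g s] by blast
qed

abbreviation "L \<equiv> localization_at B (B_max n p)"

text \<open>To evaluate an operation of the localization, it suffices that its result does not depend on
  the representatives of the two fractions.\<close>

lemma frac_union:
  assumes g: "g \<in> polys" and s: "s \<in> denoms"
    and h: "h \<in> polys" and t: "t \<in> denoms"
    and c: "\<And>g' s' h' t'. g' \<in> polys \<Longrightarrow> s' \<in> denoms \<Longrightarrow> h' \<in> polys \<Longrightarrow> t' \<in> denoms \<Longrightarrow>
      vanishes_mod p (s' * g - s * g') \<Longrightarrow> vanishes_mod p (t' * h - t * h') \<Longrightarrow>
      \<Phi> (cls g') (cls s') (cls h') (cls t') = c0"
  shows "(\<Union>(a, x)\<in>frac g s. \<Union>(b, y)\<in>frac h t. \<Phi> a x b y) = c0"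
proof -
  have "\<Phi> a x b y = c0" if ax: "(a, x) \<in> frac g s" and bz: "(b, y) \<in> frac h t" for a x b y
  proof -
    obtain g' s' where g': "g' \<in> polys" "s' \<in> denoms" "a = cls g'" "x = cls s'"
      using frac_members[OF ax] by blast
    obtain h' t' where h': "h' \<in> polys" "t' \<in> denoms" "b = cls h'" "y = cls t'"
      using frac_members[OF bz] by blast
    show ?thesis
      using c[OF g'(1,2) h'(1,2)] cls_in_frac[OF g s g'(1,2)] cls_in_frac[OF h t h'(1,2)] ax bz g' h'
      by simp
  qed
  moreover have "(cls g, cls s) \<in> frac g s" "(cls h, cls t) \<in> frac h t"
    using cls_in_frac[OF g s g s] cls_in_frac[OF h t h t] by simp_all
  ultimately show ?thesis by blast
qed

lemma frac_mult:
  assumes g: "g \<in> polys" and s: "s \<in> denoms"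
    and h: "h \<in> polys" and t: "t \<in> denoms"
  shows "frac g s \<otimes>\<^bsub>L\<^esub> frac h t = frac (g * h) (s * t)"
proof -
  have "frac g s \<otimes>\<^bsub>L\<^esub> frac h t = (\<Union>(a, x)\<in>frac g s. \<Union>(b, y)\<in>frac h t. fraction B S (a \<otimes>\<^bsub>B\<^esub> b) (x \<otimes>\<^bsub>B\<^esub> y))"
    by (simp add: localization_at_def localization_def)
  also have "\<dots> = frac (g * h) (s * t)"
  proof (rule frac_union[OF g s h t])
    fix g' s' h' t' assume g': "g' \<in> polys" and s': "s' \<in> denoms"
      and h': "h' \<in> polys" and t': "t' \<in> denoms"
      and v: "vanishes_mod p (s' * g - s * g')" "vanishes_mod p (t' * h - t * h')"
    have "fraction B S (cls g' \<otimes>\<^bsub>B\<^esub> cls h') (cls s' \<otimes>\<^bsub>B\<^esub> cls t') = frac (g' * h') (s' * t')"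
      using g' h' denoms_toric s' t' by (simp add: frac_def cls_mult)
    also have "\<dots> = frac (g * h) (s * t)"
    proof (subst frac_eq_iff)
      have "s * t * (g' * h') - s' * t' * (g * h) =
         0 - ((s' * g - s * g') * (t' * h) + (s * g') * (t' * h - t * h'))" by (simp add: algebra_simps)
      also have "vanishes_mod p \<dots>"
        by (intro vanishes_mod_diff vanishes_mod_add vanishes_mod_zero
            vanishes_mod_mult(2)[OF v(1)] vanishes_mod_mult(1)[OF v(2)])
      finally show "vanishes_mod p (s * t * (g' * h') - s' * t' * (g * h))" .
    qed (use g s h t g' s' h' t' in \<open>auto intro: toric_denoms_mult[OF prime_p]\<close>)
    finally show "fraction B S (cls g' \<otimes>\<^bsub>B\<^esub> cls h') (cls s' \<otimes>\<^bsub>B\<^esub> cls t') = frac (g * h) (s * t)" .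
  qed
  finally show ?thesis .
qed

lemma frac_add:
  assumes g: "g \<in> polys" and s: "s \<in> denoms"
    and h: "h \<in> polys" and t: "t \<in> denoms"
  shows "frac g s \<oplus>\<^bsub>L\<^esub> frac h t = frac (t * g + s * h) (s * t)"
proof -
  have "frac g s \<oplus>\<^bsub>L\<^esub> frac h t = (\<Union>(a, x)\<in>frac g s. \<Union>(b, y)\<in>frac h t.
     fraction B S ((y \<otimes>\<^bsub>B\<^esub> a) \<oplus>\<^bsub>B\<^esub> (x \<otimes>\<^bsub>B\<^esub> b)) (x \<otimes>\<^bsub>B\<^esub> y))"
    by (simp add: localization_at_def localization_def)
  also have "\<dots> = frac (t * g + s * h) (s * t)"
  proof (rule frac_union[OF g s h t])
    fix g' s' h' t' assume g': "g' \<in> polys" and s': "s' \<in> denoms"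
      and h': "h' \<in> polys" and t': "t' \<in> denoms"
      and v: "vanishes_mod p (s' * g - s * g')" "vanishes_mod p (t' * h - t * h')"
    have "fraction B S ((cls t' \<otimes>\<^bsub>B\<^esub> cls g') \<oplus>\<^bsub>B\<^esub> (cls s' \<otimes>\<^bsub>B\<^esub> cls h')) (cls s' \<otimes>\<^bsub>B\<^esub> cls t') =
        frac (t' * g' + s' * h') (s' * t')"
      using g' h' denoms_toric s' t' by (simp add: frac_def cls_mult cls_add mult_toric_polys)
    also have "\<dots> = frac (t * g + s * h) (s * t)"
    proof (subst frac_eq_iff)
      have "s * t * (t' * g' + s' * h') - s' * t' * (t * g + s * h) =
         0 - ((s' * g - s * g') * (t * t') + (s * s') * (t' * h - t * h'))" by (simp add: algebra_simps)
      also have "vanishes_mod p \<dots>"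
        by (intro vanishes_mod_diff vanishes_mod_add vanishes_mod_zero
            vanishes_mod_mult(2)[OF v(1)] vanishes_mod_mult(1)[OF v(2)])
      finally show "vanishes_mod p (s * t * (t' * g' + s' * h') - s' * t' * (t * g + s * h))" .
    qed (use g s h t g' s' h' t' denoms_toric in \<open>auto intro: toric_denoms_mult[OF prime_p]\<close>)
    finally show "fraction B S ((cls t' \<otimes>\<^bsub>B\<^esub> cls g') \<oplus>\<^bsub>B\<^esub> (cls s' \<otimes>\<^bsub>B\<^esub> cls h')) (cls s' \<otimes>\<^bsub>B\<^esub> cls t') =
        frac (t * g + s * h) (s * t)" .
  qed
  finally show ?thesis .
qed

lemma L_simps:
  "carrier L = {frac g s | g s. g \<in> polys \<and> s \<in> denoms}"
  "\<one>\<^bsub>L\<^esub> = frac 1 1" "\<zero>\<^bsub>L\<^esub> = frac 0 1"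
proof -
  show "carrier L = {frac g s | g s. g \<in> polys \<and> s \<in> denoms}" (is "_ = ?C")
  proof (intro equalityI subsetI)
    fix x assume "x \<in> carrier L"
    then obtain a s where a: "a \<in> carrier B" "s \<in> S" "x = fraction B S a s"
      by (auto simp: localization_at_def localization_def)
    obtain g where "g \<in> polys" "a = cls g" using cls_surj[OF a(1)] by blast
    moreover obtain t where "t \<in> denoms" "s = cls t" using a(2) unfolding S_eq by blast
    ultimately show "x \<in> ?C" using a(3) unfolding frac_def by blast
  next
    fix x assume "x \<in> ?C"
    then obtain g s where g: "g \<in> polys" "s \<in> denoms" "x = frac g s" by blast
    have "cls g \<in> carrier B" "cls s \<in> S" using g cls_closed by (auto simp: S_eq)
    then show "x \<in> carrier L"
      using g(3) unfolding frac_def localization_at_def localization_def by auto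
  qed
qed (simp_all add: frac_def cls_one cls_zero localization_at_def localization_def)

lemma frac_closed: "g \<in> polys \<Longrightarrow> s \<in> denoms \<Longrightarrow> frac g s \<in> carrier L"
  unfolding L_simps by blast

lemma L_elem:
  assumes "x \<in> carrier L"
  obtains g s where "g \<in> polys" "s \<in> denoms" "x = frac g s"
  using assms unfolding L_simps by blast

lemma frac_eqI:
  assumes "g \<in> polys" "s \<in> denoms" "h \<in> polys" "t \<in> denoms"
    and "t * g = s * h"
  shows "frac g s = frac h t"
  using frac_eq_iff[OF assms(1-4)] assms(5) by simp

lemmas poly_closure = mult_toric_polys add_toric_polys toric_denoms_mult[OF prime_p] denoms_toric
  one_toric_denoms[OF prime_p] one_toric_polys zero_toric_polys

lemma cring_L: "cring L"
proof (rule cringI)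
  show "abelian_group L"
  proof (rule abelian_groupI)
    fix x y assume x: "x \<in> carrier L" and y: "y \<in> carrier L"
    obtain g s where g: "g \<in> polys" "s \<in> denoms" "x = frac g s" using L_elem[OF x] .
    obtain h t where h: "h \<in> polys" "t \<in> denoms" "y = frac h t" using L_elem[OF y] .
    show "x \<oplus>\<^bsub>L\<^esub> y \<in> carrier L" using g h by (simp add: frac_add frac_closed poly_closure)
    show "x \<oplus>\<^bsub>L\<^esub> y = y \<oplus>\<^bsub>L\<^esub> x"
      using g h by (simp add: frac_add poly_closure) (rule frac_eqI; simp add: poly_closure algebra_simps)
  next
    fix x y z assume x: "x \<in> carrier L" and y: "y \<in> carrier L" and z: "z \<in> carrier L"
    obtain g s where g: "g \<in> polys" "s \<in> denoms" "x = frac g s" using L_elem[OF x] .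
    obtain h t where h: "h \<in> polys" "t \<in> denoms" "y = frac h t" using L_elem[OF y] .
    obtain k u where k: "k \<in> polys" "u \<in> denoms" "z = frac k u" using L_elem[OF z] .
    show "x \<oplus>\<^bsub>L\<^esub> y \<oplus>\<^bsub>L\<^esub> z = x \<oplus>\<^bsub>L\<^esub> (y \<oplus>\<^bsub>L\<^esub> z)"
      using g h k by (simp add: frac_add poly_closure) (rule frac_eqI; simp add: poly_closure algebra_simps)
  next
    show "\<zero>\<^bsub>L\<^esub> \<in> carrier L" by (simp add: L_simps(2,3) frac_closed poly_closure)
  next
    fix x assume "x \<in> carrier L"
    then obtain g s where g: "g \<in> polys" "s \<in> denoms" "x = frac g s" using L_elem by blast
    show "\<zero>\<^bsub>L\<^esub> \<oplus>\<^bsub>L\<^esub> x = x" using g by (simp add: L_simps(2,3) frac_add poly_closure)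
    have n: "0 - g \<in> polys" using g by (intro diff_toric_polys) auto
    have "frac (0 - g) s \<oplus>\<^bsub>L\<^esub> x = frac (s * (0 - g) + s * g) (s * s)"
      using g n by (simp only: frac_add)
    also have "\<dots> = \<zero>\<^bsub>L\<^esub>" using g by (simp add: L_simps(2,3)) (rule frac_eqI; simp add: poly_closure)
    finally show "\<exists>y\<in>carrier L. y \<oplus>\<^bsub>L\<^esub> x = \<zero>\<^bsub>L\<^esub>" using frac_closed[OF n g(2)] by blast
  qed
  show "comm_monoid L"
  proof (rule comm_monoidI)
    fix x y assume x: "x \<in> carrier L" and y: "y \<in> carrier L"
    obtain g s where g: "g \<in> polys" "s \<in> denoms" "x = frac g s" using L_elem[OF x] .
    obtain h t where h: "h \<in> polys" "t \<in> denoms" "y = frac h t" using L_elem[OF y] .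
    show "x \<otimes>\<^bsub>L\<^esub> y \<in> carrier L" using g h by (simp add: frac_mult frac_closed poly_closure)
    show "x \<otimes>\<^bsub>L\<^esub> y = y \<otimes>\<^bsub>L\<^esub> x" using g h by (simp add: frac_mult mult.commute)
  next
    fix x y z assume x: "x \<in> carrier L" and y: "y \<in> carrier L" and z: "z \<in> carrier L"
    obtain g s where g: "g \<in> polys" "s \<in> denoms" "x = frac g s" using L_elem[OF x] .
    obtain h t where h: "h \<in> polys" "t \<in> denoms" "y = frac h t" using L_elem[OF y] .
    obtain k u where k: "k \<in> polys" "u \<in> denoms" "z = frac k u" using L_elem[OF z] .
    show "x \<otimes>\<^bsub>L\<^esub> y \<otimes>\<^bsub>L\<^esub> z = x \<otimes>\<^bsub>L\<^esub> (y \<otimes>\<^bsub>L\<^esub> z)"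
      using g h k by (simp add: frac_mult poly_closure mult.assoc)
  next
    show "\<one>\<^bsub>L\<^esub> \<in> carrier L" by (simp add: L_simps(2,3) frac_closed poly_closure)
  next
    fix x assume "x \<in> carrier L"
    then obtain g s where g: "g \<in> polys" "s \<in> denoms" "x = frac g s" using L_elem by blast
    show "\<one>\<^bsub>L\<^esub> \<otimes>\<^bsub>L\<^esub> x = x" using g by (simp add: L_simps(2,3) frac_mult poly_closure)
  qed
  fix x y z assume x: "x \<in> carrier L" and y: "y \<in> carrier L" and z: "z \<in> carrier L"
  obtain g s where g: "g \<in> polys" "s \<in> denoms" "x = frac g s" using L_elem[OF x] .
  obtain h t where h: "h \<in> polys" "t \<in> denoms" "y = frac h t" using L_elem[OF y] .
  obtain k u where k: "k \<in> polys" "u \<in> denoms" "z = frac k u" using L_elem[OF z] .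
  show "(x \<oplus>\<^bsub>L\<^esub> y) \<otimes>\<^bsub>L\<^esub> z = x \<otimes>\<^bsub>L\<^esub> z \<oplus>\<^bsub>L\<^esub> y \<otimes>\<^bsub>L\<^esub> z"
    using g h k by (simp add: frac_add frac_mult poly_closure) (rule frac_eqI; simp add: poly_closure algebra_simps)
qed

theorem toric_local_ring_localization: "toric_local_ring L p n (\<lambda>g. frac g 1)"
proof (intro toric_local_ring.intro cring_L toric_local_ring_axioms.intro prime_p n_pos)
  fix f g assume f: "f \<in> polys" and g: "g \<in> polys"
  show "frac g 1 \<in> carrier L" using g by (simp add: frac_closed poly_closure)
  show "frac (f + g) 1 = frac f 1 \<oplus>\<^bsub>L\<^esub> frac g 1" using f g by (simp add: frac_add poly_closure)
  show "frac (f * g) 1 = frac f 1 \<otimes>\<^bsub>L\<^esub> frac g 1" using f g by (simp add: frac_mult poly_closure)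
  show "frac g 1 = \<zero>\<^bsub>L\<^esub> \<longleftrightarrow> vanishes_mod p g"
    using g by (simp add: L_simps(2,3) frac_eq_iff poly_closure)
next
  show "frac 1 1 = \<one>\<^bsub>L\<^esub>" by (simp add: L_simps(2,3))
next
  fix g assume g: "g \<in> polys" "\<not> int p dvd coef g 0"
  interpret L: cring L by (rule cring_L)
  have gd: "g \<in> denoms" using g by (simp add: toric_denoms_def)
  have c: "frac 1 g \<in> carrier L" "frac g 1 \<in> carrier L" using g gd by (simp_all add: frac_closed poly_closure)
  have "frac 1 g \<otimes>\<^bsub>L\<^esub> frac g 1 = \<one>\<^bsub>L\<^esub>"
    using g gd by (simp add: L_simps(2,3) frac_mult poly_closure) (rule frac_eqI; simp add: poly_closure)
  then show "frac g 1 \<in> Units L"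
    unfolding Units_def using c L.m_comm[OF c] by auto
next
  fix r assume "r \<in> carrier L"
  then obtain g s where g: "g \<in> polys" "s \<in> denoms" "r = frac g s" using L_elem by blast
  have "frac s 1 \<otimes>\<^bsub>L\<^esub> r = frac g 1"
    using g by (simp add: frac_mult poly_closure) (rule frac_eqI; simp add: poly_closure)
  then show "\<exists>g\<in>polys. \<exists>s\<in>polys. \<not> int p dvd coef s 0 \<and> frac s 1 \<otimes>\<^bsub>L\<^esub> r = frac g 1"
    using g by (auto simp: toric_denoms_def)
qed

end

theorem theorem2:
  fixes p n :: nat
  assumes "prime p" and "n \<ge> 2"
  shows "F_signature p (localization_at (B_ring n p) (B_max n p)) =
    (fact n)\<^sup>2 / fact (2 * n - 1)"
proof -
  interpret hypersurface p n using assms by unfold_locales auto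
  show ?thesis by (rule toric_local_ring.F_signature_eq[OF toric_local_ring_localization])
qed

end
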